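(* Let $\mathcal{C}$ be a simplicial complex on a finite ground set. The following are equivalent: (1) $\mathcal{C}$ is unimodular; (2) $\mathcal{C}$ is $\beta$-avoiding; (3) $\mathcal{C}$ is nuclear.
   Context: A simplicial complex $\mathcal{C}$ on a finite ground set $V$ is a family of subsets of $V$ closed under taking subsets (the void complex $\{\}$ and the irrelevant complex $\{\emptyset\}$ are allowed). Elements of $V$ lying in no face are called ghost vertices. Facets are inclusion-maximal faces. Two complexes are isomorphic if there is a bijection of ground sets carrying faces onto faces; all equalities of complexes below are up to isomorphism. For $\mathbf{d}=(d_v)_{v\in V}$ with all $d_v\ge 2$, $\mathcal{A}_{\mathcal{C},\mathbf{d}}$ is the $0/1$ matrix whose columns are indexed by $\mathbf{i}\in\prod_{v\in V}[d_v]$ and whose rows are indexed by pairs $(F,\mathbf{e})$ with $F$ a facet of $\mathcal{C}$ and $\mathbf{e}\in\prod_{v\in F}[d_v]$; the entry is $1$ iff $\mathbf{e}=\mathbf{i}|_F$. Write $\mathcal{A}_{\mathcal{C}}=\mathcal{A}_{\mathcal{C},\mathbf{2}}$ (all $d_v=2$). An integer matrix $A$ is unimodular if every circuit of $A$ (a nonzero integer vector $u\in\ker A$ with relatively prime entries such that no nonzero kernel vector has support strictly contained in that of $u$) has all entries in $\{0,1,-1\}$; equivalently, if $\operatorname{rank}A=d$ and $A$ has $d$ rows, all $d\times d$ minors lie in $\{0,\pm\lambda\}$ for some $\lambda$. $\mathcal{C}$ is unimodular if $\mathcal{A}_{\mathcal{C}}$ is. Operations: for $W\subseteq V$, the induced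 subcomplex is $\{F\in\mathcal{C}:F\subseteq W\}$ on ground set $W$; $\mathcal{C}\setminus S$ denotes the induced subcomplex on $V\setminus S$. For a face $S$, $\operatorname{link}_S(\mathcal{C})=\{F\setminus S: F\in\mathcal{C}, S\subseteq F\}$ on ground set $V\setminus S$. A minor of $\mathcal{C}$ is any $\operatorname{link}_R(\mathcal{C}\setminus S)$ with $S,R\subseteq V$ disjoint and $R$ a face of $\mathcal{C}$. The Alexander dual is $\mathcal{C}^*=\{S\subseteq V: V\setminus S\notin\mathcal{C}\}$ on $V$. $\Delta_k$ ($k\ge0$) is the complex on a $(k+1)$-set with that set as its only facet; $\Delta_{-1}=\{\emptyset\}$ and $\Delta_{-2}=\{\}$ on the empty ground set. $\partial\Delta_n$ is the complex of all proper subsets of an $(n+1)$-set. $\sqcup$ denotes disjoint union (ground sets and faces). $D_{m,n}=(\Delta_m\sqcup\Delta_n)^*$. $\operatorname{cone}^p(\mathcal{C})$ is the complex on $V\cup\{u_1,\dots,u_p\}$ (new vertices) with facets $F\cup\{u_1,\dots,u_p\}$, $F$ a facet of $\mathcal{C}$. $G(\mathcal{C})$ is $\mathcal{C}$ on ground set $V\cup\{w\}$ with $w$ a new (ghost) vertex. For $\mathcal{C}$ on $[n]$, the Lawrence lifting $\Lambda(\mathcal{C})$ is the complex on $[n+1]$ with facets $[n]$ and $F\cup\{n+1\}$, $F$ a facet of $\mathcal{C}$. $\beta$-avoiding: $\mathcal{C}$ has no minor isomorphic to any of: $P_4$ (ground set $\{1,2,3,4\}$, facets $12,23,34$); $O_6$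 (ground set $\{1,\dots,6\}$, faces the subsets containing none of the pairs $\{1,2\},\{3,4\},\{5,6\}$) or its Alexander dual $O_6^*$; $J_1$ (on $\{1,\dots,5\}$, facets $12,15,234,345$) or $J_1^*$ (on $\{1,\dots,5\}$, facets $134,235,245$); $J_2$ (on $\{1,\dots,5\}$, facets $12,235,34,145$); $\partial\Delta_n\sqcup\{v\}$ for $n\ge1$ (i.e. $\partial\Delta_n$ disjoint union with a single vertex complex $\Delta_0$). Nuclear: $\mathcal{C}$ is nuclear if it is (isomorphic to) one of: $\Lambda(\mathcal{D})$ with $\mathcal{D}$ nuclear; $G(\mathcal{D})$ with $\mathcal{D}$ nuclear; $\operatorname{cone}^p(\Delta_m\sqcup\Delta_n)$ with $p,m,n\ge0$; $\operatorname{cone}^p(D_{m,n})$ with $p\ge0$, $m,n\ge1$; $\Delta_k$ with $k\ge-2$. *)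

theory Defs
  imports Main "HOL-Library.FuncSet"
begin

text \<open>A complex is a pair (ground set V, set of faces C).\<close>
type_synonym 'a cx = "'a set \<times> 'a set set"

definition simplicial_complex :: "'a set \<Rightarrow> 'a set set \<Rightarrow> bool" where
  "simplicial_complex V C \<longleftrightarrow> finite V \<and> C \<subseteq> Pow V \<and> (\<forall>F\<in>C. \<forall>G. G \<subseteq> F \<longrightarrow> G \<in> C)"

definition facets :: "'a set set \<Rightarrow> 'a set set" where
  "facets C = {F \<in> C. \<forall>G\<in>C. F \<subseteq> G \<longrightarrow> G = F}"

definition cx_iso :: "'a cx \<Rightarrow> 'b cx \<Rightarrow> bool" where
  "cx_iso K L \<longleftrightarrow> (\<exists>f. bij_betw f (fst K) (fst L) \<and> snd L = (\<lambda>F. f ` F) ` snd K)"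

section \<open>The matrix A_C (all d_v = 2, with [2] encoded as {0,1}) and unimodularity\<close>

definition AC_cols :: "'a set \<Rightarrow> ('a \<Rightarrow> nat) set" where
  "AC_cols V = (\<Pi>\<^sub>E v\<in>V. {0,1})"

definition AC_rows :: "'a set set \<Rightarrow> ('a set \<times> ('a \<Rightarrow> nat)) set" where
  "AC_rows C = {(F, e). F \<in> facets C \<and> e \<in> (\<Pi>\<^sub>E v\<in>F. {0,1})}"

definition AC_entry :: "('a set \<times> ('a \<Rightarrow> nat)) \<Rightarrow> ('a \<Rightarrow> nat) \<Rightarrow> int" where
  "AC_entry r i = (if snd r = restrict i (fst r) then 1 else 0)"

definition in_kernel :: "'a set \<Rightarrow> 'a set set \<Rightarrow> (('a \<Rightarrow> nat) \<Rightarrow> int) \<Rightarrow> bool" where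
  "in_kernel V C u \<longleftrightarrow> (\<forall>i. i \<notin> AC_cols V \<longrightarrow> u i = 0) \<and>
     (\<forall>r\<in>AC_rows C. (\<Sum>i\<in>AC_cols V. AC_entry r i * u i) = 0)"

definition supp :: "(('a \<Rightarrow> nat) \<Rightarrow> int) \<Rightarrow> ('a \<Rightarrow> nat) set" where
  "supp u = {i. u i \<noteq> 0}"

definition is_circuit :: "'a set \<Rightarrow> 'a set set \<Rightarrow> (('a \<Rightarrow> nat) \<Rightarrow> int) \<Rightarrow> bool" where
  "is_circuit V C u \<longleftrightarrow> in_kernel V C u \<and> supp u \<noteq> {} \<and> Gcd (u ` AC_cols V) = 1 \<and>
     \<not> (\<exists>w. in_kernel V C w \<and> supp w \<noteq> {} \<and> supp w \<subset> supp u)"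

definition unimodular :: "'a set \<Rightarrow> 'a set set \<Rightarrow> bool" where
  "unimodular V C \<longleftrightarrow> (\<forall>u. is_circuit V C u \<longrightarrow> (\<forall>i. u i \<in> {-1, 0, 1}))"

definition del :: "'a set \<Rightarrow> 'a cx \<Rightarrow> 'a cx" where
  "del S K = (fst K - S, {F \<in> snd K. F \<subseteq> fst K - S})"

definition link :: "'a set \<Rightarrow> 'a cx \<Rightarrow> 'a cx" where
  "link R K = (fst K - R, {F - R | F. F \<in> snd K \<and> R \<subseteq> F})"

definition is_minor :: "'a cx \<Rightarrow> 'a cx \<Rightarrow> bool" where
  "is_minor M K \<longleftrightarrow> (\<exists>S R. S \<subseteq> fst K \<and> R \<subseteq> fst K \<and> S \<inter> R = {} \<and> R \<in> snd K \<and>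
      M = link R (del S K))"

definition alex_dual :: "'a cx \<Rightarrow> 'a cx" where
  "alex_dual K = (fst K, {S. S \<subseteq> fst K \<and> fst K - S \<notin> snd K})"

definition gen :: "'a set \<Rightarrow> 'a set set \<Rightarrow> 'a cx" where
  "gen V Fs = (V, {G. \<exists>F\<in>Fs. G \<subseteq> F})"

definition P4 :: "nat cx" where "P4 = gen {1..4} {{1,2},{2,3},{3,4}}"

definition O6 :: "nat cx" where
  "O6 = ({1..6}, {S. S \<subseteq> {1..6} \<and> \<not> {1,2} \<subseteq> S \<and> \<not> {3,4} \<subseteq> S \<and> \<not> {5,6} \<subseteq> S})"

definition J1 :: "nat cx" where "J1 = gen {1..5} {{1,2},{1,5},{2,3,4},{3,4,5}}"

definition J1_dual :: "nat cx" where "J1_dual = gen {1..5} {{1,3,4},{2,3,5},{2,4,5}}"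

definition J2 :: "nat cx" where "J2 = gen {1..5} {{1,2},{2,3,5},{3,4},{1,4,5}}"

definition bdry_plus_pt :: "nat \<Rightarrow> nat cx" where
  "bdry_plus_pt n = ({0..Suc n}, {G. G \<subset> {0..n}} \<union> {{}, {Suc n}})"

definition beta_avoiding :: "'a set \<Rightarrow> 'a set set \<Rightarrow> bool" where
  "beta_avoiding V C \<longleftrightarrow> \<not> (\<exists>M. is_minor M (V, C) \<and>
     (cx_iso M P4 \<or> cx_iso M O6 \<or> cx_iso M (alex_dual O6) \<or> cx_iso M J1 \<or> cx_iso M J1_dual \<or>
      cx_iso M J2 \<or> (\<exists>n\<ge>1. cx_iso M (bdry_plus_pt n))))"

definition lawrence :: "'a \<Rightarrow> 'a cx \<Rightarrow> 'a cx" where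
  "lawrence w K = (insert w (fst K), {G. G \<subseteq> fst K \<or> (\<exists>F\<in>snd K. G \<subseteq> insert w F)})"

definition ghost :: "'a \<Rightarrow> 'a cx \<Rightarrow> 'a cx" where
  "ghost w K = (insert w (fst K), snd K)"

text \<open>cone^p with new vertex set U (|U| = p): facets F \<union> U, F facet of C.\<close>
definition cone :: "'a set \<Rightarrow> 'a cx \<Rightarrow> 'a cx" where
  "cone U K = (fst K \<union> U, {G. \<exists>F\<in>snd K. G \<subseteq> F \<union> U})"

definition two_simplices :: "'a set \<Rightarrow> 'a set \<Rightarrow> 'a cx" where
  "two_simplices A B = (A \<union> B, {G. G \<subseteq> A \<or> G \<subseteq> B})"

inductive nuclear_nat :: "nat cx \<Rightarrow> bool" where
  lawrence: "nuclear_nat D \<Longrightarrow> w \<notin> fst D \<Longrightarrow> nuclear_nat (lawrence w D)"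
| ghost: "nuclear_nat D \<Longrightarrow> w \<notin> fst D \<Longrightarrow> nuclear_nat (ghost w D)"
| cone_simplices: "finite A \<Longrightarrow> finite B \<Longrightarrow> finite U \<Longrightarrow> A \<noteq> {} \<Longrightarrow> B \<noteq> {} \<Longrightarrow>
     A \<inter> B = {} \<Longrightarrow> A \<inter> U = {} \<Longrightarrow> B \<inter> U = {} \<Longrightarrow> nuclear_nat (cone U (two_simplices A B))"
| cone_D: "finite A \<Longrightarrow> finite B \<Longrightarrow> finite U \<Longrightarrow> card A \<ge> 2 \<Longrightarrow> card B \<ge> 2 \<Longrightarrow>
     A \<inter> B = {} \<Longrightarrow> A \<inter> U = {} \<Longrightarrow> B \<inter> U = {} \<Longrightarrow>
     nuclear_nat (cone U (alex_dual (two_simplices A B)))"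
| void: "nuclear_nat ({}, {})"
| simplex: "finite A \<Longrightarrow> nuclear_nat (A, Pow A)"
| iso: "nuclear_nat D \<Longrightarrow> cx_iso D D' \<Longrightarrow> nuclear_nat D'"

definition nuclear :: "'a set \<Rightarrow> 'a set set \<Rightarrow> bool" where
  "nuclear V C \<longleftrightarrow> (\<exists>D. nuclear_nat D \<and> cx_iso (V, C) D)"

end

theory Submission
  imports Defs
begin

text \<open>Call a space of integer vectors regular if below the support of each of its nonzero members it has a
nonzero member with entries in \<open>{-1, 0, 1}\<close>; unimodularity is regularity of the kernel of \<open>A_C\<close>.
Indexing columns by subsets of \<open>V\<close>, that kernel consists of the functions all of whose marginals on
faces vanish, so it restricts along deletions and links and can be computed for each nuclear
construction: two simplices give the cycle space of a complete bipartite graph, their dual gives its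
cut space.

The excluded minors are not regular because of a parity obstruction: some point \<open>b\<close> lies in the support
of a kernel vector \<open>u\<close>, yet an integral combination of marginals forces \<open>w b\<close> to be even for every kernel
vector \<open>w\<close> supported on the support of \<open>u\<close>.

A ghost vertex or a vertex whose deletion is a simplex can be removed from a nuclear description.
For an avoiding complex without such vertices, excluding \<open>P4\<close> and boundaries of simplices plus a point
forces every non-edge \<open>{a, b}\<close> to extend to two disjoint simplices, completely joined in the 1-skeleton
to the remaining vertices; the links of those vertices are known by induction, and \<open>J1\<close>, \<open>J1_dual\<close>,
\<open>J2\<close>, \<open>O6\<close> exclude all configurations but the two nuclear ones. Alexander duality preserves everything,
so one may also use a non-edge of the dual, and a complex with neither kind of non-edge
does not exist.\<close>

section \<open>Regular kernels and unimodularity\<close>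

text \<open>A circuit has minimal support and coprime entries, and both properties get lost when a
  vector is extended or sliced. Regularity asks only for some unit vector below a given support. In
  a space closed under integral combinations that vector can be chosen to be nonzero at any
  prescribed point of the support, and this is how a parity constraint at a single point becomes a
  contradiction. The obstacle in the structural half is that the induction hypothesis speaks of
  complexes without ghosts and without simplex deletions, while the link of a vertex has no ghosts
  only if that vertex is adjacent to all others. So the graph of non-edges must be understood before
  any link is used: it is triangle-free and its components are complete bipartite, and vertices
  adjacent to all others appear outside these components. When neither the complex nor its dual has
  a non-edge, links and vertex deletions both satisfy the induction hypothesis, and their shapes
  clash: a link made of two simplices produces overlapping minimal nonfaces, whereas the minimal
  nonfaces of the dual shape are disjoint.\<close>

abbreviation has_unit_below :: "('b \<Rightarrow> int) set \<Rightarrow> ('b \<Rightarrow> int) \<Rightarrow> bool" where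
  "has_unit_below K u \<equiv>
     \<exists>w\<in>K. (\<exists>x. w x \<noteq> 0) \<and> (\<forall>x. w x \<noteq> 0 \<longrightarrow> u x \<noteq> 0) \<and> (\<forall>x. w x \<in> {-1, 0, 1})"

text \<open>For groups of integer vectors with finite supports this is Tutte's regular chain group
  in an equivalent form. Minimal supports and gcds appear only in
  \<open>regular_iff_circuits\<close>.\<close>

definition regular :: "('b \<Rightarrow> int) set \<Rightarrow> bool" where
  "regular K \<longleftrightarrow> (\<forall>u\<in>K. (\<exists>x. u x \<noteq> 0) \<longrightarrow> has_unit_below K u)"

text \<open>A column is encoded by the set of vertices where its index is 1, a row by a face
  \<open>F\<close> and a trace \<open>E\<close>. All faces occur, not only the facets, since facets
  behave badly under deletion and link.\<close>

definition marg_ker :: "'a set \<Rightarrow> 'a set set \<Rightarrow> ('a set \<Rightarrow> int) set" where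
  "marg_ker V C = {u. (\<forall>X. \<not> X \<subseteq> V \<longrightarrow> u X = 0) \<and>
     (\<forall>F\<in>C. \<forall>E. (\<Sum>X | X \<subseteq> V \<and> X \<inter> F = E. u X) = 0)}"

lemma regularD:
  assumes "regular K" "u \<in> K" "u x \<noteq> 0"
  obtains w y where "w \<in> K" "w y \<noteq> 0" "\<And>x. w x \<noteq> 0 \<Longrightarrow> u x \<noteq> 0" "\<And>x. w x \<in> {-1, 0, 1}"
  using assms unfolding regular_def by blast

text \<open>If a unit vector \<open>w\<close> below \<open>u\<close> vanishes at \<open>b\<close>,
  eliminating from \<open>u\<close> a point \<open>y\<close> of the support of \<open>w\<close>
  shrinks the support and keeps \<open>b\<close>.\<close>

lemma regular_through_point:
  assumes reg: "regular K" and fin: "\<And>u. u \<in> K \<Longrightarrow> finite {x. u x \<noteq> 0}"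
    and comb: "\<And>u w c d. u \<in> K \<Longrightarrow> w \<in> K \<Longrightarrow> (\<lambda>x. c * u x + d * w x) \<in> K"
    and u: "u \<in> K" "u b \<noteq> 0"
  shows "\<exists>w\<in>K. w b \<noteq> 0 \<and> (\<forall>x. w x \<noteq> 0 \<longrightarrow> u x \<noteq> 0) \<and> (\<forall>x. w x \<in> {-1, 0, 1})"
  using u
proof (induction "card {x. u x \<noteq> 0}" arbitrary: u rule: less_induct)
  case less
  obtain w y where w: "w \<in> K" "w y \<noteq> 0" "\<And>x. w x \<noteq> 0 \<Longrightarrow> u x \<noteq> 0" "\<And>x. w x \<in> {-1, 0, 1}"
    using regularD[OF reg less.prems] by metis
  show ?case
  proof (cases "w b = 0")
    case True
    define u' where "u' = (\<lambda>x. w y * u x + (- u y) * w x)"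
    have u': "u' \<in> K" "u' b \<noteq> 0"
      unfolding u'_def using comb[OF less.prems(1) w(1), of "w y" "- u y"] less.prems(2) w(2) True by auto
    have sub: "u x \<noteq> 0" if "u' x \<noteq> 0" for x
      using that w(3)[of x] unfolding u'_def by auto
    have "u' y = 0" by (simp add: u'_def)
    then have "{x. u' x \<noteq> 0} \<subset> {x. u x \<noteq> 0}"
      using sub w(3)[OF w(2)] by blast
    then have "card {x. u' x \<noteq> 0} < card {x. u x \<noteq> 0}"
      by (rule psubset_card_mono[OF fin[OF less.prems(1)]])
    from less.hyps[OF this u'] show ?thesis using sub by blast
  qed (use w in blast)
qed

text \<open>A unit vector below a circuit is proportional to it by minimality, and coprimality makes
  the factor a sign. Conversely, a vector of minimal support below \<open>u\<close>, divided by its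
  gcd, is a circuit; \<open>sat\<close> allows the division.\<close>

lemma regular_iff_circuits:
  assumes finA: "finite A" and out: "\<And>u x. u \<in> K \<Longrightarrow> x \<notin> A \<Longrightarrow> u x = 0"
    and comb: "\<And>u w c d. u \<in> K \<Longrightarrow> w \<in> K \<Longrightarrow> (\<lambda>x. c * u x + d * w x) \<in> K"
    and sat: "\<And>u (c::int). c \<noteq> 0 \<Longrightarrow> (\<lambda>x. c * u x) \<in> K \<Longrightarrow> u \<in> K"
  shows "regular K \<longleftrightarrow> (\<forall>u. u \<in> K \<and> {x. u x \<noteq> 0} \<noteq> {} \<and> Gcd (u ` A) = 1 \<and>
      \<not> (\<exists>w. w \<in> K \<and> {x. w x \<noteq> 0} \<noteq> {} \<and> {x. w x \<noteq> 0} \<subset> {x. u x \<noteq> 0}) \<longrightarrow> (\<forall>x. u x \<in> {-1, 0, 1}))"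
    (is "_ \<longleftrightarrow> (\<forall>u. ?circ u \<longrightarrow> _)")
proof (intro iffI allI impI)
  fix u x
  assume reg: "regular K" and u: "?circ u"
  then obtain z where "u z \<noteq> 0" by auto
  with u obtain w y where w: "w \<in> K" "w y \<noteq> 0" "\<And>x. w x \<noteq> 0 \<Longrightarrow> u x \<noteq> 0" "\<And>x. w x \<in> {-1, 0, 1}"
    using regularD[OF reg, of u z] by metis
  \<comment> \<open>Since \<open>w y\<close> is 1 or -1, the multiple \<open>u y * w y\<close> of
    \<open>w\<close> agrees with \<open>u\<close> at \<open>y\<close>, so \<open>v\<close> loses the
    point \<open>y\<close>.\<close>
  define v where "v = (\<lambda>x. 1 * u x + (- u y * w y) * w x)"
  have vK: "v \<in> K" unfolding v_def using comb u w(1) by blast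
  have wy: "w y * w y = 1" using w(2) w(4)[of y] by auto
  have "v y = 0" unfolding v_def using wy by (simp add: mult.assoc)
  moreover have "u y \<noteq> 0" using w by blast
  moreover have "u x \<noteq> 0" if "v x \<noteq> 0" for x using that w(3)[of x] unfolding v_def by auto
  ultimately have "{x. v x \<noteq> 0} \<subset> {x. u x \<noteq> 0}" by auto
  with u vK have "{x. v x \<noteq> 0} = {}" by blast
  then have v0: "v x = 0" for x by blast
  have "v x = u x - u y * (w y * w x)" for x by (simp add: v_def mult.assoc)
  then have eq: "u x = u y * (w y * w x)" for x using v0[of x] by (metis eq_iff_diff_eq_0)
  have "u y dvd u x" for x using eq[of x] by (metis dvd_triv_left)
  then have "u y dvd Gcd (u ` A)" by (intro Gcd_greatest) auto
  with u have "u y dvd 1" by simp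
  then have "\<bar>u y\<bar> = 1" by simp
  then show "u x \<in> {-1, 0, 1}" using eq[of x] w(4)[of x] w(4)[of y] by (auto simp: abs_if split: if_splits)
next
  assume R: "\<forall>u. ?circ u \<longrightarrow> (\<forall>x. u x \<in> {-1, 0, 1})"
  show "regular K" unfolding regular_def
  proof (intro ballI impI)
    fix u assume u: "u \<in> K" "\<exists>x. u x \<noteq> 0"
    define T where "T = {w \<in> K. (\<exists>x. w x \<noteq> 0) \<and> (\<forall>x. w x \<noteq> 0 \<longrightarrow> u x \<noteq> 0)}"
    have "u \<in> T" using u unfolding T_def by auto
    then obtain w where w: "w \<in> T" and min: "\<And>v. v \<in> T \<Longrightarrow> card {x. w x \<noteq> 0} \<le> card {x. v x \<noteq> 0}"
      using ex_has_least_nat[of "\<lambda>w. w \<in> T" u "\<lambda>w. card {x. w x \<noteq> 0}"] by blast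
    define g where "g = Gcd (w ` A)"
    obtain z where z: "w z \<noteq> 0" using w unfolding T_def by auto
    have zA: "z \<in> A" using out[of w z] z w unfolding T_def by auto
    have gd: "g dvd w x" for x
      using out[of w x] w unfolding g_def T_def by (cases "x \<in> A") auto
    have g0: "g \<noteq> 0" using gd[of z] z by auto
    define v where "v = (\<lambda>x. w x div g)"
    have wv: "w x = g * v x" for x unfolding v_def using gd by simp
    have vK: "v \<in> K" using sat[OF g0, of v] w unfolding T_def wv[symmetric] by simp
    have sv: "v x \<noteq> 0 \<longleftrightarrow> w x \<noteq> 0" for x using wv[of x] g0 by auto
    have "w ` A = (\<lambda>x. g * x) ` (v ` A)" unfolding image_image wv[symmetric] by simp
    then have "g = normalize (g * Gcd (v ` A))" unfolding g_def by (metis Gcd_mult)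
    then have "\<bar>g\<bar> * Gcd (v ` A) = \<bar>g\<bar>" by (metis abs_mult abs_idempotent abs_Gcd_eq normalize_int_def g_def)
    then have gcd1: "Gcd (v ` A) = 1" using g0 by simp
    have nosub: False if "y \<in> K" "{x. y x \<noteq> 0} \<noteq> {}" "{x. y x \<noteq> 0} \<subset> {x. v x \<noteq> 0}" for y
    proof -
      have "y \<in> T" using that sv w unfolding T_def by blast
      moreover have "card {x. y x \<noteq> 0} < card {x. w x \<noteq> 0}"
      proof (rule psubset_card_mono)
        have "{x. w x \<noteq> 0} \<subseteq> A" using out w unfolding T_def by auto
        then show "finite {x. w x \<noteq> 0}" using finA finite_subset by blast
        show "{x. y x \<noteq> 0} \<subset> {x. w x \<noteq> 0}" using that(3) sv by simp
      qed
      ultimately show False using min by fastforce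
    qed
    have "?circ v" using vK gcd1 z sv nosub by blast
    then have "\<forall>x. v x \<in> {-1, 0, 1}" using R by blast
    moreover have "v z \<noteq> 0" "\<forall>x. v x \<noteq> 0 \<longrightarrow> u x \<noteq> 0" using z sv w unfolding T_def by auto
    ultimately show "has_unit_below K u"
      using vK by blast
  qed
qed

section \<open>From index functions to subsets of the ground set\<close>

definition ind :: "'a set \<Rightarrow> 'a set \<Rightarrow> 'a \<Rightarrow> nat" where
  "ind V X = (\<lambda>v\<in>V. if v \<in> X then 1 else 0)"

lemma bij_betw_ind: "bij_betw (ind V) (Pow V) (AC_cols V)"
proof (rule bij_betwI[where g = "\<lambda>i. {v \<in> V. i v = 1}"])
  show "ind V \<in> Pow V \<rightarrow> AC_cols V" by (auto simp: ind_def AC_cols_def)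
  show "(\<lambda>i. {v \<in> V. i v = 1}) \<in> AC_cols V \<rightarrow> Pow V" by auto
  show "{v \<in> V. ind V X v = 1} = X" if "X \<in> Pow V" for X using that by (auto simp: ind_def)
  show "ind V {v \<in> V. i v = 1} = i" if "i \<in> AC_cols V" for i
  proof
    fix v show "ind V {v \<in> V. i v = 1} v = i v"
      using that by (cases "v \<in> V") (auto simp: ind_def AC_cols_def PiE_def extensional_def Pi_iff)
  qed
qed

lemma ind_eq_iff: "X \<subseteq> V \<Longrightarrow> Y \<subseteq> V \<Longrightarrow> ind V X = ind V Y \<longleftrightarrow> X = Y"
  using bij_betw_ind[of V] by (auto simp: bij_betw_def inj_on_def)

lemma restrict_ind: "F \<subseteq> V \<Longrightarrow> restrict (ind V X) F = ind F (X \<inter> F)"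
  by (auto simp: ind_def restrict_def fun_eq_iff)

lemma facet_above:
  assumes "simplicial_complex V C" "F \<in> C" obtains G where "G \<in> facets C" "F \<subseteq> G"
proof -
  have "finite C" using assms(1) finite_subset[of C "Pow V"] by (auto simp: simplicial_complex_def)
  from finite_has_maximal2[OF this assms(2)]
  obtain G where "G \<in> C" "F \<subseteq> G" "\<forall>H\<in>C. G \<subseteq> H \<longrightarrow> G = H" by blast
  then have "G \<in> facets C" by (auto simp: facets_def)
  then show ?thesis using \<open>F \<subseteq> G\<close> by (rule that)
qed

lemma marg_kerI:
  assumes "\<And>X. \<not> X \<subseteq> V \<Longrightarrow> u X = 0"
    and "\<And>F E. F \<in> C \<Longrightarrow> E \<subseteq> F \<Longrightarrow> (\<Sum>X | X \<subseteq> V \<and> X \<inter> F = E. u X) = 0"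
  shows "u \<in> marg_ker V C"
  unfolding marg_ker_def
proof (intro CollectI conjI allI impI ballI)
  fix F E assume F: "F \<in> C"
  show "(\<Sum>X | X \<subseteq> V \<and> X \<inter> F = E. u X) = 0"
  proof (cases "E \<subseteq> F")
    case False
    then have "{X. X \<subseteq> V \<and> X \<inter> F = E} = {}" by auto
    then show ?thesis by (metis sum.empty)
  qed (use assms F in blast)
qed (use assms in blast)

lemma marg_ker_outside: "u \<in> marg_ker V C \<Longrightarrow> \<not> X \<subseteq> V \<Longrightarrow> u X = 0"
  by (simp add: marg_ker_def)

lemma marg_ker_sum: "u \<in> marg_ker V C \<Longrightarrow> F \<in> C \<Longrightarrow> (\<Sum>X | X \<subseteq> V \<and> X \<inter> F = E. u X) = 0"
  by (simp add: marg_ker_def)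

text \<open>A marginal at a face is a sum of marginals at any facet above it, one for each
  compatible trace. Hence the rows of the matrix, which come from facets, already impose the
  conditions at all faces.\<close>

lemma marg_ker_facetsI:
  assumes sc: "simplicial_complex V C" and out: "\<And>X. \<not> X \<subseteq> V \<Longrightarrow> u X = 0"
    and fac: "\<And>F E. F \<in> facets C \<Longrightarrow> E \<subseteq> F \<Longrightarrow> (\<Sum>X | X \<subseteq> V \<and> X \<inter> F = E. u X) = 0"
  shows "u \<in> marg_ker V C"
proof (rule marg_kerI)
  fix F E assume F: "F \<in> C" "E \<subseteq> F"
  obtain G where G: "G \<in> facets C" "F \<subseteq> G" using facet_above[OF sc F(1)] .
  have finV: "finite V" using sc by (simp add: simplicial_complex_def)
  have "G \<subseteq> V" using G(1) sc by (auto simp: simplicial_complex_def facets_def)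
  then have finG: "finite G" using finV finite_subset by blast
  have "(\<Sum>X | X \<subseteq> V \<and> X \<inter> F = E. u X)
      = (\<Sum>E' | E' \<subseteq> G \<and> E' \<inter> F = E. \<Sum>X | X \<in> {X. X \<subseteq> V \<and> X \<inter> F = E} \<and> X \<inter> G = E'. u X)"
    by (rule sum.group[symmetric]) (use finV finG G in auto)
  also have "\<dots> = (\<Sum>E' | E' \<subseteq> G \<and> E' \<inter> F = E. 0)"
  proof (rule sum.cong[OF refl])
    fix E' assume E': "E' \<in> {E'. E' \<subseteq> G \<and> E' \<inter> F = E}"
    then have "{X \<in> {X. X \<subseteq> V \<and> X \<inter> F = E}. X \<inter> G = E'} = {X. X \<subseteq> V \<and> X \<inter> G = E'}"
      using G by auto
    then show "(\<Sum>X | X \<in> {X. X \<subseteq> V \<and> X \<inter> F = E} \<and> X \<inter> G = E'. u X) = 0"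
      using fac[OF G(1)] E' by simp
  qed
  finally show "(\<Sum>X | X \<subseteq> V \<and> X \<inter> F = E. u X) = 0" by simp
qed (rule out)

lemma in_kernel_iff:
  assumes sc: "simplicial_complex V C"
  shows "in_kernel V C u \<longleftrightarrow> (\<forall>i. i \<notin> AC_cols V \<longrightarrow> u i = 0) \<and>
    (\<lambda>X. if X \<subseteq> V then u (ind V X) else 0) \<in> marg_ker V C" (is "_ \<longleftrightarrow> _ \<and> ?u \<in> _")
proof -
  have finV: "finite V" using sc by (simp add: simplicial_complex_def)
  have sums: "(\<Sum>i\<in>AC_cols V. AC_entry (F, ind F E) i * u i) = (\<Sum>X | X \<subseteq> V \<and> X \<inter> F = E. ?u X)"
    if F: "F \<in> C" "E \<subseteq> F" for F E
  proof -
    have FV: "F \<subseteq> V" using F sc by (auto simp: simplicial_complex_def)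
    have "(\<Sum>i\<in>AC_cols V. AC_entry (F, ind F E) i * u i)
        = (\<Sum>X\<in>Pow V. AC_entry (F, ind F E) (ind V X) * u (ind V X))"
      by (rule sum.reindex_bij_betw[OF bij_betw_ind, symmetric])
    \<comment> \<open>The row \<open>(F, ind F E)\<close> has entry 1 in the column of
      \<open>X\<close> exactly when \<open>X\<close> has trace \<open>E\<close> on
      \<open>F\<close>.\<close>
    also have "\<dots> = (\<Sum>X\<in>Pow V. if X \<inter> F = E then ?u X else 0)"
      by (rule sum.cong) (use FV F in \<open>auto simp: AC_entry_def restrict_ind ind_eq_iff\<close>)
    also have "\<dots> = (\<Sum>X | X \<in> Pow V \<and> X \<inter> F = E. ?u X)"
      by (subst sum.inter_filter) (use finV in auto)
    finally show ?thesis by (simp add: conj_commute)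
  qed
  have rows: "AC_rows C = {(F, ind F E) | F E. F \<in> facets C \<and> E \<subseteq> F}"
  proof -
    have "(F \<rightarrow>\<^sub>E {0, 1}) = ind F ` Pow F" for F :: "'a set"
      using bij_betw_ind[of F] by (simp add: bij_betw_def AC_cols_def)
    then show ?thesis by (auto simp: AC_rows_def)
  qed
  have fC: "F \<in> facets C \<Longrightarrow> F \<in> C" for F by (simp add: facets_def)
  have "(\<forall>r\<in>AC_rows C. (\<Sum>i\<in>AC_cols V. AC_entry r i * u i) = 0) \<longleftrightarrow> ?u \<in> marg_ker V C" (is "?l \<longleftrightarrow> ?r")
  proof
    assume ?l
    show ?r
    proof (rule marg_ker_facetsI[OF sc])
      fix F E assume FE: "F \<in> facets C" "E \<subseteq> F"
      then have "(F, ind F E) \<in> AC_rows C" unfolding rows by blast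
      then show "(\<Sum>X | X \<subseteq> V \<and> X \<inter> F = E. ?u X) = 0"
        using \<open>?l\<close> sums[OF fC[OF FE(1)] FE(2)] by metis
    qed simp
  next
    assume ?r
    show ?l
    proof
      fix r assume "r \<in> AC_rows C"
      then obtain F E where r: "r = (F, ind F E)" "F \<in> C" "E \<subseteq> F" unfolding rows using fC by blast
      show "(\<Sum>i\<in>AC_cols V. AC_entry r i * u i) = 0"
        unfolding r(1) sums[OF r(2,3)] using marg_ker_sum[OF \<open>?r\<close> r(2)] .
    qed
  qed
  then show ?thesis by (simp add: in_kernel_def)
qed

lemma marg_ker_comb:
  "u \<in> marg_ker V C \<Longrightarrow> w \<in> marg_ker V C \<Longrightarrow> (\<lambda>x. c * u x + d * w x) \<in> marg_ker V C"
  by (auto simp: marg_ker_def sum.distrib sum_distrib_left[symmetric])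

lemma in_kernel_comb:
  "in_kernel V C u \<Longrightarrow> in_kernel V C w \<Longrightarrow> in_kernel V C (\<lambda>x. c * u x + d * w x)"
  by (simp add: in_kernel_def algebra_simps sum.distrib)
     (simp add: mult.left_commute sum_distrib_left[symmetric])

lemma in_kernel_cancel: "c \<noteq> 0 \<Longrightarrow> in_kernel V C (\<lambda>x. c * u x) \<Longrightarrow> in_kernel V C u"
  by (simp add: in_kernel_def mult.left_commute sum_distrib_left[symmetric])

lemma regular_in_kernel_iff:
  assumes sc: "simplicial_complex V C"
  shows "regular {u. in_kernel V C u} \<longleftrightarrow> regular (marg_ker V C)"
proof -
  define T where "T = (\<lambda>(u :: ('a \<Rightarrow> nat) \<Rightarrow> int) X. if X \<subseteq> V then u (ind V X) else 0)"
  define S where "S = (\<lambda>(u :: 'a set \<Rightarrow> int) i. if i \<in> AC_cols V then u {v \<in> V. i v = 1} else 0)"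
  have inv: "{v \<in> V. ind V X v = 1} = X" if "X \<subseteq> V" for X using that by (auto simp: ind_def)
  have indc: "ind V X \<in> AC_cols V" if "X \<subseteq> V" for X using bij_betw_ind[of V] that by (auto simp: bij_betw_def)
  have TS: "T (S u) = u" if "u \<in> marg_ker V C" for u
  proof
    show "T (S u) X = u X" for X
      using that inv by (cases "X \<subseteq> V") (simp_all add: T_def S_def indc marg_ker_outside)
  qed
  have kT: "in_kernel V C u \<longleftrightarrow> (\<forall>i. i \<notin> AC_cols V \<longrightarrow> u i = 0) \<and> T u \<in> marg_ker V C" for u
    unfolding in_kernel_iff[OF sc] T_def ..
  have SK: "in_kernel V C (S u)" if "u \<in> marg_ker V C" for u
    unfolding kT TS[OF that] using that by (simp add: S_def)
  have cols: "\<exists>X\<subseteq>V. i = ind V X" if "i \<in> AC_cols V" for i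
    using that bij_betw_ind[of V] by (auto simp: bij_betw_def)
  have Sind: "S u (ind V X) = u X" if "X \<subseteq> V" for u X
    using inv[OF that] that by (simp add: S_def indc)
  show ?thesis
  proof
    assume R: "regular {u. in_kernel V C u}"
    show "regular (marg_ker V C)" unfolding regular_def
    proof (intro ballI impI)
      fix u assume u: "u \<in> marg_ker V C" "\<exists>x. u x \<noteq> 0"
      then obtain X where X: "u X \<noteq> 0" "X \<subseteq> V" using marg_ker_outside by blast
      then have "S u (ind V X) \<noteq> 0" by (simp add: Sind)
      then obtain w y where w: "in_kernel V C w" "w y \<noteq> 0" "\<And>x. w x \<noteq> 0 \<Longrightarrow> S u x \<noteq> 0"
        "\<And>x. w x \<in> {-1, 0, 1}"
        using regularD[OF R, of "S u" "ind V X"] SK[OF u(1)] by auto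
      have "T w \<in> marg_ker V C" using w(1) kT by blast
      moreover obtain Y where "Y \<subseteq> V" "y = ind V Y" using w(1,2) kT cols by blast
      then have "T w Y \<noteq> 0" using w(2) by (simp add: T_def)
      moreover have "u x \<noteq> 0" if "T w x \<noteq> 0" for x
        using that w(3)[of "ind V x"] Sind[of x u] by (auto simp: T_def split: if_splits)
      moreover have "T w x \<in> {-1, 0, 1}" for x using w(4) by (auto simp: T_def)
      ultimately show "has_unit_below (marg_ker V C) u"
        by blast
    qed
  next
    assume R: "regular (marg_ker V C)"
    show "regular {u. in_kernel V C u}" unfolding regular_def
    proof (intro ballI impI)
      fix u assume "u \<in> {u. in_kernel V C u}" and nz: "\<exists>x. u x \<noteq> 0"
      then have u: "in_kernel V C u" by simp
      obtain X where X: "u (ind V X) \<noteq> 0" "X \<subseteq> V" using u nz kT cols by metis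
      then have "T u X \<noteq> 0" by (simp add: T_def)
      moreover have "T u \<in> marg_ker V C" using u kT by blast
      ultimately obtain w y where w: "w \<in> marg_ker V C" "w y \<noteq> 0" "\<And>x. w x \<noteq> 0 \<Longrightarrow> T u x \<noteq> 0"
        "\<And>x. w x \<in> {-1, 0, 1}"
        using regularD[OF R, of "T u" X] by metis
      have "y \<subseteq> V" using w marg_ker_outside by blast
      then have "S w (ind V y) \<noteq> 0" using w(2) by (simp add: Sind)
      moreover have "u x \<noteq> 0" if "S w x \<noteq> 0" for x
      proof -
        have "x \<in> AC_cols V" using that by (auto simp: S_def split: if_splits)
        then obtain Y where "Y \<subseteq> V" "x = ind V Y" using cols by blast
        then show ?thesis using that w(3)[of Y] by (simp add: Sind T_def)
      qed
      moreover have "S w x \<in> {-1, 0, 1}" for x using w(4) by (auto simp: S_def)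
      ultimately show "has_unit_below {u. in_kernel V C u} u"
        using SK[OF w(1)] by blast
    qed
  qed
qed

lemma unimodular_iff_regular:
  assumes sc: "simplicial_complex V C"
  shows "unimodular V C \<longleftrightarrow> regular (marg_ker V C)"
proof -
  have "finite V" using sc by (simp add: simplicial_complex_def)
  then have "finite (AC_cols V)" unfolding AC_cols_def by (intro finite_PiE) auto
  then have "regular {u. in_kernel V C u} \<longleftrightarrow> (\<forall>u. u \<in> {u. in_kernel V C u} \<and> {x. u x \<noteq> 0} \<noteq> {} \<and>
      Gcd (u ` AC_cols V) = 1 \<and> \<not> (\<exists>w. w \<in> {u. in_kernel V C u} \<and> {x. w x \<noteq> 0} \<noteq> {} \<and>
      {x. w x \<noteq> 0} \<subset> {x. u x \<noteq> 0}) \<longrightarrow> (\<forall>x. u x \<in> {-1, 0, 1}))"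
  proof (rule regular_iff_circuits)
    show "u x = 0" if "u \<in> {u. in_kernel V C u}" "x \<notin> AC_cols V" for u x
      using that by (simp add: in_kernel_def)
    show "u \<in> {u. in_kernel V C u}" if "c \<noteq> 0" "(\<lambda>x. c * u x) \<in> {u. in_kernel V C u}" for u and c :: int
      using in_kernel_cancel[OF that(1)] that(2) by blast
  qed (auto intro: in_kernel_comb)
  then have "regular {u. in_kernel V C u} \<longleftrightarrow> unimodular V C"
    by (simp add: unimodular_def is_circuit_def supp_def)
  then show ?thesis using regular_in_kernel_iff[OF sc] by simp
qed

section \<open>Minors and isomorphic copies\<close>

definition flip :: "'a \<Rightarrow> 'a set \<Rightarrow> 'a set" where
  "flip n X = (if n \<in> X then X - {n} else insert n X)"

lemma flip_flip [simp]: "flip n (flip n X) = X"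
  by (auto simp: flip_def)

lemma flip_subset: "n \<in> V \<Longrightarrow> flip n X \<subseteq> V \<longleftrightarrow> X \<subseteq> V"
  by (auto simp: flip_def)

lemma flip_Int: "n \<notin> F \<Longrightarrow> flip n X \<inter> F = X \<inter> F"
  by (auto simp: flip_def)

lemma sign_flip:
  assumes "finite X"
  shows "(-1 :: int) ^ card (flip n X) = - ((-1) ^ card X)"
proof (cases "n \<in> X")
  case True
  then have "card X = Suc (card (X - {n}))" using assms by (metis card_Suc_Diff1)
  then have "(-1 :: int) ^ card X = - ((-1) ^ card (X - {n}))" by (metis power_Suc mult_minus1)
  moreover have "flip n X = X - {n}" using True by (simp add: flip_def)
  ultimately show ?thesis by simp
next
  case False
  then have "flip n X = insert n X" by (simp add: flip_def)
  then show ?thesis using False assms by simp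
qed

text \<open>Toggling a point outside \<open>F\<close> is an involution of each fibre of the trace
  map. It reverses the sign of \<open>u\<close>, so the fibre sum equals its own negative.\<close>

lemma marg_flip_zero:
  fixes u :: "'a set \<Rightarrow> int"
  assumes "n \<in> V" "n \<notin> F" "\<And>X. X \<subseteq> V \<Longrightarrow> u (flip n X) = - u X"
  shows "(\<Sum>X | X \<subseteq> V \<and> X \<inter> F = E. u X) = 0"
proof -
  let ?S = "{X. X \<subseteq> V \<and> X \<inter> F = E}"
  have "sum u ?S = (\<Sum>X\<in>?S. - u X)"
    by (rule sum.reindex_bij_witness[of _ "flip n" "flip n"])
       (use assms in \<open>auto simp: flip_subset flip_Int\<close>)
  then have "sum u ?S = - sum u ?S" by (simp add: sum_negf)
  then show ?thesis by simp
qed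

lemma marg_insert:
  fixes u :: "'a set \<Rightarrow> int"
  assumes "finite V" "n \<notin> V" "n \<notin> F"
  shows "(\<Sum>X | X \<subseteq> insert n V \<and> X \<inter> F = E. u X) = (\<Sum>Y | Y \<subseteq> V \<and> Y \<inter> F = E. u Y + u (insert n Y))"
proof -
  let ?S = "{Y. Y \<subseteq> V \<and> Y \<inter> F = E}"
  have eq: "{X. X \<subseteq> insert n V \<and> X \<inter> F = E} = ?S \<union> insert n ` ?S"
  proof (intro equalityI subsetI)
    fix X assume X: "X \<in> {X. X \<subseteq> insert n V \<and> X \<inter> F = E}"
    show "X \<in> ?S \<union> insert n ` ?S"
    proof (cases "n \<in> X")
      case True
      then have "X = insert n (X - {n})" "X - {n} \<in> ?S" using X assms by auto
      then show ?thesis by blast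
    qed (use X in auto)
  qed (use assms in auto)
  have inj: "inj_on (insert n) ?S" using assms by (auto simp: inj_on_def)
  have "?S \<inter> insert n ` ?S = {}" using assms by auto
  then have "sum u (?S \<union> insert n ` ?S) = sum u ?S + sum u (insert n ` ?S)"
    using assms by (intro sum.union_disjoint) auto
  then show ?thesis unfolding eq sum.reindex[OF inj] by (simp add: sum.distrib)
qed

text \<open>A face that contains \<open>U\<close> sees the whole trace on \<open>U\<close>, so
  fixing that trace leaves a marginal on \<open>V\<close> alone. Links, cones and Lawrence liftings
  all rest on this.\<close>

lemma marg_slice:
  fixes u :: "'a set \<Rightarrow> int"
  assumes "V \<inter> U = {}" "R \<subseteq> U" "F \<subseteq> V" "E \<subseteq> F"
  shows "(\<Sum>X | X \<subseteq> V \<union> U \<and> X \<inter> (F \<union> U) = E \<union> R. u X) = (\<Sum>Y | Y \<subseteq> V \<and> Y \<inter> F = E. u (Y \<union> R))"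
proof (rule sum.reindex_bij_witness[of _ "\<lambda>Y. Y \<union> R" "\<lambda>X. X \<inter> V"])
  fix X assume X: "X \<in> {X. X \<subseteq> V \<union> U \<and> X \<inter> (F \<union> U) = E \<union> R}"
  then have "X \<inter> U = R" using assms by blast
  then show "X \<inter> V \<union> R = X" using X by blast
  then show "u (X \<inter> V \<union> R) = u X" by simp
qed (use assms in auto)

text \<open>The product of the differences in the directions of \<open>N\<close>, placed at
  \<open>J\<close>: alternating signs on the cube of sets \<open>J\<close> united with a subset of
  \<open>N\<close>. It is zero if \<open>J\<close> meets \<open>N\<close>.\<close>

definition move :: "'a set \<Rightarrow> 'a set \<Rightarrow> 'a set \<Rightarrow> int" where
  "move N J X = (if X - N = J then (-1) ^ card (X \<inter> N) else 0)"

text \<open>Every face misses some point of the nonface \<open>N\<close>, and toggling that point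
  reverses the sign.\<close>

lemma move_in_marg_ker:
  assumes "finite V" "N \<subseteq> V" "J \<subseteq> V" "\<And>F. F \<in> C \<Longrightarrow> \<not> N \<subseteq> F"
  shows "move N J \<in> marg_ker V C"
proof (rule marg_kerI)
  fix X assume "\<not> X \<subseteq> V"
  then show "move N J X = 0" using assms by (auto simp: move_def)
next
  fix F E assume "F \<in> C"
  then obtain n where n: "n \<in> N" "n \<notin> F" using assms(4) by blast
  show "(\<Sum>X | X \<subseteq> V \<and> X \<inter> F = E. move N J X) = 0"
  proof (rule marg_flip_zero)
    fix X assume X: "X \<subseteq> V"
    have "flip n X - N = X - N" "flip n X \<inter> N = flip n (X \<inter> N)" using n by (auto simp: flip_def)
    moreover have "finite (X \<inter> N)" using X assms finite_subset by blast
    ultimately show "move N J (flip n X) = - move N J X"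
      by (simp add: move_def sign_flip)
  qed (use n assms in auto)
qed

text \<open>Extension by zero embeds the kernel of the induced subcomplex: on subsets of
  \<open>V - S\<close> a face acts only through its trace on \<open>V - S\<close>. A unit vector
  below such an extension again lives on subsets of \<open>V - S\<close>.\<close>

lemma regular_deletion:
  assumes reg: "regular (marg_ker V C)" and C: "\<And>F G. F \<in> C \<Longrightarrow> G \<subseteq> F \<Longrightarrow> G \<in> C" and fin: "finite V"
  shows "regular (marg_ker (V - S) {F \<in> C. F \<subseteq> V - S})"
  unfolding regular_def
proof (intro ballI impI)
  let ?C = "{F \<in> C. F \<subseteq> V - S}"
  fix u assume u: "u \<in> marg_ker (V - S) ?C" and "\<exists>x. u x \<noteq> 0"
  then obtain x where x: "u x \<noteq> 0" by blast
  have restr: "(\<Sum>X | X \<subseteq> V \<and> X \<inter> F = E. w X) = (\<Sum>X | X \<subseteq> V - S \<and> X \<inter> F = E. w X)"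
    if "\<And>X. w X \<noteq> 0 \<Longrightarrow> u X \<noteq> 0" for w :: "'a set \<Rightarrow> int" and F E
    by (rule sum.mono_neutral_right) (use that marg_ker_outside[OF u] fin in auto)
  have "u \<in> marg_ker V C"
  proof (rule marg_kerI)
    fix F E assume F: "F \<in> C" "E \<subseteq> F"
    have "(\<Sum>X | X \<subseteq> V - S \<and> X \<inter> F = E. u X) = 0"
    proof (cases "E \<subseteq> V - S")
      case True
      have "{X. X \<subseteq> V - S \<and> X \<inter> F = E} = {X. X \<subseteq> V - S \<and> X \<inter> (F \<inter> (V - S)) = E}" by auto
      moreover have "F \<inter> (V - S) \<in> ?C" using F C by auto
      ultimately show ?thesis using marg_ker_sum[OF u, of "F \<inter> (V - S)" E] by simp
    next
      case False
      then have "{X. X \<subseteq> V - S \<and> X \<inter> F = E} = {}" by auto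
      then show ?thesis by (simp only: sum.empty)
    qed
    then show "(\<Sum>X | X \<subseteq> V \<and> X \<inter> F = E. u X) = 0" by (simp add: restr)
  qed (use marg_ker_outside[OF u] in blast)
  from regularD[OF reg this x] obtain w y where
    w: "w \<in> marg_ker V C" "w y \<noteq> 0" "\<And>x. w x \<noteq> 0 \<Longrightarrow> u x \<noteq> 0" "\<And>x. w x \<in> {-1, 0, 1}" by metis
  have "w \<in> marg_ker (V - S) ?C"
  proof (rule marg_kerI)
    show "\<not> X \<subseteq> V - S \<Longrightarrow> w X = 0" for X using w(3) marg_ker_outside[OF u] by blast
    show "(\<Sum>X | X \<subseteq> V - S \<and> X \<inter> F = E. w X) = 0" if "F \<in> ?C" for F E
      using marg_ker_sum[OF w(1), of F E] that restr[of w F E] w(3) by simp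
  qed
  then show "has_unit_below (marg_ker (V - S) ?C) u"
    using w by blast
qed

lemma marg_ker_slice:
  assumes w: "w \<in> marg_ker (V \<union> U) C" and VU: "V \<inter> U = {}" "R \<subseteq> U"
    and D: "\<And>F. F \<in> D \<Longrightarrow> F \<subseteq> V \<and> F \<union> U \<in> C"
  shows "(\<lambda>Y. if Y \<subseteq> V then w (Y \<union> R) else 0) \<in> marg_ker V D"
proof (rule marg_kerI)
  fix F E assume F: "F \<in> D" "E \<subseteq> F"
  have "(\<Sum>Y | Y \<subseteq> V \<and> Y \<inter> F = E. if Y \<subseteq> V then w (Y \<union> R) else 0) = (\<Sum>Y | Y \<subseteq> V \<and> Y \<inter> F = E. w (Y \<union> R))"
    by (rule sum.cong) auto
  also have "\<dots> = 0"
    using marg_slice[of V U R F E w] marg_ker_sum[OF w, of "F \<union> U"] VU D[OF F(1)] F(2) by simp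
  finally show "(\<Sum>Y | Y \<subseteq> V \<and> Y \<inter> F = E. if Y \<subseteq> V then w (Y \<union> R) else 0) = 0" .
qed simp

lemma regular_link:
  assumes reg: "regular (marg_ker V C)" and sc: "simplicial_complex V C" and R: "R \<in> C"
  shows "regular (marg_ker (V - R) {F - R | F. F \<in> C \<and> R \<subseteq> F})"
  unfolding regular_def
proof (intro ballI impI)
  let ?D = "{F - R | F. F \<in> C \<and> R \<subseteq> F}"
  have fin: "finite V" and RV: "R \<subseteq> V" and CV: "\<And>F. F \<in> C \<Longrightarrow> F \<subseteq> V"
    using sc R by (auto simp: simplicial_complex_def)
  have VR: "V - R \<union> R = V" using RV by auto
  fix u assume u: "u \<in> marg_ker (V - R) ?D" and "\<exists>x. u x \<noteq> 0"
  then obtain x where x: "u x \<noteq> 0" by blast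
  then have xV: "x \<subseteq> V - R" using marg_ker_outside[OF u] by blast
  \<comment> \<open>Spread \<open>u\<close> over all traces on \<open>R\<close> with alternating
    signs: a face containing \<open>R\<close> sees one signed copy of \<open>u\<close>, and a face
    missing a point of \<open>R\<close> is handled by toggling that point.\<close>
  define u' where "u' = (\<lambda>X. (-1) ^ card (X \<inter> R) * u (X - R))"
  have "u' \<in> marg_ker V C"
  proof (rule marg_kerI)
    show "\<not> X \<subseteq> V \<Longrightarrow> u' X = 0" for X
      using marg_ker_outside[OF u, of "X - R"] RV by (auto simp: u'_def)
    fix F E assume F: "F \<in> C" "E \<subseteq> F"
    show "(\<Sum>X | X \<subseteq> V \<and> X \<inter> F = E. u' X) = 0"
    proof (cases "R \<subseteq> F")
      case True
      have E: "E - R \<union> E \<inter> R = E" and FR: "F - R \<union> R = F" using True by auto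
      have "(\<Sum>X | X \<subseteq> V \<and> X \<inter> F = E. u' X) = (\<Sum>Y | Y \<subseteq> V - R \<and> Y \<inter> (F - R) = E - R. u' (Y \<union> E \<inter> R))"
        using marg_slice[of "V - R" R "E \<inter> R" "F - R" "E - R" u'] F CV[OF F(1)] unfolding VR E FR by auto
      also have "\<dots> = (\<Sum>Y | Y \<subseteq> V - R \<and> Y \<inter> (F - R) = E - R. (-1) ^ card (E \<inter> R) * u Y)"
      proof (rule sum.cong[OF refl])
        fix Y assume "Y \<in> {Y. Y \<subseteq> V - R \<and> Y \<inter> (F - R) = E - R}"
        then have "(Y \<union> E \<inter> R) \<inter> R = E \<inter> R" "(Y \<union> E \<inter> R) - R = Y" by auto
        then show "u' (Y \<union> E \<inter> R) = (-1) ^ card (E \<inter> R) * u Y" by (simp add: u'_def)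
      qed
      also have "\<dots> = 0"
        using marg_ker_sum[OF u, of "F - R" "E - R"] F(1) True by (auto simp: sum_distrib_left[symmetric])
      finally show ?thesis .
    next
      case False
      then obtain r where r: "r \<in> R" "r \<notin> F" by blast
      show ?thesis
      proof (rule marg_flip_zero)
        fix X assume X: "X \<subseteq> V"
        have "flip r X \<inter> R = flip r (X \<inter> R)" "flip r X - R = X - R" using r by (auto simp: flip_def)
        moreover have "finite (X \<inter> R)" using X fin finite_subset by blast
        ultimately show "u' (flip r X) = - u' X" by (simp add: u'_def sign_flip)
      qed (use r RV in auto)
    qed
  qed
  moreover have "u' x \<noteq> 0"
  proof -
    have "x - R = x" using xV by auto
    then show ?thesis using x by (simp add: u'_def)
  qed
  ultimately obtain w y where
    w: "w \<in> marg_ker V C" "w y \<noteq> 0" "\<And>x. w x \<noteq> 0 \<Longrightarrow> u' x \<noteq> 0" "\<And>x. w x \<in> {-1, 0, 1}"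
    using regularD[OF reg, of u' x] by metis
  have yV: "y \<subseteq> V" using w marg_ker_outside by blast
  \<comment> \<open>Only the slice of \<open>w\<close> with the trace of \<open>y\<close> on
    \<open>R\<close> is kept; it is nonzero because \<open>w y\<close> is.\<close>
  define w' where "w' = (\<lambda>Y. if Y \<subseteq> V - R then w (Y \<union> (y \<inter> R)) else 0)"
  have "w' \<in> marg_ker (V - R) ?D" unfolding w'_def
  proof (rule marg_ker_slice[of _ _ R C])
    fix F assume "F \<in> ?D"
    then obtain G where G: "G \<in> C" "R \<subseteq> G" "F = G - R" by blast
    then have "F \<union> R = G" by auto
    then show "F \<subseteq> V - R \<and> F \<union> R \<in> C" using G CV[OF G(1)] by auto
  qed (use w VR in auto)
  moreover have "w' (y - R) \<noteq> 0"
  proof -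
    have "y - R \<union> y \<inter> R = y" by auto
    then show ?thesis using w(2) yV by (auto simp: w'_def)
  qed
  moreover have "u x \<noteq> 0" if "w' x \<noteq> 0" for x
  proof -
    have "x \<subseteq> V - R" "w (x \<union> (y \<inter> R)) \<noteq> 0" using that by (auto simp: w'_def split: if_splits)
    moreover from this have "x \<union> (y \<inter> R) - R = x" by auto
    ultimately show ?thesis using w(3)[of "x \<union> (y \<inter> R)"] by (simp add: u'_def)
  qed
  moreover have "w' x \<in> {-1, 0, 1}" for x using w(4) by (auto simp: w'_def)
  ultimately show "has_unit_below (marg_ker (V - R) ?D) u"
    by blast
qed

lemma marg_ker_bij:
  assumes f: "bij_betw f V W" and CV: "C \<subseteq> Pow V" and u: "u \<in> marg_ker W ((`) f ` C)"
  shows "(\<lambda>X. if X \<subseteq> V then u (f ` X) else 0) \<in> marg_ker V C"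
proof (rule marg_kerI)
  have inj: "inj_on f V" and im: "f ` V = W" using f by (auto simp: bij_betw_def)
  fix F E assume F: "F \<in> C" "E \<subseteq> F"
  have iff: "f ` X \<inter> f ` F = f ` E \<longleftrightarrow> X \<inter> F = E" if "X \<subseteq> V" for X
  proof -
    have "f ` X \<inter> f ` F = f ` (X \<inter> F)" using inj_on_image_Int[OF inj, of X F] that F CV by blast
    moreover have "f ` (X \<inter> F) = f ` E \<longleftrightarrow> X \<inter> F = E"
      by (rule inj_on_image_eq_iff[OF inj]) (use that F CV in auto)
    ultimately show ?thesis by simp
  qed
  have "(\<Sum>X | X \<subseteq> V \<and> X \<inter> F = E. if X \<subseteq> V then u (f ` X) else 0) = (\<Sum>X | X \<subseteq> V \<and> X \<inter> F = E. u (f ` X))"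
    by (rule sum.cong) auto
  also have "\<dots> = (\<Sum>Y | Y \<subseteq> W \<and> Y \<inter> f ` F = f ` E. u Y)"
  proof (rule sum.reindex_bij_betw)
    show "bij_betw ((`) f) {X. X \<subseteq> V \<and> X \<inter> F = E} {Y. Y \<subseteq> W \<and> Y \<inter> f ` F = f ` E}"
      unfolding bij_betw_def
    proof
      show "inj_on ((`) f) {X. X \<subseteq> V \<and> X \<inter> F = E}"
        by (rule inj_on_subset[OF inj_on_image_Pow[OF inj]]) auto
      show "(`) f ` {X. X \<subseteq> V \<and> X \<inter> F = E} = {Y. Y \<subseteq> W \<and> Y \<inter> f ` F = f ` E}"
      proof (intro equalityI subsetI)
        fix Y assume Y: "Y \<in> {Y. Y \<subseteq> W \<and> Y \<inter> f ` F = f ` E}"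
        then obtain X where "X \<subseteq> V" "Y = f ` X" using im by (auto simp: subset_image_iff)
        then show "Y \<in> (`) f ` {X. X \<subseteq> V \<and> X \<inter> F = E}" using Y iff by auto
      qed (use iff im in auto)
    qed
  qed
  also have "\<dots> = 0" using marg_ker_sum[OF u] F by blast
  finally show "(\<Sum>X | X \<subseteq> V \<and> X \<inter> F = E. if X \<subseteq> V then u (f ` X) else 0) = 0" .
qed simp

lemma bij_betw_faces:
  assumes "bij_betw f V W" "C \<subseteq> Pow V"
  shows "(`) (the_inv_into V f) ` (`) f ` C = C"
proof -
  have inj: "inj_on f V" using assms by (auto simp: bij_betw_def)
  have "the_inv_into V f ` f ` F = F" if "F \<in> C" for F
    using that assms(2) inj by (force simp: image_image the_inv_into_f_f)
  then show ?thesis by (auto simp: image_image image_iff)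
qed

lemma regular_iso:
  assumes reg: "regular (marg_ker V C)" and f: "bij_betw f V W" and CV: "C \<subseteq> Pow V"
  shows "regular (marg_ker W ((`) f ` C))"
  unfolding regular_def
proof (intro ballI impI)
  let ?g = "the_inv_into V f"
  have g: "bij_betw ?g W V" using f by (rule bij_betw_the_inv_into)
  have DW: "(`) f ` C \<subseteq> Pow W" using f CV by (auto simp: bij_betw_def)
  have fg: "f ` ?g ` Y = Y" if "Y \<subseteq> W" for Y
    using that f by (force simp: image_image f_the_inv_into_f_bij_betw)
  have gV: "?g ` Y \<subseteq> V" if "Y \<subseteq> W" for Y using that g by (auto simp: bij_betw_def)
  have gf: "?g ` f ` X = X" if "X \<subseteq> V" for X
    using that f by (force simp: image_image bij_betw_def the_inv_into_f_f)
  have fW: "f ` X \<subseteq> W" if "X \<subseteq> V" for X using that f by (auto simp: bij_betw_def)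
  fix u assume u: "u \<in> marg_ker W ((`) f ` C)" and "\<exists>x. u x \<noteq> 0"
  then obtain x where x: "u x \<noteq> 0" "x \<subseteq> W" using marg_ker_outside[OF u] by blast
  define u' where "u' = (\<lambda>X. if X \<subseteq> V then u (f ` X) else 0)"
  have "u' \<in> marg_ker V C" unfolding u'_def by (rule marg_ker_bij[OF f CV u])
  moreover have "u' (?g ` x) \<noteq> 0" using x by (simp add: u'_def gV fg)
  ultimately obtain w y where
    w: "w \<in> marg_ker V C" "w y \<noteq> 0" "\<And>x. w x \<noteq> 0 \<Longrightarrow> u' x \<noteq> 0" "\<And>x. w x \<in> {-1, 0, 1}"
    using regularD[OF reg] by metis
  define w' where "w' = (\<lambda>Y. if Y \<subseteq> W then w (?g ` Y) else 0)"
  have "w' \<in> marg_ker W ((`) f ` C)" unfolding w'_def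
    by (rule marg_ker_bij[OF g DW]) (simp only: bij_betw_faces[OF f CV] w(1))
  moreover have "y \<subseteq> V" using w marg_ker_outside by blast
  then have "w' (f ` y) \<noteq> 0" using w(2) by (simp add: w'_def gf fW)
  moreover have "u Y \<noteq> 0" if "w' Y \<noteq> 0" for Y
    using that w(3)[of "?g ` Y"] by (auto simp: w'_def u'_def fg split: if_splits)
  moreover have "w' x \<in> {-1, 0, 1}" for x using w(4) by (auto simp: w'_def)
  ultimately show "has_unit_below (marg_ker W ((`) f ` C)) u"
    by blast
qed

section \<open>Nuclear constructions\<close>

lemma cx_ghost: "simplicial_complex V C \<Longrightarrow> simplicial_complex (insert w V) C"
  by (auto simp: simplicial_complex_def)

text \<open>If \<open>u\<close> is nonzero at both lifts of some set, the difference of these lifts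
  is already a unit kernel vector. Otherwise adding the two lifts causes no cancellation, and a unit
  vector below the projection can be lifted back.\<close>

lemma regular_ghost:
  assumes reg: "regular (marg_ker V C)" and sc: "simplicial_complex V C" and w: "w \<notin> V"
  shows "regular (marg_ker (insert w V) C)"
  unfolding regular_def
proof (intro ballI impI)
  have fin: "finite V" and CV: "\<And>F. F \<in> C \<Longrightarrow> F \<subseteq> V" using sc by (auto simp: simplicial_complex_def)
  fix u assume u: "u \<in> marg_ker (insert w V) C" and "\<exists>x. u x \<noteq> 0"
  then obtain x where x: "u x \<noteq> 0" by blast
  then have xV: "x \<subseteq> insert w V" using marg_ker_outside[OF u] by blast
  show "has_unit_below (marg_ker (insert w V) C) u"
  proof (cases "\<exists>Y\<subseteq>V. u Y \<noteq> 0 \<and> u (insert w Y) \<noteq> 0")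
    case True
    then obtain Y where Y: "Y \<subseteq> V" "u Y \<noteq> 0" "u (insert w Y) \<noteq> 0" by blast
    have "move {w} Y \<in> marg_ker (insert w V) C"
      by (rule move_in_marg_ker) (use fin Y w CV in auto)
    moreover have "move {w} Y Y \<noteq> 0" using Y w by (auto simp: move_def)
    moreover have "u x \<noteq> 0" if "move {w} Y x \<noteq> 0" for x
    proof -
      have "x - {w} = Y" using that by (auto simp: move_def split: if_splits)
      then have "x = Y \<or> x = insert w Y" by auto
      then show ?thesis using Y by auto
    qed
    moreover have "move {w} Y x \<in> {-1, 0, 1}" for x
      by (cases "w \<in> x") (auto simp: move_def)
    ultimately show ?thesis by blast
  next
    case False
    define u' where "u' = (\<lambda>Y. if Y \<subseteq> V then u Y + u (insert w Y) else 0)"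
    have "u' \<in> marg_ker V C"
    proof (rule marg_kerI)
      fix F E assume F: "F \<in> C"
      have "(\<Sum>X | X \<subseteq> V \<and> X \<inter> F = E. u' X) = (\<Sum>X | X \<subseteq> V \<and> X \<inter> F = E. u X + u (insert w X))"
        by (rule sum.cong) (auto simp: u'_def)
      then show "(\<Sum>X | X \<subseteq> V \<and> X \<inter> F = E. u' X) = 0"
        using marg_insert[OF fin w, of F u E] CV[OF F] w marg_ker_sum[OF u F, of E] by auto
    qed (simp add: u'_def)
    moreover have "u' (x - {w}) \<noteq> 0"
    proof (cases "w \<in> x")
      case True
      then have "insert w (x - {w}) = x" by auto
      moreover have "x - {w} \<subseteq> V" using xV by auto
      moreover have "u (x - {w}) = 0" using False x calculation by metis
      ultimately show ?thesis using x by (simp add: u'_def)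
    next
      assume "w \<notin> x"
      then have "x - {w} = x" "x \<subseteq> V" using xV by auto
      then show ?thesis using False x by (auto simp: u'_def)
    qed
    ultimately obtain v y where
      v: "v \<in> marg_ker V C" "v y \<noteq> 0" "\<And>x. v x \<noteq> 0 \<Longrightarrow> u' x \<noteq> 0" "\<And>x. v x \<in> {-1, 0, 1}"
      using regularD[OF reg, of u' "x - {w}"] by metis
    \<comment> \<open>Here at most one lift of each set lies in the support of \<open>u\<close>, and
      that lift receives the value of \<open>v\<close>.\<close>
    define v' where "v' = (\<lambda>X. if u X \<noteq> 0 then v (X - {w}) else 0)"
    have pair: "v' Y + v' (insert w Y) = v Y" if "Y \<subseteq> V" for Y
    proof -
      have "Y - {w} = Y" "insert w Y - {w} = Y" using that w by auto
      then show ?thesis using that False v(3)[of Y] by (auto simp: v'_def u'_def)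
    qed
    have "v' \<in> marg_ker (insert w V) C"
    proof (rule marg_kerI)
      fix F E assume F: "F \<in> C"
      have "(\<Sum>X | X \<subseteq> insert w V \<and> X \<inter> F = E. v' X) = (\<Sum>X | X \<subseteq> V \<and> X \<inter> F = E. v' X + v' (insert w X))"
        by (rule marg_insert) (use fin w CV[OF F] in auto)
      also have "\<dots> = (\<Sum>X | X \<subseteq> V \<and> X \<inter> F = E. v X)" by (rule sum.cong) (auto simp: pair)
      also have "\<dots> = 0" by (rule marg_ker_sum[OF v(1) F])
      finally show "(\<Sum>X | X \<subseteq> insert w V \<and> X \<inter> F = E. v' X) = 0" .
    qed (use marg_ker_outside[OF u] in \<open>auto simp: v'_def\<close>)
    moreover have "y \<subseteq> V" using v marg_ker_outside by blast
    then have "v' y + v' (insert w y) \<noteq> 0" using v(2) pair by simp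
    then have "\<exists>x. v' x \<noteq> 0" by (metis add_0)
    moreover have "v' x \<noteq> 0 \<Longrightarrow> u x \<noteq> 0" "v' x \<in> {-1, 0, 1}" for x using v(4) by (auto simp: v'_def split: if_splits)
    ultimately show ?thesis by blast
  qed
qed

lemma simplicial_complexI:
  assumes "finite V" "\<And>F. F \<in> C \<Longrightarrow> F \<subseteq> V" "\<And>F G. F \<in> C \<Longrightarrow> G \<subseteq> F \<Longrightarrow> G \<in> C"
  shows "simplicial_complex V C"
  unfolding simplicial_complex_def using assms by blast

lemma simplicial_complexD:
  assumes "simplicial_complex V C"
  shows "finite V" "F \<in> C \<Longrightarrow> F \<subseteq> V" "F \<in> C \<Longrightarrow> G \<subseteq> F \<Longrightarrow> G \<in> C"
  using assms unfolding simplicial_complex_def by blast+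

lemma cx_lawrence:
  assumes "simplicial_complex V C"
  shows "simplicial_complex (insert w V) {G. G \<subseteq> V \<or> (\<exists>F\<in>C. G \<subseteq> insert w F)}"
proof (rule simplicial_complexI)
  show "F \<subseteq> insert w V" if "F \<in> {G. G \<subseteq> V \<or> (\<exists>F\<in>C. G \<subseteq> insert w F)}" for F
    using that simplicial_complexD(2)[OF assms] by fast
  show "G \<in> {G. G \<subseteq> V \<or> (\<exists>F\<in>C. G \<subseteq> insert w F)}"
    if "F \<in> {G. G \<subseteq> V \<or> (\<exists>F\<in>C. G \<subseteq> insert w F)}" "G \<subseteq> F" for F G
    using that by (simp, meson subset_trans)
qed (use simplicial_complexD(1)[OF assms] in simp)

text \<open>Since \<open>V\<close> is a face, its marginals make \<open>u\<close> antisymmetric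
  under toggling \<open>w\<close>. So the kernel is a signed double of the kernel of
  \<open>C\<close>.\<close>

lemma regular_lawrence:
  assumes reg: "regular (marg_ker V C)" and sc: "simplicial_complex V C" and w: "w \<notin> V"
  shows "regular (marg_ker (insert w V) {G. G \<subseteq> V \<or> (\<exists>F\<in>C. G \<subseteq> insert w F)})" (is "regular (marg_ker ?V ?C)")
  unfolding regular_def
proof (intro ballI impI)
  have fin: "finite V" and CV: "\<And>F. F \<in> C \<Longrightarrow> F \<subseteq> V" and C: "\<And>F G. F \<in> C \<Longrightarrow> G \<subseteq> F \<Longrightarrow> G \<in> C"
    using sc by (auto simp: simplicial_complex_def)
  fix u assume u: "u \<in> marg_ker ?V ?C" and "\<exists>x. u x \<noteq> 0"
  then obtain x where x: "u x \<noteq> 0" by blast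
  then have xV: "x \<subseteq> insert w V" using marg_ker_outside[OF u] by blast
  have opp: "u (insert w Y) = - u Y" if "Y \<subseteq> V" for Y
  proof -
    have "(\<Sum>X | X \<subseteq> insert w V \<and> X \<inter> V = Y. u X) = (\<Sum>X | X \<subseteq> V \<and> X \<inter> V = Y. u X + u (insert w X))"
      by (rule marg_insert) (use fin w in auto)
    moreover have "{X. X \<subseteq> V \<and> X \<inter> V = Y} = {Y}" using that by auto
    ultimately show ?thesis using marg_ker_sum[OF u, of V Y] by simp
  qed
  define u' where "u' = (\<lambda>Y. if Y \<subseteq> V then u (Y \<union> {}) else 0)"
  have "u' \<in> marg_ker V C" unfolding u'_def
    by (rule marg_ker_slice[of _ _ "{w}" ?C]) (use u w CV in auto)
  moreover have "u' (x - {w}) \<noteq> 0"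
  proof (cases "w \<in> x")
    case True
    then have "insert w (x - {w}) = x" "x - {w} \<subseteq> V" using xV by auto
    then show ?thesis using opp[of "x - {w}"] x by (simp add: u'_def)
  next
    case False
    then have "x - {w} = x" "x \<subseteq> V" using xV by auto
    then show ?thesis using x by (simp add: u'_def)
  qed
  ultimately obtain v y where
    v: "v \<in> marg_ker V C" "v y \<noteq> 0" "\<And>x. v x \<noteq> 0 \<Longrightarrow> u' x \<noteq> 0" "\<And>x. v x \<in> {-1, 0, 1}"
    using regularD[OF reg, of u' "x - {w}"] by metis
  define v' where "v' = (\<lambda>X. if w \<in> X then - v (X - {w}) else v X)"
  have v'_ins: "v' (insert w Y) = - v Y" and v'_V: "v' Y = v Y" if "Y \<subseteq> V" for Y
  proof -
    have "insert w Y - {w} = Y" "w \<notin> Y" using that w by auto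
    then show "v' (insert w Y) = - v Y" "v' Y = v Y" by (auto simp: v'_def)
  qed
  have "v' \<in> marg_ker ?V ?C"
  proof (rule marg_kerI)
    fix X assume "\<not> X \<subseteq> insert w V"
    then have "\<not> X \<subseteq> V" "\<not> X - {w} \<subseteq> V" by auto
    then show "v' X = 0" using marg_ker_outside[OF v(1)] by (simp add: v'_def)
  next
    fix G E assume G: "G \<in> ?C" "E \<subseteq> G"
    show "(\<Sum>X | X \<subseteq> insert w V \<and> X \<inter> G = E. v' X) = 0"
    proof (cases "w \<in> G")
      case False
      have "(\<Sum>X | X \<subseteq> insert w V \<and> X \<inter> G = E. v' X) = (\<Sum>X | X \<subseteq> V \<and> X \<inter> G = E. v' X + v' (insert w X))"
        by (rule marg_insert) (use fin w False in auto)
      also have "\<dots> = 0" by (rule sum.neutral) (auto simp: v'_ins v'_V)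
      finally show ?thesis .
    next
      case True
      then obtain F where "F \<in> C" "G \<subseteq> insert w F" using G(1) w by auto
      then have GC: "G - {w} \<in> C" by (auto intro: C[of F])
      then have GV: "G - {w} \<subseteq> V" using CV by blast
      define R where "R = E \<inter> {w}"
      have eqs: "V \<union> {w} = insert w V" "G - {w} \<union> {w} = G" "E - {w} \<union> R = E" using True by (auto simp: R_def)
      have "(\<Sum>X | X \<subseteq> insert w V \<and> X \<inter> G = E. v' X)
          = (\<Sum>Y | Y \<subseteq> V \<and> Y \<inter> (G - {w}) = E - {w}. v' (Y \<union> R))"
        using marg_slice[of V "{w}" R "G - {w}" "E - {w}" v'] w GV G(2) unfolding eqs
        by (auto simp: R_def)
      also have "\<dots> = (\<Sum>Y | Y \<subseteq> V \<and> Y \<inter> (G - {w}) = E - {w}. (if w \<in> E then -1 else 1) * v Y)"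
        by (rule sum.cong) (auto simp: R_def v'_V v'_ins)
      also have "\<dots> = 0" using marg_ker_sum[OF v(1) GC, of "E - {w}"] by (simp only: sum_distrib_left[symmetric] mult_zero_right)
      finally show ?thesis .
    qed
  qed
  moreover have yV: "y \<subseteq> V" using v marg_ker_outside by blast
  then have "v' y \<noteq> 0" using v(2) v'_V by simp
  moreover have "u x \<noteq> 0" if "v' x \<noteq> 0" for x
  proof (cases "w \<in> x")
    case True
    then have "v (x - {w}) \<noteq> 0" using that by (simp add: v'_def)
    then have "x - {w} \<subseteq> V" "u (x - {w}) \<noteq> 0"
      using v(3)[of "x - {w}"] marg_ker_outside[OF v(1)] by (auto simp: u'_def split: if_splits)
    moreover have "insert w (x - {w}) = x" using True by auto
    ultimately show ?thesis using opp[of "x - {w}"] by simp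
  next
    case False
    then show ?thesis using that v(3)[of x] by (auto simp: v'_def u'_def split: if_splits)
  qed
  moreover have "v' x \<in> {-1, 0, 1}" for x using v(4)[of x] v(4)[of "x - {w}"] by (auto simp: v'_def)
  ultimately show "has_unit_below (marg_ker ?V ?C) u"
    by blast
qed

lemma cx_cone:
  assumes "simplicial_complex V C" "finite U"
  shows "simplicial_complex (V \<union> U) {G. \<exists>F\<in>C. G \<subseteq> F \<union> U}"
proof (rule simplicial_complexI)
  show "F \<subseteq> V \<union> U" if "F \<in> {G. \<exists>F\<in>C. G \<subseteq> F \<union> U}" for F
    using that simplicial_complexD(2)[OF assms(1)] by fast
  show "G \<in> {G. \<exists>F\<in>C. G \<subseteq> F \<union> U}" if "F \<in> {G. \<exists>F\<in>C. G \<subseteq> F \<union> U}" "G \<subseteq> F" for F G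
    using that by (simp, meson subset_trans)
qed (use simplicial_complexD(1)[OF assms(1)] assms(2) in simp)

text \<open>All facets contain \<open>U\<close>, so marginals never mix different traces on
  \<open>U\<close>: the kernel is a direct sum of copies of the kernel of \<open>C\<close>, one for
  each subset of \<open>U\<close>. The proof works in the copy that contains
  \<open>x\<close>.\<close>

lemma regular_cone:
  assumes reg: "regular (marg_ker V C)" and sc: "simplicial_complex V C" and U: "finite U" "V \<inter> U = {}"
  shows "regular (marg_ker (V \<union> U) {G. \<exists>F\<in>C. G \<subseteq> F \<union> U})" (is "regular (marg_ker ?V ?C)")
  unfolding regular_def
proof (intro ballI impI)
  have fin: "finite V" and CV: "\<And>F. F \<in> C \<Longrightarrow> F \<subseteq> V" and C: "\<And>F G. F \<in> C \<Longrightarrow> G \<subseteq> F \<Longrightarrow> G \<in> C"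
    using sc by (auto simp: simplicial_complex_def)
  fix u assume u: "u \<in> marg_ker ?V ?C" and "\<exists>x. u x \<noteq> 0"
  then obtain x where x: "u x \<noteq> 0" by blast
  then have xV: "x \<subseteq> V \<union> U" using marg_ker_outside[OF u] by blast
  define R where "R = x \<inter> U"
  define u' where "u' = (\<lambda>Y. if Y \<subseteq> V then u (Y \<union> R) else 0)"
  have "u' \<in> marg_ker V C" unfolding u'_def
    by (rule marg_ker_slice[of _ _ U ?C]) (use u U CV in \<open>auto simp: R_def\<close>)
  moreover have "u' (x \<inter> V) \<noteq> 0"
  proof -
    have "x \<inter> V \<union> R = x" using xV by (auto simp: R_def)
    then show ?thesis using x by (simp add: u'_def)
  qed
  ultimately obtain v y where
    v: "v \<in> marg_ker V C" "v y \<noteq> 0" "\<And>x. v x \<noteq> 0 \<Longrightarrow> u' x \<noteq> 0" "\<And>x. v x \<in> {-1, 0, 1}"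
    using regularD[OF reg, of u' "x \<inter> V"] by metis
  define v' where "v' = (\<lambda>X. if X \<subseteq> ?V \<and> X \<inter> U = R then v (X \<inter> V) else 0)"
  have "v' \<in> marg_ker ?V ?C"
  proof (rule marg_kerI)
    fix G E assume G: "G \<in> ?C" "E \<subseteq> G"
    show "(\<Sum>X | X \<subseteq> ?V \<and> X \<inter> G = E. v' X) = 0"
    proof (cases "R \<inter> G = E \<inter> U")
      case True
      have "(\<Sum>X | X \<subseteq> ?V \<and> X \<inter> G = E. v' X)
          = (\<Sum>X | X \<subseteq> ?V \<and> X \<inter> G = E \<and> X \<inter> U = R. v' X)"
        by (rule sum.mono_neutral_right) (use fin U in \<open>auto simp: v'_def\<close>)
      also have "\<dots> = (\<Sum>Y | Y \<subseteq> V \<and> Y \<inter> (G - U) = E - U. v Y)"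
      proof (rule sum.reindex_bij_witness[of _ "\<lambda>Y. Y \<union> R" "\<lambda>X. X \<inter> V"])
        fix X assume X: "X \<in> {X. X \<subseteq> ?V \<and> X \<inter> G = E \<and> X \<inter> U = R}"
        show "X \<inter> V \<union> R = X" using X by auto
        have "E \<subseteq> V \<union> U" using X by auto
        then show "X \<inter> V \<in> {Y. Y \<subseteq> V \<and> Y \<inter> (G - U) = E - U}" using X U(2) by auto
        show "v (X \<inter> V) = v' X" using X by (simp add: v'_def)
      next
        fix Y assume Y: "Y \<in> {Y. Y \<subseteq> V \<and> Y \<inter> (G - U) = E - U}"
        have "R \<subseteq> U" by (simp add: R_def)
        then show "(Y \<union> R) \<inter> V = Y" using Y U(2) by auto
        have "(Y \<union> R) \<inter> G = (Y \<inter> (G - U)) \<union> (R \<inter> G)" using Y U(2) \<open>R \<subseteq> U\<close> by auto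
        then have "(Y \<union> R) \<inter> G = E" using Y True by auto
        then show "Y \<union> R \<in> {X. X \<subseteq> ?V \<and> X \<inter> G = E \<and> X \<inter> U = R}" using Y \<open>R \<subseteq> U\<close> U(2) by auto
      qed
      also have "\<dots> = 0"
      proof (rule marg_ker_sum[OF v(1)])
        obtain F where "F \<in> C" "G \<subseteq> F \<union> U" using G(1) by auto
        then show "G - U \<in> C" by (auto intro: C[of F])
      qed
      finally show ?thesis .
    next
      case False
      then show ?thesis by (intro sum.neutral) (use G in \<open>auto simp: v'_def\<close>)
    qed
  qed (simp add: v'_def)
  moreover have yV: "y \<subseteq> V" using v marg_ker_outside by blast
  then have "(y \<union> R) \<inter> V = y" "(y \<union> R) \<inter> U = R" using U by (auto simp: R_def)
  then have "v' (y \<union> R) \<noteq> 0" using v(2) yV by (auto simp: v'_def R_def)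
  moreover have "u x \<noteq> 0" if "v' x \<noteq> 0" for x
  proof -
    have "x \<subseteq> ?V" "x \<inter> U = R" "v (x \<inter> V) \<noteq> 0" using that by (auto simp: v'_def split: if_splits)
    moreover from this have "x \<inter> V \<union> R = x" by auto
    ultimately show ?thesis using v(3)[of "x \<inter> V"] by (simp add: u'_def)
  qed
  moreover have "v' x \<in> {-1, 0, 1}" for x using v(4) by (auto simp: v'_def)
  ultimately show "has_unit_below (marg_ker ?V ?C) u"
    by blast
qed

lemma regular_simplex: "regular (marg_ker V (Pow V))"
proof -
  have "u X = 0" if "u \<in> marg_ker V (Pow V)" for u X
  proof (cases "X \<subseteq> V")
    case True
    then have "{Y. Y \<subseteq> V \<and> Y \<inter> V = X} = {X}" by auto
    then show ?thesis using marg_ker_sum[OF that, of V X] by simp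
  qed (rule marg_ker_outside[OF that])
  then show ?thesis by (auto simp: regular_def)
qed

text \<open>There are no rows, so the kernel consists of all functions on the single column.\<close>

lemma regular_void: "regular (marg_ker {} {})"
  unfolding regular_def
proof (intro ballI impI)
  fix u :: "'a set \<Rightarrow> int" assume u: "u \<in> marg_ker {} {}" "\<exists>x. u x \<noteq> 0"
  then have "u {} \<noteq> 0" using marg_ker_outside by (metis subset_empty)
  moreover have "(\<lambda>X. if X = {} then 1 else 0) \<in> marg_ker {} {}" by (auto simp: marg_ker_def)
  ultimately show "has_unit_below (marg_ker {} {}) u"
    by (intro bexI[of _ "\<lambda>X. if X = {} then 1 else 0"]) auto
qed

section \<open>Disjoint union of two simplices\<close>

lemma cx_two_simplices: "finite A \<Longrightarrow> finite B \<Longrightarrow> simplicial_complex (A \<union> B) {G. G \<subseteq> A \<or> G \<subseteq> B}"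
  by (rule simplicial_complexI) auto

lemma zero_sum_other_nonzero:
  fixes h :: "'s \<Rightarrow> int"
  assumes "finite S" "a \<in> S" "sum h S = 0" "h a \<noteq> 0"
  shows "\<exists>b\<in>S. b \<noteq> a \<and> h b \<noteq> 0"
proof (rule ccontr)
  assume "\<not> ?thesis"
  then have "sum h (S - {a}) = 0" by (intro sum.neutral) auto
  then show False using assms by (simp add: sum.remove)
qed

text \<open>The support of the matrix is a bipartite graph without leaves; walking along it until a
  row repeats closes an alternating cycle. The first repetition makes the rows of the cycle
  distinct, while columns may be visited more than once.\<close>

lemma zero_sum_matrix_cycle:
  fixes M :: "'r \<Rightarrow> 'c \<Rightarrow> int"
  assumes fin: "finite I" "finite J"
    and rows: "\<And>x. x \<in> I \<Longrightarrow> (\<Sum>y\<in>J. M x y) = 0" and cols: "\<And>y. y \<in> J \<Longrightarrow> (\<Sum>x\<in>I. M x y) = 0"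
    and nz: "x0 \<in> I" "y0 \<in> J" "M x0 y0 \<noteq> 0"
  obtains W where "\<And>x. (\<Sum>y\<in>J. W x y) = (0::int)" "\<And>y. (\<Sum>x\<in>I. W x y) = 0"
    "\<And>x y. W x y \<in> {-1, 0, 1}" "\<And>x y. W x y \<noteq> 0 \<Longrightarrow> x \<in> I \<and> y \<in> J \<and> M x y \<noteq> 0" "\<exists>x y. W x y \<noteq> 0"
proof -
  define ok where "ok = (\<lambda>p. fst p \<in> I \<and> snd p \<in> J \<and> M (fst p) (snd p) \<noteq> 0)"
  \<comment> \<open>One step moves within the column of \<open>p\<close> to another row and then
    within that row to another column, so the corner \<open>(fst q, snd p)\<close> is also a nonzero
    entry.\<close>
  define step where "step = (\<lambda>p q. fst q \<noteq> fst p \<and> snd q \<noteq> snd p \<and> M (fst q) (snd p) \<noteq> 0)"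
  have "\<exists>q. ok q \<and> step p q" if okp: "ok p" for p
  proof -
    obtain x where x: "x \<in> I" "x \<noteq> fst p" "M x (snd p) \<noteq> 0"
      using zero_sum_other_nonzero[of I "fst p" "\<lambda>x. M x (snd p)"] okp fin cols unfolding ok_def by auto
    then obtain y where "y \<in> J" "y \<noteq> snd p" "M x y \<noteq> 0"
      using zero_sum_other_nonzero[of J "snd p" "M x"] okp fin rows unfolding ok_def by auto
    then show ?thesis using x by (intro exI[of _ "(x, y)"]) (auto simp: ok_def step_def)
  qed
  moreover have "ok (x0, y0)" using nz by (simp add: ok_def)
  ultimately obtain p where p: "\<And>n::nat. ok (p n)" "\<And>n. step (p n) (p (Suc n))"
    using dependent_nat_choice[of "\<lambda>_. ok" "\<lambda>_. step"] by metis
  define r where "r = (\<lambda>n. fst (p n))"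
  define c where "c = (\<lambda>n. snd (p n))"
  have rI: "r n \<in> I" and cJ: "c n \<in> J" and M1: "M (r n) (c n) \<noteq> 0" for n
    using p(1)[of n] by (auto simp: ok_def r_def c_def)
  have rne: "r (Suc n) \<noteq> r n" and cne: "c (Suc n) \<noteq> c n" and M2: "M (r (Suc n)) (c n) \<noteq> 0" for n
    using p(2)[of n] by (auto simp: step_def r_def c_def)
  have "\<not> inj r"
    using fin(1) rI finite_imageD[of r UNIV] finite_subset[of "range r" I] by auto
  then have "\<exists>j i. i < j \<and> r i = r j" unfolding inj_def by (metis linorder_neqE_nat)
  define j where "j = (LEAST j. \<exists>i<j. r i = r j)"
  have "\<exists>i<j. r i = r j" unfolding j_def by (rule LeastI_ex) (use \<open>\<exists>j i. i < j \<and> r i = r j\<close> in blast)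
  then obtain i where i: "i < j" "r i = r j" by blast
  have nrep: "r s \<noteq> r t" if "s < t" "t < j" for s t
    using that not_less_Least[of t "\<lambda>j. \<exists>i<j. r i = r j"] unfolding j_def by blast
  have inj1: "inj_on r {i..<j}"
    by (rule inj_onI) (metis nrep atLeastLessThan_iff linorder_neqE_nat)
  have inj2: "inj_on (\<lambda>t. r (Suc t)) {i..<j}"
  proof (rule linorder_inj_onI)
    fix s t assume st: "s < t" "s \<in> {i..<j}" "t \<in> {i..<j}"
    show "r (Suc s) \<noteq> r (Suc t)"
    proof (cases "Suc t = j")
      case True
      then show ?thesis using nrep[of i "Suc s"] st i by auto
    qed (use nrep[of "Suc s" "Suc t"] st in auto)
  qed auto
  define P where "P = (\<lambda>x y. \<Sum>t=i..<j. if r t = x \<and> c t = y then 1 else 0 :: int)"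
  define N where "N = (\<lambda>x y. \<Sum>t=i..<j. if r (Suc t) = x \<and> c t = y then 1 else 0 :: int)"
  \<comment> \<open>As the rows are distinct along the cycle, an entry is visited at most once even
    if its column recurs.\<close>
  have single: "(\<Sum>t=i..<j. if f t = x \<and> c t = y then 1 else 0 :: int) \<in> {0, 1}"
    if "inj_on f {i..<j}" for f :: "nat \<Rightarrow> 'r" and x y
  proof -
    let ?S = "{t \<in> {i..<j}. f t = x \<and> c t = y}"
    have eq: "(\<Sum>t=i..<j. if f t = x \<and> c t = y then 1 else 0 :: int) = int (card ?S)"
      by (simp add: sum.inter_filter[symmetric])
    have "card ?S \<le> 1"
      unfolding One_nat_def by (subst card_le_Suc0_iff_eq) (use that in \<open>auto dest: inj_onD\<close>)
    then have "card ?S = 0 \<or> card ?S = 1" by linarith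
    then show ?thesis unfolding eq by auto
  qed
  have P01: "P x y \<in> {0, 1}" and N01: "N x y \<in> {0, 1}" for x y
    unfolding P_def N_def using single[OF inj1] single[OF inj2] by blast+
  have Ppos: "P x y = 0" if "\<And>t. i \<le> t \<Longrightarrow> t < j \<Longrightarrow> \<not> (r t = x \<and> c t = y)" for x y
    unfolding P_def by (rule sum.neutral) (use that in auto)
  have Npos: "N x y = 0" if "\<And>t. i \<le> t \<Longrightarrow> t < j \<Longrightarrow> \<not> (r (Suc t) = x \<and> c t = y)" for x y
    unfolding N_def by (rule sum.neutral) (use that in auto)
  show ?thesis
  proof (rule that[of "\<lambda>x y. P x y - N x y"])
    fix x
    have "(\<Sum>y\<in>J. P x y) = (\<Sum>t=i..<j. if r t = x then 1 else 0)"
      unfolding P_def by (subst sum.swap, rule sum.cong) (use cJ fin in \<open>auto simp: sum.delta'\<close>)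
    moreover have "(\<Sum>y\<in>J. N x y) = (\<Sum>t=i..<j. if r (Suc t) = x then 1 else 0)"
      unfolding N_def by (subst sum.swap, rule sum.cong) (use cJ fin in \<open>auto simp: sum.delta'\<close>)
    \<comment> \<open>The rows of \<open>N\<close> are those of \<open>P\<close> shifted by one, so
      the difference telescopes to the two ends, which coincide because the walk closes at row
      \<open>r j\<close>.\<close>
    ultimately have "(\<Sum>y\<in>J. P x y - N x y) = - (\<Sum>t=i..<j. (if r (Suc t) = x then 1 else 0) - (if r t = x then 1 else 0))"
      by (simp add: sum_subtractf)
    also have "\<dots> = - ((if r j = x then 1 else 0) - (if r i = x then 1 else 0))"
      by (subst sum_Suc_diff'[of i j "\<lambda>t. if r t = x then 1 else 0 :: int"]) (use i in auto)
    finally show "(\<Sum>y\<in>J. P x y - N x y) = 0" using i by simp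
  next
    fix y
    have "(\<Sum>x\<in>I. P x y) = (\<Sum>t=i..<j. if c t = y then 1 else 0)"
      unfolding P_def by (subst sum.swap, rule sum.cong) (use rI fin in \<open>auto simp: sum.delta'\<close>)
    moreover have "(\<Sum>x\<in>I. N x y) = (\<Sum>t=i..<j. if c t = y then 1 else 0)"
      unfolding N_def by (subst sum.swap, rule sum.cong) (use rI fin in \<open>auto simp: sum.delta'\<close>)
    ultimately show "(\<Sum>x\<in>I. P x y - N x y) = 0" by (simp add: sum_subtractf)
  next
    show "P x y - N x y \<in> {-1, 0, 1}" for x y using P01[of x y] N01[of x y] by auto
  next
    fix x y assume "P x y - N x y \<noteq> 0"
    then have "P x y \<noteq> 0 \<or> N x y \<noteq> 0" by auto
    then show "x \<in> I \<and> y \<in> J \<and> M x y \<noteq> 0"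
      using Ppos[of x y] Npos[of x y] rI cJ M1 M2 by metis
  next
    have ij: "Suc i < j"
    proof (rule ccontr)
      assume "\<not> Suc i < j"
      then have "j = Suc i" using i by simp
      then show False using i rne[of i] by simp
    qed
    \<comment> \<open>Nothing cancels at this entry: the row \<open>r (Suc i)\<close> occurs in
      \<open>N\<close> only for \<open>t = i\<close>, in the different column
      \<open>c i\<close>.\<close>
    have "P (r (Suc i)) (c (Suc i)) \<ge> (if r (Suc i) = r (Suc i) \<and> c (Suc i) = c (Suc i) then 1 else 0)"
      unfolding P_def by (rule member_le_sum) (use ij in auto)
    moreover have "N (r (Suc i)) (c (Suc i)) = 0"
    proof (rule Npos)
      fix t assume "i \<le> t" "t < j"
      then show "\<not> (r (Suc t) = r (Suc i) \<and> c t = c (Suc i))"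
        using inj_onD[OF inj2, of t i] i cne[of i] by auto
    qed
    ultimately have "P (r (Suc i)) (c (Suc i)) - N (r (Suc i)) (c (Suc i)) \<noteq> 0" by simp
    then show "\<exists>x y. P x y - N x y \<noteq> 0" by blast
  qed
qed

text \<open>A subset is the pair of its traces on \<open>A\<close> and \<open>B\<close>, so a vector
  is a matrix. Its marginals at \<open>A\<close> are the row sums and those at \<open>B\<close> the
  column sums.\<close>

lemma regular_two_simplices:
  assumes fin: "finite A" "finite B" and AB: "A \<inter> B = {}"
  shows "regular (marg_ker (A \<union> B) {G. G \<subseteq> A \<or> G \<subseteq> B})" (is "regular (marg_ker ?V ?C)")
  unfolding regular_def
proof (intro ballI impI)
  fix u assume u: "u \<in> marg_ker ?V ?C" and "\<exists>x. u x \<noteq> 0"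
  then obtain x where x: "u x \<noteq> 0" by blast
  then have xV: "x \<subseteq> ?V" using marg_ker_outside[OF u] by blast
  have margA: "(\<Sum>X | X \<subseteq> ?V \<and> X \<inter> A = E. h X) = (\<Sum>y\<in>Pow B. h (E \<union> y))" if "E \<subseteq> A" for E and h :: "'a set \<Rightarrow> int"
    by (rule sum.reindex_bij_witness[of _ "\<lambda>y. E \<union> y" "\<lambda>X. X \<inter> B"])
       (use that AB in \<open>auto intro!: arg_cong[where f = h]\<close>)
  have margB: "(\<Sum>X | X \<subseteq> ?V \<and> X \<inter> B = E. h X) = (\<Sum>y\<in>Pow A. h (y \<union> E))" if "E \<subseteq> B" for E and h :: "'a set \<Rightarrow> int"
    by (rule sum.reindex_bij_witness[of _ "\<lambda>y. y \<union> E" "\<lambda>X. X \<inter> A"])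
       (use that AB in \<open>auto intro!: arg_cong[where f = h]\<close>)
  have split: "x \<inter> A \<union> x \<inter> B = x" using xV by auto
  obtain W where W: "\<And>x. (\<Sum>y\<in>Pow B. W x y) = (0::int)" "\<And>y. (\<Sum>x\<in>Pow A. W x y) = 0"
    "\<And>x y. W x y \<in> {-1, 0, 1}" "\<And>x y. W x y \<noteq> 0 \<Longrightarrow> x \<in> Pow A \<and> y \<in> Pow B \<and> u (x \<union> y) \<noteq> 0" "\<exists>x y. W x y \<noteq> 0"
  proof (rule zero_sum_matrix_cycle[of "Pow A" "Pow B" "\<lambda>x y. u (x \<union> y)" "x \<inter> A" "x \<inter> B"])
    show "(\<Sum>y\<in>Pow B. u (x \<union> y)) = 0" if "x \<in> Pow A" for x
      using margA[of x u] marg_ker_sum[OF u, of A x] that by simp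
    show "(\<Sum>x\<in>Pow A. u (x \<union> y)) = 0" if "y \<in> Pow B" for y
      using margB[of y u] marg_ker_sum[OF u, of B y] that by simp
  qed (use fin split x in auto)
  define w where "w = (\<lambda>X. if X \<subseteq> ?V then W (X \<inter> A) (X \<inter> B) else 0)"
  have wW: "w (x \<union> y) = W x y" if "x \<subseteq> A" "y \<subseteq> B" for x y
  proof -
    have "(x \<union> y) \<inter> A = x" "(x \<union> y) \<inter> B = y" "x \<union> y \<subseteq> ?V" using that AB by auto
    then show ?thesis by (simp add: w_def)
  qed
  have "w \<in> marg_ker ?V ?C"
  proof (rule marg_ker_facetsI)
    show "simplicial_complex ?V ?C" using fin by (rule cx_two_simplices)
    fix F E assume F: "F \<in> facets ?C" and E: "E \<subseteq> F"
    then have "F = A \<or> F = B" by (auto simp: facets_def)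
    then show "(\<Sum>X | X \<subseteq> ?V \<and> X \<inter> F = E. w X) = 0"
    proof
      assume "F = A"
      then show ?thesis using margA[of E w] E W(1)[of E] by (simp add: wW)
    next
      assume "F = B"
      then show ?thesis using margB[of E w] E W(2)[of E] by (simp add: wW)
    qed
  qed (simp add: w_def)
  moreover obtain x y where "W x y \<noteq> 0" using W(5) by blast
  then have "w (x \<union> y) \<noteq> 0" using W(4)[of x y] by (simp add: wW)
  moreover have "u X \<noteq> 0" if "w X \<noteq> 0" for X
  proof -
    have "X \<inter> A \<union> X \<inter> B = X" "W (X \<inter> A) (X \<inter> B) \<noteq> 0" using that by (auto simp: w_def split: if_splits)
    then show ?thesis using W(4) by metis
  qed
  moreover have "w x \<in> {-1, 0, 1}" for x using W(3) by (auto simp: w_def)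
  ultimately show "has_unit_below (marg_ker ?V ?C) u"
    by blast
qed

text \<open>By \<open>sq\<close>, the increment of \<open>s\<close> in a direction of
  \<open>B\<close> does not change when points of \<open>A\<close> are added, so it can be computed
  with empty \<open>A\<close>-part.\<close>

lemma mixed_difference:
  fixes s :: "'a set \<Rightarrow> int"
  assumes fin: "finite A" "finite B" and AB: "A \<inter> B = {}"
    and sq: "\<And>X a b. X \<subseteq> A \<union> B \<Longrightarrow> a \<in> A - X \<Longrightarrow> b \<in> B - X \<Longrightarrow>
      s X - s (insert a X) - s (insert b X) + s (insert a (insert b X)) = 0"
    and x: "x \<subseteq> A" and y: "y \<subseteq> B"
  shows "s (x \<union> y) = s x + s y - s {}"
proof -
  have step: "s (x \<union> insert b y) - s (x \<union> y) = s (insert b y) - s y"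
    if "insert b y \<subseteq> B" "b \<notin> y" "x \<subseteq> A" for x y b
  proof -
    have "finite x" using that fin finite_subset by blast
    then show ?thesis using \<open>x \<subseteq> A\<close>
    proof induction
      case (insert a x)
      have "s (x \<union> y) - s (insert a (x \<union> y)) - s (insert b (x \<union> y)) + s (insert a (insert b (x \<union> y))) = 0"
        by (rule sq) (use insert that AB in auto)
      then show ?case using insert by (simp add: insert_commute)
    qed simp
  qed
  have "finite y" using y fin finite_subset by blast
  then show ?thesis using y
  proof induction
    case (insert b y)
    then show ?case using step[of b y x] x by simp
  qed simp
qed

lemma cx_join_boundaries:
  "finite A \<Longrightarrow> finite B \<Longrightarrow> simplicial_complex (A \<union> B) {S. S \<subseteq> A \<union> B \<and> \<not> A \<subseteq> S \<and> \<not> B \<subseteq> S}"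
  by (rule simplicial_complexI) auto

text \<open>After multiplication by the sign \<open>(-1) ^ card X\<close>, the kernel consists of the functions
  \<open>f (X \<inter> A) - g (X \<inter> B)\<close>; cutting \<open>f\<close> and \<open>g\<close> at a common threshold makes them 0/1-valued.\<close>

lemma regular_join_boundaries:
  assumes fin: "finite A" "finite B" and AB: "A \<inter> B = {}"
  shows "regular (marg_ker (A \<union> B) {S. S \<subseteq> A \<union> B \<and> \<not> A \<subseteq> S \<and> \<not> B \<subseteq> S})" (is "regular (marg_ker ?V ?C)")
  unfolding regular_def
proof (intro ballI impI)
  fix u assume u: "u \<in> marg_ker ?V ?C" and "\<exists>x. u x \<noteq> 0"
  then obtain x where x: "u x \<noteq> 0" by blast
  then have xV: "x \<subseteq> ?V" using marg_ker_outside[OF u] by blast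
  have finV: "finite X" if "X \<subseteq> ?V" for X using that fin finite_subset by blast
  define s where "s = (\<lambda>X. (-1) ^ card X * u X)"
  have us: "u X = (-1) ^ card X * s X" for X
    unfolding s_def by (simp add: mult.assoc[symmetric] power_add[symmetric] mult_2[symmetric])
  \<comment> \<open>The complement of one point from each side is a face, and its marginals are sums
    over squares. The sign turns them into mixed second differences.\<close>
  have sq: "s X - s (insert a X) - s (insert b X) + s (insert a (insert b X)) = 0"
    if X: "X \<subseteq> ?V" and a: "a \<in> A - X" and b: "b \<in> B - X" for X a b
  proof -
    have ne: "a \<noteq> b" using a b AB by auto
    let ?F = "?V - {a, b}"
    have "?F \<in> ?C" using a b by auto
    from marg_ker_sum[OF u this, of X]
    have "(\<Sum>Y | Y \<subseteq> ?V \<and> Y \<inter> ?F = X. u Y) = 0" .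
    moreover have "{Y. Y \<subseteq> ?V \<and> Y \<inter> ?F = X} = {X, insert a X, insert b X, insert a (insert b X)}"
      using X a b AB by (auto 0 4)
    moreover have "insert a X \<noteq> insert b X" "X \<noteq> insert a X" "X \<noteq> insert b X"
      "insert a (insert b X) \<noteq> X" "insert a (insert b X) \<noteq> insert a X" "insert a (insert b X) \<noteq> insert b X"
      using a b ne by auto
    ultimately have "u X + u (insert a X) + u (insert b X) + u (insert a (insert b X)) = 0" by simp
    moreover have "card (insert a X) = Suc (card X)" "card (insert b X) = Suc (card X)"
      "card (insert a (insert b X)) = Suc (Suc (card X))"
      using a b ne finV[OF X] by auto
    ultimately have "(-1) ^ card X * (s X - s (insert a X) - s (insert b X) + s (insert a (insert b X))) = 0"
      by (simp add: us algebra_simps)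
    then show ?thesis by simp
  qed
  have dec: "s X = s (X \<inter> A) + s (X \<inter> B) - s {}" if "X \<subseteq> ?V" for X
  proof -
    have "X \<inter> A \<union> X \<inter> B = X" using that by auto
    then show ?thesis using mixed_difference[OF fin AB, of s "X \<inter> A" "X \<inter> B"] sq by auto
  qed
  define f where "f = (\<lambda>X. s (X \<inter> A))"
  define g where "g = (\<lambda>X. s {} - s (X \<inter> B))"
  have ufg: "u X = (-1) ^ card X * (f X - g X)" if "X \<subseteq> ?V" for X
    using us[of X] dec[OF that] by (simp add: f_def g_def)
  \<comment> \<open>Since \<open>f x\<close> and \<open>g x\<close> differ, exactly one of them
    reaches the larger value \<open>t\<close>, so the cuts differ at \<open>x\<close>. Wherever the
    cuts differ, \<open>f\<close> and \<open>g\<close> differ, which keeps \<open>w\<close> below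
    \<open>u\<close>.\<close>
  define t where "t = max (f x) (g x)"
  define w where "w = (\<lambda>X. if X \<subseteq> ?V then (-1) ^ card X * (of_bool (f X \<ge> t) - of_bool (g X \<ge> t)) else 0 :: int)"
  have "w \<in> marg_ker ?V ?C"
  proof (rule marg_kerI)
    fix F E assume "F \<in> ?C"
    then obtain a b where ab: "a \<in> A" "a \<notin> F" "b \<in> B" "b \<notin> F" by auto
    define w1 where "w1 = (\<lambda>X. if X \<subseteq> ?V then (-1) ^ card X * of_bool (f X \<ge> t) else 0 :: int)"
    define w2 where "w2 = (\<lambda>X. if X \<subseteq> ?V then (-1) ^ card X * of_bool (g X \<ge> t) else 0 :: int)"
    \<comment> \<open>\<open>f\<close> depends only on the \<open>A\<close>-part, so toggling
      \<open>b\<close> changes just the sign. For \<open>g\<close> the point \<open>a\<close> is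
      toggled.\<close>
    have "(\<Sum>X | X \<subseteq> ?V \<and> X \<inter> F = E. w1 X) = 0"
    proof (rule marg_flip_zero[of b])
      fix X assume X: "X \<subseteq> ?V"
      have "f (flip b X) = f X" using ab AB by (auto simp: f_def flip_def intro!: arg_cong[where f = s])
      then show "w1 (flip b X) = - w1 X"
        using X ab flip_subset[of b ?V X] by (simp add: w1_def sign_flip[OF finV[OF X]])
    qed (use ab in auto)
    moreover have "(\<Sum>X | X \<subseteq> ?V \<and> X \<inter> F = E. w2 X) = 0"
    proof (rule marg_flip_zero[of a])
      fix X assume X: "X \<subseteq> ?V"
      have "flip a X \<inter> B = X \<inter> B" using ab AB by (auto simp: flip_def)
      then have "g (flip a X) = g X" by (simp add: g_def)
      then show "w2 (flip a X) = - w2 X"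
        using X ab flip_subset[of a ?V X] by (simp add: w2_def sign_flip[OF finV[OF X]])
    qed (use ab in auto)
    moreover have "w X = w1 X - w2 X" for X by (simp add: w_def w1_def w2_def algebra_simps)
    ultimately show "(\<Sum>X | X \<subseteq> ?V \<and> X \<inter> F = E. w X) = 0" by (simp add: sum_subtractf)
  qed (simp add: w_def)
  moreover have "f x \<noteq> g x" using x ufg[OF xV] by auto
  then have "w x \<noteq> 0" using xV by (auto simp: w_def t_def max_def)
  moreover have "u X \<noteq> 0" if "w X \<noteq> 0" for X
    using that ufg[of X] by (auto simp: w_def split: if_splits)
  moreover have "w X \<in> {-1, 0, 1}" for X
    by (cases "even (card X)") (auto simp: w_def)
  ultimately show "has_unit_below (marg_ker ?V ?C) u"
    by blast
qed

section \<open>Every nuclear complex has a regular kernel\<close>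

lemma alex_dual_two_simplices:
  "A \<inter> B = {} \<Longrightarrow> alex_dual (two_simplices A B) = (A \<union> B, {S. S \<subseteq> A \<union> B \<and> \<not> A \<subseteq> S \<and> \<not> B \<subseteq> S})"
  by (auto simp: alex_dual_def two_simplices_def)

lemma cx_iso_sym:
  assumes "cx_iso K L" "snd K \<subseteq> Pow (fst K)"
  shows "cx_iso L K"
proof -
  obtain f where f: "bij_betw f (fst K) (fst L)" "snd L = (`) f ` snd K"
    using assms(1) by (auto simp: cx_iso_def)
  then show ?thesis unfolding cx_iso_def
    using bij_betw_the_inv_into[OF f(1)] bij_betw_faces[OF f(1) assms(2)] by metis
qed

lemma cx_iso_regular:
  assumes "cx_iso K L" "simplicial_complex (fst K) (snd K)" "regular (marg_ker (fst K) (snd K))"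
  shows "regular (marg_ker (fst L) (snd L))"
proof -
  obtain f where f: "bij_betw f (fst K) (fst L)" "snd L = (`) f ` snd K"
    using assms(1) by (auto simp: cx_iso_def)
  have "snd K \<subseteq> Pow (fst K)" using assms(2) by (simp add: simplicial_complex_def)
  from regular_iso[OF assms(3) f(1) this] show ?thesis unfolding f(2) .
qed

lemma cx_iso_simplicial:
  assumes "cx_iso K L" "simplicial_complex (fst K) (snd K)"
  shows "simplicial_complex (fst L) (snd L)"
proof -
  obtain f where f: "bij_betw f (fst K) (fst L)" "snd L = (`) f ` snd K"
    using assms(1) by (auto simp: cx_iso_def)
  note sc = simplicial_complexD[OF assms(2)]
  have im: "fst L = f ` fst K" using f(1) by (simp add: bij_betw_def)
  show ?thesis
  proof (rule simplicial_complexI)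
    show "finite (fst L)" using sc(1) im by simp
    show "F \<subseteq> fst L" if "F \<in> snd L" for F using that sc(2) unfolding f(2) im by auto
    fix F G assume "F \<in> snd L" "G \<subseteq> F"
    then obtain X Y where "X \<in> snd K" "Y \<subseteq> X" "G = f ` Y" unfolding f(2) by (auto simp: subset_image_iff)
    then show "G \<in> snd L" unfolding f(2) using sc(3) by blast
  qed
qed

lemma nuclear_nat_regular:
  "nuclear_nat K \<Longrightarrow> simplicial_complex (fst K) (snd K) \<and> regular (marg_ker (fst K) (snd K))"
proof (induction rule: nuclear_nat.induct)
  case (lawrence D w)
  then show ?case using cx_lawrence[of "fst D" "snd D" w] regular_lawrence[of "fst D" "snd D" w]
    by (simp add: lawrence_def)
next
  case (ghost D w)
  then show ?case using cx_ghost[of "fst D" "snd D" w] regular_ghost[of "fst D" "snd D" w]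
    by (simp add: ghost_def)
next
  case (cone_simplices A B U)
  then show ?case
    using cx_cone[OF cx_two_simplices[of A B], of U] regular_cone[OF regular_two_simplices[of A B] cx_two_simplices[of A B], of U]
    by (simp add: cone_def two_simplices_def Int_Un_distrib2)
next
  case (cone_D A B U)
  then show ?case
    using cx_cone[OF cx_join_boundaries[of A B], of U] regular_cone[OF regular_join_boundaries[of A B] cx_join_boundaries[of A B], of U]
    unfolding alex_dual_two_simplices[OF \<open>A \<inter> B = {}\<close>]
    by (simp add: cone_def Int_Un_distrib2)
next
  case void
  then show ?case by (simp add: regular_void simplicial_complex_def)
next
  case (simplex A)
  then show ?case by (auto simp: regular_simplex simplicial_complex_def)
next
  case (iso D D')
  then show ?case using cx_iso_regular cx_iso_simplicial by blast
qed

lemma nuclear_imp_unimodular: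
  assumes sc: "simplicial_complex V C" and nuc: "nuclear V C"
  shows "unimodular V C"
proof -
  obtain K where K: "nuclear_nat K" "cx_iso (V, C) K" using nuc by (auto simp: nuclear_def)
  have "cx_iso K (V, C)" by (rule cx_iso_sym[OF K(2)]) (use sc in \<open>simp add: simplicial_complex_def\<close>)
  from cx_iso_regular[OF this] nuclear_nat_regular[OF K(1)] show ?thesis
    by (simp add: unimodular_iff_regular[OF sc])
qed

section \<open>Excluded minors are not unimodular\<close>

text \<open>Listing nonfaces supplies kernel vectors directly, as moves along sets containing a
  listed one, and makes membership decidable by evaluation.\<close>

definition nonface_cx :: "'a set \<Rightarrow> 'a set set \<Rightarrow> 'a set set" where
  "nonface_cx V Ns = {X. X \<subseteq> V \<and> (\<forall>N\<in>Ns. \<not> N \<subseteq> X)}"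

definition combo :: "(int \<times> 'a set \<times> 'a set) list \<Rightarrow> 'a set \<Rightarrow> int" where
  "combo ms X = (\<Sum>(c, N, J)\<leftarrow>ms. c * move N J X)"

text \<open>The kernel vector \<open>combo ms\<close> has \<open>b\<close> in its support. The sum over \<open>G \<in> set gs\<close> of the marginals
  at \<open>G\<close> shows that a kernel vector \<open>w\<close> supported on the support of \<open>combo ms\<close> has \<open>w b\<close> even.\<close>

definition certificate :: "'a set \<Rightarrow> 'a set set \<Rightarrow> (int \<times> 'a set \<times> 'a set) list \<Rightarrow> 'a set list \<Rightarrow> 'a set \<Rightarrow> bool" where
  "certificate V Ns ms gs b \<longleftrightarrow>
     (\<forall>(c, N, J)\<in>set ms. N \<subseteq> V \<and> J \<subseteq> V \<and> (\<exists>M\<in>Ns. M \<subseteq> N)) \<and>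
     (\<forall>G\<in>set gs. G \<subseteq> V \<and> (\<forall>N\<in>Ns. \<not> N \<subseteq> G)) \<and>
     b \<subseteq> V \<and> combo ms b \<noteq> 0 \<and> odd (length (filter (\<lambda>G. G \<subseteq> b) gs)) \<and>
     (\<forall>X\<in>Pow V. X = b \<or> combo ms X = 0 \<or> even (length (filter (\<lambda>G. G \<subseteq> X) gs)))"

lemma marg_ker_zero: "(\<lambda>X. 0) \<in> marg_ker V C"
  by (simp add: marg_ker_def)

lemma regular_marg_ker_through_point:
  assumes "regular (marg_ker V C)" "finite V" "u \<in> marg_ker V C" "u b \<noteq> 0"
  obtains w where "w \<in> marg_ker V C" "w b \<noteq> 0" "\<And>x. w x \<noteq> 0 \<Longrightarrow> u x \<noteq> 0" "\<And>x. w x \<in> {-1, 0, 1}"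
proof -
  have "finite {X. u X \<noteq> 0}" if "u \<in> marg_ker V C" for u
    by (rule finite_subset[of _ "Pow V"]) (use marg_ker_outside[OF that] assms(2) in auto)
  from regular_through_point[OF assms(1) this marg_ker_comb assms(3,4)] show ?thesis using that by blast
qed

lemma combo_in_marg_ker:
  assumes "finite V" "\<forall>(c, N, J)\<in>set ms. N \<subseteq> V \<and> J \<subseteq> V \<and> (\<exists>M\<in>Ns. M \<subseteq> N)"
  shows "combo ms \<in> marg_ker V (nonface_cx V Ns)"
  using assms(2)
proof (induction ms)
  case Nil
  then show ?case using marg_ker_zero by (simp add: combo_def)
next
  case (Cons m ms)
  obtain c N J where m: "m = (c, N, J)" by (metis prod_cases3)
  have "move N J \<in> marg_ker V (nonface_cx V Ns)"
  proof (rule move_in_marg_ker)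
    show "N \<subseteq> V" "J \<subseteq> V" using Cons.prems m by auto
    obtain M where "M \<in> Ns" "M \<subseteq> N" using Cons.prems m by auto
    then show "\<not> N \<subseteq> F" if "F \<in> nonface_cx V Ns" for F
      using that unfolding nonface_cx_def by blast
  qed (rule assms(1))
  from marg_ker_comb[OF this Cons.IH, of c 1] show ?case using Cons.prems m by (simp add: combo_def)
qed

lemma certificate_not_regular:
  assumes cert: "certificate V Ns ms gs b" and fin: "finite V"
  shows "\<not> regular (marg_ker V (nonface_cx V Ns))"
proof
  let ?C = "nonface_cx V Ns"
  let ?g = "\<lambda>X. length (filter (\<lambda>G. G \<subseteq> X) gs)"
  assume reg: "regular (marg_ker V ?C)"
  have ms: "\<forall>(c, N, J)\<in>set ms. N \<subseteq> V \<and> J \<subseteq> V \<and> (\<exists>M\<in>Ns. M \<subseteq> N)"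
    and gs: "\<And>G. G \<in> set gs \<Longrightarrow> G \<in> ?C" and b: "b \<subseteq> V" "combo ms b \<noteq> 0" "odd (?g b)"
    and ev: "\<And>X. X \<subseteq> V \<Longrightarrow> X \<noteq> b \<Longrightarrow> combo ms X \<noteq> 0 \<Longrightarrow> even (?g X)"
    using cert unfolding certificate_def nonface_cx_def by (simp_all) blast+
  \<comment> \<open>The vector must be nonzero at \<open>b\<close> itself, since the marginals
    constrain parity only there; this is what \<open>regular_through_point\<close> provides.\<close>
  obtain w where w: "w \<in> marg_ker V ?C" "w b \<noteq> 0" "\<And>X. w X \<noteq> 0 \<Longrightarrow> combo ms X \<noteq> 0"
    "\<And>X. w X \<in> {-1, 0, 1}"
    using regular_marg_ker_through_point[OF reg fin combo_in_marg_ker[OF fin ms] b(2)] by metis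
  have "(\<Sum>X\<in>Pow V. int (length (filter (\<lambda>G. G \<subseteq> X) hs)) * w X) = 0" if "set hs \<subseteq> ?C" for hs
    using that
  proof (induction hs)
    case (Cons G hs)
    have "(\<Sum>X\<in>Pow V. int (length (filter (\<lambda>G. G \<subseteq> X) (G # hs))) * w X)
        = (\<Sum>X\<in>Pow V. (if G \<subseteq> X then w X else 0) + int (length (filter (\<lambda>G. G \<subseteq> X) hs)) * w X)"
      by (rule sum.cong) (auto simp: algebra_simps)
    also have "\<dots> = (\<Sum>X | X \<in> Pow V \<and> G \<subseteq> X. w X) + 0"
      using Cons fin by (simp add: sum.distrib sum.inter_filter[symmetric])
    also have "{X. X \<in> Pow V \<and> G \<subseteq> X} = {X. X \<subseteq> V \<and> X \<inter> G = G}" by auto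
    also have "sum w {X. X \<subseteq> V \<and> X \<inter> G = G} + 0 = 0" using marg_ker_sum[OF w(1), of G G] Cons.prems by simp
    finally show ?case .
  qed simp
  then have "(\<Sum>X\<in>Pow V. int (?g X) * w X) = 0" using gs by blast
  then have "int (?g b) * w b = - (\<Sum>X\<in>Pow V - {b}. int (?g X) * w X)"
    using b(1) fin by (subst (asm) sum.remove[of _ b]) auto
  moreover have "even (\<Sum>X\<in>Pow V - {b}. int (?g X) * w X)"
  proof (rule dvd_sum)
    fix X assume X: "X \<in> Pow V - {b}"
    show "2 dvd int (?g X) * w X"
    proof (cases "w X = 0")
      case False
      then have "even (?g X)" using ev[of X] w(3) X by blast
      then show ?thesis by (intro dvd_mult2) simp
    qed simp
  qed
  ultimately have "even (int (?g b) * w b)" by simp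
  then have "even (w b)" using b(3) by simp
  then show False using w(2) w(4)[of b] by auto
qed

section \<open>Certificates for the individual excluded complexes\<close>

lemma gen_eq_nonface_cx:
  assumes "\<forall>X\<in>Pow V. (\<exists>F\<in>Fs. X \<subseteq> F) \<longleftrightarrow> (\<forall>N\<in>Ns. \<not> N \<subseteq> X)" "\<forall>F\<in>Fs. F \<subseteq> V"
  shows "gen V Fs = (V, nonface_cx V Ns)"
  using assms unfolding gen_def nonface_cx_def by blast

lemma interval_4: "{1..4} = {1, 2, 3, 4::nat}" and interval_5: "{1..5} = {1, 2, 3, 4, 5::nat}"
  and interval_6: "{1..6} = {1, 2, 3, 4, 5, 6::nat}"
  by (auto simp: numeral_eq_Suc)

lemma P4_eq: "P4 = ({1, 2, 3, 4}, nonface_cx {1, 2, 3, 4} {{1, 3}, {1, 4}, {2, 4}})"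
  unfolding P4_def interval_4 by (rule gen_eq_nonface_cx) code_simp+

lemma O6_eq: "O6 = ({1, 2, 3, 4, 5, 6}, nonface_cx {1, 2, 3, 4, 5, 6} {{1, 2}, {3, 4}, {5, 6}})"
  unfolding O6_def interval_6 by (simp add: nonface_cx_def)

lemma O6_dual_eq: "alex_dual O6 = ({1, 2, 3, 4, 5, 6}, nonface_cx {1, 2, 3, 4, 5, 6}
  {{1, 3, 5}, {1, 3, 6}, {1, 4, 5}, {1, 4, 6}, {2, 3, 5}, {2, 3, 6}, {2, 4, 5}, {2, 4, 6}})"
  unfolding O6_eq alex_dual_def nonface_cx_def by auto

lemma J1_eq: "J1 = ({1, 2, 3, 4, 5}, nonface_cx {1, 2, 3, 4, 5} {{1, 3}, {1, 4}, {2, 5}})"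
  unfolding J1_def interval_5 by (rule gen_eq_nonface_cx) code_simp+

lemma J1_dual_eq: "J1_dual = ({1, 2, 3, 4, 5}, nonface_cx {1, 2, 3, 4, 5} {{1, 2}, {1, 5}, {2, 3, 4}, {3, 4, 5}})"
  unfolding J1_dual_def interval_5 by (rule gen_eq_nonface_cx) code_simp+

lemma J2_eq: "J2 = ({1, 2, 3, 4, 5}, nonface_cx {1, 2, 3, 4, 5} {{1, 3}, {2, 4}, {1, 2, 5}, {3, 4, 5}})"
  unfolding J2_def interval_5 by (rule gen_eq_nonface_cx) code_simp+

definition bdry_nonfaces :: "nat \<Rightarrow> nat set set" where
  "bdry_nonfaces n = insert {0..n} ((\<lambda>i. {i, Suc n}) ` {0..n})"

lemma bdry_eq: "bdry_plus_pt n = ({0..Suc n}, nonface_cx {0..Suc n} (bdry_nonfaces n))"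
proof -
  have "X \<in> {G. G \<subset> {0..n}} \<union> {{}, {Suc n}} \<longleftrightarrow> X \<in> nonface_cx {0..Suc n} (bdry_nonfaces n)" for X
  proof (cases "Suc n \<in> X")
    case True
    have "X \<in> nonface_cx {0..Suc n} (bdry_nonfaces n) \<longleftrightarrow> X \<subseteq> insert (Suc n) {0..n} \<and> X \<inter> {0..n} = {}"
      using True by (auto simp: nonface_cx_def bdry_nonfaces_def atLeast0_atMost_Suc) (drule Int_absorb1, simp)
    also have "\<dots> \<longleftrightarrow> X \<subseteq> {Suc n}" by auto
    finally show ?thesis using True by auto
  next
    case False
    then have "X \<subseteq> {0..Suc n} \<longleftrightarrow> X \<subseteq> {0..n}" by (auto simp: le_Suc_eq)
    then show ?thesis using False by (auto simp: nonface_cx_def bdry_nonfaces_def)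
  qed
  then show ?thesis unfolding bdry_plus_pt_def by blast
qed

text \<open>The two moves through \<open>{2, 3, 4}\<close> add up to -2 there, and three of the four
  listed faces lie in that set. The remaining conditions are evaluated over all subsets, here and
  for the other certificates.\<close>

lemma not_regular_P4: "\<not> regular (marg_ker {1, 2, 3, 4::nat} (nonface_cx {1, 2, 3, 4} {{1, 3}, {1, 4}, {2, 4}}))"
proof (rule certificate_not_regular)
  show "certificate {1, 2, 3, 4::nat} {{1, 3}, {1, 4}, {2, 4}}
    [(-1, {1, 2, 3}, {4}), (-1, {2, 4}, {}), (-1, {2, 4}, {3}), (1, {1, 4}, {3})]
    [{3}, {4}, {1}, {2, 3}] {2, 3, 4}"
    by code_simp
qed simp

lemma not_regular_O6:
  "\<not> regular (marg_ker {1, 2, 3, 4, 5, 6::nat} (nonface_cx {1, 2, 3, 4, 5, 6} {{1, 2}, {3, 4}, {5, 6}}))"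
proof (rule certificate_not_regular)
  show "certificate {1, 2, 3, 4, 5, 6::nat} {{1, 2}, {3, 4}, {5, 6}}
    [(1, {1, 2}, {6}), (1, {1, 2}, {4}), (-1, {4, 5, 6}, {1}), (-1, {3, 4}, {1, 2, 6}),
     (1, {5, 6}, {1, 2, 4}), (-1, {3, 4, 6}, {1, 5})]
    [{}, {1}, {4}, {2}, {6}, {2, 6}, {4, 5}, {2, 4}, {3, 6}] {1, 2, 4}"
    by code_simp
qed simp

lemma not_regular_O6_dual:
  "\<not> regular (marg_ker {1, 2, 3, 4, 5, 6::nat} (nonface_cx {1, 2, 3, 4, 5, 6}
    {{1, 3, 5}, {1, 3, 6}, {1, 4, 5}, {1, 4, 6}, {2, 3, 5}, {2, 3, 6}, {2, 4, 5}, {2, 4, 6}}))"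
proof (rule certificate_not_regular)
  show "certificate {1, 2, 3, 4, 5, 6::nat}
    {{1, 3, 5}, {1, 3, 6}, {1, 4, 5}, {1, 4, 6}, {2, 3, 5}, {2, 3, 6}, {2, 4, 5}, {2, 4, 6}}
    [(1, {2, 3, 6}, {1}), (-1, {1, 3, 5}, {6}), (1, {2, 4, 5}, {1, 6})]
    [{3}, {2, 6}, {4, 5}, {2, 4}, {1, 3}, {3, 6}, {1, 5}] {1, 5, 6}"
    by code_simp
qed simp

lemma not_regular_J1:
  "\<not> regular (marg_ker {1, 2, 3, 4, 5::nat} (nonface_cx {1, 2, 3, 4, 5} {{1, 3}, {1, 4}, {2, 5}}))"
proof (rule certificate_not_regular)
  show "certificate {1, 2, 3, 4, 5::nat} {{1, 3}, {1, 4}, {2, 5}}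
    [(-1, {2, 5}, {1, 3}), (-1, {1, 4}, {3}), (1, {1, 4}, {2, 3, 5}), (1, {1, 2, 3}, {4, 5}), (1, {2, 3, 5}, {4})]
    [{3, 4}, {1}, {5}, {3, 4, 5}, {2, 3}] {1, 2, 3, 5}"
    by code_simp
qed simp

lemma not_regular_J1_dual:
  "\<not> regular (marg_ker {1, 2, 3, 4, 5::nat} (nonface_cx {1, 2, 3, 4, 5} {{1, 2}, {1, 5}, {2, 3, 4}, {3, 4, 5}}))"
proof (rule certificate_not_regular)
  show "certificate {1, 2, 3, 4, 5::nat} {{1, 2}, {1, 5}, {2, 3, 4}, {3, 4, 5}}
    [(-1, {2, 3, 4}, {1}), (1, {1, 5}, {4}), (-1, {2, 3, 4}, {5}), (1, {1, 5}, {3}), (1, {1, 2}, {5}), (1, {1, 5}, {})]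
    [{1, 3}, {1, 3, 4}, {2, 3}, {2}, {4, 5}, {1}, {3, 4}] {1}"
    by code_simp
qed simp

lemma not_regular_J2:
  "\<not> regular (marg_ker {1, 2, 3, 4, 5::nat} (nonface_cx {1, 2, 3, 4, 5} {{1, 3}, {2, 4}, {1, 2, 5}, {3, 4, 5}}))"
proof (rule certificate_not_regular)
  show "certificate {1, 2, 3, 4, 5::nat} {{1, 3}, {2, 4}, {1, 2, 5}, {3, 4, 5}}
    [(1, {2, 3, 4, 5}, {1}), (-1, {3, 4, 5}, {1}), (1, {2, 4, 5}, {1, 3}), (-1, {2, 3, 4}, {1, 5}), (1, {1, 2, 5}, {})]
    [{4}, {3, 4}, {1, 2}, {1, 5}] {1, 2, 4, 5}"
    by code_simp
qed simp

text \<open>The ground set varies with \<open>n\<close>, so evaluation is replaced by a direct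
  argument: three marginals force \<open>w {0}\<close> to be even.\<close>

lemma not_regular_bdry:
  assumes n: "n \<ge> 1"
  shows "\<not> regular (marg_ker {0..Suc n} (nonface_cx {0..Suc n} (bdry_nonfaces n)))"
proof
  let ?V = "{0..Suc n}" and ?v = "Suc n"
  let ?C = "nonface_cx ?V (bdry_nonfaces n)"
  \<comment> \<open>The moves are arranged so that the values at \<open>{?v}\<close> and
    \<open>{0, 1, ?v}\<close> cancel, those at \<open>{0}\<close> add up to -2, and
    \<open>{}\<close>, \<open>{0}\<close>, \<open>{0, 1}\<close> are the only supporting sets
    without \<open>?v\<close>.\<close>
  define ms :: "(int \<times> nat set \<times> nat set) list" where
    "ms = [(1, {0..n}, {?v}), (1, {0, ?v}, {}), (-1, {1, ?v}, {0})]"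
  assume reg: "regular (marg_ker ?V ?C)"
  have "{0, ?v} \<in> bdry_nonfaces n" "{1, ?v} \<in> bdry_nonfaces n" "{0..n} \<in> bdry_nonfaces n"
    using n by (auto simp: bdry_nonfaces_def)
  then have "combo ms \<in> marg_ker ?V ?C"
    by (intro combo_in_marg_ker) (use n in \<open>auto simp: ms_def\<close>)
  moreover have val: "combo ms X = (if X - {0..n} = {?v} then (-1) ^ card (X \<inter> {0..n}) else 0)
      + (if X - {0, ?v} = {} then (-1) ^ card (X \<inter> {0, ?v}) else 0)
      - (if X - {1, ?v} = {0} then (-1) ^ card (X \<inter> {1, ?v}) else 0)" for X
    by (simp add: combo_def ms_def move_def)
  have "combo ms {0} \<noteq> 0" using n unfolding val by auto
  ultimately obtain w where w: "w \<in> marg_ker ?V ?C" "w {0} \<noteq> 0" "\<And>x. w x \<noteq> 0 \<Longrightarrow> combo ms x \<noteq> 0"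
    "\<And>x. w x \<in> {-1, 0, 1}"
    using regular_marg_ker_through_point[OF reg] by blast
  have "combo ms {?v} = 0" using n unfolding val by auto
  then have wv: "w {?v} = 0" using w(3) by blast
  have "{0, 1, ?v} \<inter> {0..n} = {0, 1}" "{0, 1, ?v} - {0..n} = {?v}" "{0, 1, ?v} \<inter> {1, ?v} = {1, ?v}"
    "{0, 1, ?v} - {1, ?v} = {0}" "{0, 1, ?v} - {0, ?v} = {1}"
    using n by auto
  then have "combo ms {0, 1, ?v} = 0" using n unfolding val by auto
  then have w01v: "w {0, 1, ?v} = 0" using w(3) by blast
  have w0: "w X = 0" if "X \<subseteq> {0..n}" "X \<notin> {{}, {0}, {0, 1}}" for X
  proof -
    have "?v \<notin> X" using that by auto
    then have "X - {0..n} = {}" "X - {0, ?v} = X - {0}" "X - {1, ?v} = X - {1}" using that by auto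
    moreover have "X - {0} = {} \<longrightarrow> X = {} \<or> X = {0}" "X - {1} = {0} \<longrightarrow> X = {0} \<or> X = {0, 1}" by blast+
    then have "X - {0} \<noteq> {}" "X - {1} \<noteq> {0}" using that(2) by blast+
    ultimately have "combo ms X = 0" unfolding val by auto
    then show ?thesis using w(3) by blast
  qed
  \<comment> \<open>Removing one point \<open>i\<close> from the boundary's vertex set leaves a
    face, whose marginals have only four terms. The cases \<open>i = 0\<close> and
    \<open>i = 1\<close> share two terms, and their difference equates \<open>w {}\<close> and
    \<open>w {0, 1}\<close>.\<close>
  have edge: "w E + w (insert i E) + w (insert ?v E) + w (insert i (insert ?v E)) = 0"
    if "i \<le> n" "E \<subseteq> {0..n} - {i}" for i E
  proof -
    have F: "{0..n} - {i} \<in> ?C" using that by (auto simp: nonface_cx_def bdry_nonfaces_def)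
    have "{X. X \<subseteq> ?V \<and> X \<inter> ({0..n} - {i}) = E} = {E, insert i E, insert ?v E, insert i (insert ?v E)}"
    proof -
      have V: "?V = insert ?v (insert i ({0..n} - {i}))" using that by auto
      show ?thesis
      proof (intro equalityI subsetI)
        fix X assume X: "X \<in> {X. X \<subseteq> ?V \<and> X \<inter> ({0..n} - {i}) = E}"
        then have "X = E \<union> (X \<inter> {i, ?v})" using V by auto
        then show "X \<in> {E, insert i E, insert ?v E, insert i (insert ?v E)}"
          by (cases "i \<in> X"; cases "?v \<in> X") auto
      qed (use that in auto)
    qed
    moreover have ne: "i \<notin> E" "?v \<notin> E" "?v \<noteq> i" using that by auto
    have "insert i E \<noteq> E" "insert ?v E \<noteq> E" "insert i (insert ?v E) \<noteq> E"
      using ne(1,2) by (metis insertI1)+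
    moreover have "insert ?v E \<noteq> insert i E" "insert i (insert ?v E) \<noteq> insert i E"
      using ne(2,3) by (metis insert_iff)+
    moreover have "insert i (insert ?v E) \<noteq> insert ?v E"
      using ne(1,3) by (metis insert_iff)
    ultimately show ?thesis using marg_ker_sum[OF w(1) F, of E] by simp
  qed
  have "w {} + w {0} + w {?v} + w {0, ?v} = 0" using edge[of 0 "{}"] by simp
  moreover have "w {0} + w {0, 1} + w {0, ?v} + w {0, 1, ?v} = 0"
    using edge[of 1 "{0}"] n by (simp add: insert_commute)
  ultimately have eq: "w {} = w {0, 1}" using wv w01v by simp
  have "{?v} \<in> ?C" by (auto simp: nonface_cx_def bdry_nonfaces_def)
  from marg_ker_sum[OF w(1) this, of "{}"] have "(\<Sum>X | X \<subseteq> ?V \<and> X \<inter> {?v} = {}. w X) = 0" .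
  also have "(\<Sum>X | X \<subseteq> ?V \<and> X \<inter> {?v} = {}. w X) = (\<Sum>X\<in>{{}, {0}, {0, 1}}. w X)"
  proof (rule sum.mono_neutral_right)
    show "\<forall>X\<in>{X. X \<subseteq> ?V \<and> X \<inter> {?v} = {}} - {{}, {0}, {0, 1}}. w X = 0"
    proof
      fix X assume X: "X \<in> {X. X \<subseteq> ?V \<and> X \<inter> {?v} = {}} - {{}, {0}, {0, 1}}"
      then have "X \<subseteq> {0..n}" by (auto simp: le_Suc_eq)
      then show "w X = 0" using w0 X by blast
    qed
  qed (use n in auto)
  also have "\<dots> = w {} + w {0} + w {0, 1}" by (simp add: doubleton_eq_iff)
  finally have "w {0} = - 2 * w {}" using eq by simp
  then show False using w(2) w(4)[of "{0}"] by auto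
qed

section \<open>From unimodularity to the absence of excluded minors\<close>

definition forbidden :: "'a cx \<Rightarrow> bool" where
  "forbidden M \<longleftrightarrow> cx_iso M P4 \<or> cx_iso M O6 \<or> cx_iso M (alex_dual O6) \<or> cx_iso M J1 \<or>
     cx_iso M J1_dual \<or> cx_iso M J2 \<or> (\<exists>n\<ge>1. cx_iso M (bdry_plus_pt n))"

lemma beta_avoiding_iff: "beta_avoiding V C \<longleftrightarrow> (\<forall>M. is_minor M (V, C) \<longrightarrow> \<not> forbidden M)"
  unfolding beta_avoiding_def forbidden_def by blast

lemma forbidden_not_regular:
  assumes "forbidden M" "simplicial_complex (fst M) (snd M)"
  shows "\<not> regular (marg_ker (fst M) (snd M))"
proof
  assume reg: "regular (marg_ker (fst M) (snd M))"
  have no: "\<not> cx_iso M (W, D)" if "\<not> regular (marg_ker W D)" for W :: "nat set" and D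
    using cx_iso_regular[OF _ assms(2) reg, of "(W, D)"] that by auto
  have "\<not> cx_iso M P4" unfolding P4_eq by (rule no[OF not_regular_P4])
  moreover have "\<not> cx_iso M (alex_dual O6)" unfolding O6_dual_eq by (rule no[OF not_regular_O6_dual])
  moreover have "\<not> cx_iso M O6" unfolding O6_eq by (rule no[OF not_regular_O6])
  moreover have "\<not> cx_iso M J1" unfolding J1_eq by (rule no[OF not_regular_J1])
  moreover have "\<not> cx_iso M J1_dual" unfolding J1_dual_eq by (rule no[OF not_regular_J1_dual])
  moreover have "\<not> cx_iso M J2" unfolding J2_eq by (rule no[OF not_regular_J2])
  moreover have "\<not> cx_iso M (bdry_plus_pt n)" if "n \<ge> 1" for n
    unfolding bdry_eq by (rule no[OF not_regular_bdry[OF that]])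
  ultimately show False using assms(1) unfolding forbidden_def by blast
qed

lemma unimodular_imp_beta_avoiding:
  assumes sc: "simplicial_complex V C" and uni: "unimodular V C"
  shows "beta_avoiding V C"
  unfolding beta_avoiding_iff
proof (intro allI impI notI)
  fix M :: "'a cx"
  assume "is_minor M (V, C)" and forb: "forbidden M"
  then obtain S R where SR: "S \<subseteq> V" "S \<inter> R = {}" "R \<in> C" "M = link R (del S (V, C))"
    by (auto simp: is_minor_def)
  let ?C = "{F \<in> C. F \<subseteq> V - S}"
  have M: "M = (V - S - R, {F - R | F. F \<in> ?C \<and> R \<subseteq> F})"
    unfolding SR(4) link_def del_def by simp
  have sc': "simplicial_complex (V - S) ?C"
    by (rule simplicial_complexI) (use simplicial_complexD[OF sc] in auto)
  have "R \<in> ?C" using SR simplicial_complexD(2)[OF sc, of R] by auto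
  moreover have "regular (marg_ker (V - S) ?C)"
  proof (rule regular_deletion)
    show "regular (marg_ker V C)" using uni unimodular_iff_regular[OF sc] by simp
  qed (use simplicial_complexD[OF sc] in auto)
  ultimately have "regular (marg_ker (fst M) (snd M))"
    unfolding M fst_conv snd_conv using regular_link[OF _ sc'] by blast
  moreover have "simplicial_complex (fst M) (snd M)"
    unfolding M fst_conv snd_conv
  proof (rule simplicial_complexI)
    fix F G assume "F \<in> {F - R | F. F \<in> ?C \<and> R \<subseteq> F}" "G \<subseteq> F"
    then obtain F' where F': "F' \<in> ?C" "R \<subseteq> F'" "G \<subseteq> F' - R" by blast
    have "G \<union> R \<in> ?C" using F' simplicial_complexD(3)[OF sc', of F' "G \<union> R"] by blast
    moreover have "G = (G \<union> R) - R" using F' by blast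
    ultimately show "G \<in> {F - R | F. F \<in> ?C \<and> R \<subseteq> F}" by blast
  qed (use simplicial_complexD(1)[OF sc] in auto)
  ultimately show False using forbidden_not_regular[OF forb] by blast
qed

section \<open>Minors and Alexander duality of avoiding complexes\<close>

text \<open>Deletion and link in one formula: \<open>W\<close> remains, \<open>R\<close> is
  contracted, everything else is deleted. Iterated minors compose by uniting the contracted sets,
  and contracting a nonface of a complex gives the void family.\<close>

definition minor_faces :: "'a set set \<Rightarrow> 'a set \<Rightarrow> 'a set \<Rightarrow> 'a set set" where
  "minor_faces C W R = {F. F \<subseteq> W \<and> F \<union> R \<in> C}"

lemma is_minor_iff:
  assumes sc: "simplicial_complex V C"
  shows "is_minor M (V, C) \<longleftrightarrow>
    (\<exists>W R. W \<inter> R = {} \<and> W \<union> R \<subseteq> V \<and> R \<in> C \<and> M = (W, minor_faces C W R))" (is "?l \<longleftrightarrow> ?r")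
proof -
  have eq: "link R (del S (V, C)) = (V - S - R, minor_faces C (V - S - R) R)"
    if "S \<subseteq> V" "R \<subseteq> V" "S \<inter> R = {}" for S R
  proof -
    have "{F - R | F. (F \<in> C \<and> F \<subseteq> V - S) \<and> R \<subseteq> F} = minor_faces C (V - S - R) R" (is "?A = ?B")
    proof (intro equalityI subsetI)
      fix G assume "G \<in> ?A"
      then obtain F where F: "G = F - R" "F \<in> C" "F \<subseteq> V - S" "R \<subseteq> F" by blast
      then have "G \<union> R = F" by blast
      then show "G \<in> ?B" using F by (auto simp: minor_faces_def)
    next
      fix G assume G: "G \<in> ?B"
      then have "G = (G \<union> R) - R" "G \<union> R \<subseteq> V - S" using that by (auto simp: minor_faces_def)
      then show "G \<in> ?A" using G unfolding minor_faces_def by blast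
    qed
    then show ?thesis by (simp add: link_def del_def)
  qed
  show ?thesis
  proof
    assume ?l
    then obtain S R where "S \<subseteq> V" "R \<subseteq> V" "S \<inter> R = {}" "R \<in> C" "M = link R (del S (V, C))"
      by (auto simp: is_minor_def)
    moreover from this have "M = (V - S - R, minor_faces C (V - S - R) R)" using eq by simp
    ultimately show ?r by blast
  next
    assume ?r
    then obtain W R where WR: "W \<inter> R = {}" "W \<union> R \<subseteq> V" "R \<in> C" "M = (W, minor_faces C W R)" by blast
    define S where "S = V - W - R"
    have "V - S - R = W" "S \<subseteq> V" "R \<subseteq> V" "S \<inter> R = {}" using WR by (auto simp: S_def)
    moreover from this have "M = link R (del S (V, C))" using WR eq[of S R] by simp
    ultimately show ?l unfolding is_minor_def fst_conv snd_conv using WR(3) by blast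
  qed
qed

lemma cx_minor_faces:
  assumes sc: "simplicial_complex V C" and W: "W \<subseteq> V"
  shows "simplicial_complex W (minor_faces C W R)"
proof (rule simplicial_complexI)
  show "finite W" using simplicial_complexD(1)[OF sc] W finite_subset by blast
  fix F G assume "F \<in> minor_faces C W R" "G \<subseteq> F"
  then show "G \<in> minor_faces C W R"
    using simplicial_complexD(3)[OF sc, of "F \<union> R" "G \<union> R"] by (auto simp: minor_faces_def)
qed (auto simp: minor_faces_def)

lemma avoiding_not_forbidden:
  assumes "simplicial_complex V C" "beta_avoiding V C" "W \<inter> R = {}" "W \<union> R \<subseteq> V" "R \<in> C"
  shows "\<not> forbidden (W, minor_faces C W R)"
  using assms unfolding beta_avoiding_iff is_minor_iff[OF assms(1)] by blast

lemma avoiding_minor: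
  assumes sc: "simplicial_complex V C" and av: "beta_avoiding V C"
    and WR: "W \<inter> R = {}" "W \<union> R \<subseteq> V" "R \<in> C"
  shows "beta_avoiding W (minor_faces C W R)"
proof -
  have sc': "simplicial_complex W (minor_faces C W R)" using cx_minor_faces[OF sc] WR by blast
  show ?thesis unfolding beta_avoiding_iff is_minor_iff[OF sc']
  proof (intro allI impI)
    fix M assume "\<exists>W' R'. W' \<inter> R' = {} \<and> W' \<union> R' \<subseteq> W \<and> R' \<in> minor_faces C W R \<and>
      M = (W', minor_faces (minor_faces C W R) W' R')"
    then obtain W' R' where M: "W' \<inter> R' = {}" "W' \<union> R' \<subseteq> W" "R' \<in> minor_faces C W R"
      "M = (W', minor_faces (minor_faces C W R) W' R')" by blast
    have "minor_faces (minor_faces C W R) W' R' = minor_faces C W' (R' \<union> R)"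
      using M(2) by (auto simp: minor_faces_def Un_assoc)
    moreover have "\<not> forbidden (W', minor_faces C W' (R' \<union> R))"
      by (rule avoiding_not_forbidden[OF sc av]) (use M WR in \<open>auto simp: minor_faces_def\<close>)
    ultimately show "\<not> forbidden M" using M(4) by simp
  qed
qed

section \<open>Isomorphisms and duality of the excluded list\<close>

lemma cx_isoI:
  assumes "bij_betw f V W" "C \<subseteq> Pow V" "D \<subseteq> Pow W" "\<And>X. X \<subseteq> V \<Longrightarrow> f ` X \<in> D \<longleftrightarrow> X \<in> C"
  shows "cx_iso (V, C) (W, D)"
proof -
  have "D = (`) f ` C"
  proof (intro equalityI subsetI)
    fix Y assume Y: "Y \<in> D"
    then have "Y \<subseteq> f ` V" using assms(1,3) by (auto simp: bij_betw_def)
    then obtain X where "X \<subseteq> V" "Y = f ` X" by (auto simp: subset_image_iff)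
    then show "Y \<in> (`) f ` C" using assms(4) Y by blast
  qed (use assms in auto)
  then show ?thesis using assms(1) by (auto simp: cx_iso_def)
qed

lemma cx_iso_trans:
  assumes "cx_iso K L" "cx_iso L M" shows "cx_iso K M"
proof -
  obtain f g where f: "bij_betw f (fst K) (fst L)" "snd L = (`) f ` snd K"
    and g: "bij_betw g (fst L) (fst M)" "snd M = (`) g ` snd L"
    using assms by (auto simp: cx_iso_def)
  have "snd M = (`) (g \<circ> f) ` snd K" unfolding g(2) f(2) by (simp add: image_image image_comp)
  then show ?thesis using bij_betw_trans[OF f(1) g(1)] unfolding cx_iso_def by blast
qed

lemma cx_iso_alex_dual:
  assumes "cx_iso K L" "snd K \<subseteq> Pow (fst K)"
  shows "cx_iso (alex_dual K) (alex_dual L)"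
proof -
  obtain f where f: "bij_betw f (fst K) (fst L)" "snd L = (`) f ` snd K"
    using assms(1) by (auto simp: cx_iso_def)
  have inj: "inj_on f (fst K)" and im: "f ` fst K = fst L" using f(1) by (auto simp: bij_betw_def)
  show ?thesis unfolding alex_dual_def
  proof (rule cx_isoI[OF f(1)])
    fix X assume X: "X \<subseteq> fst K"
    have "fst L - f ` X = f ` (fst K - X)" using inj_on_image_set_diff[OF inj, of "fst K" X] X im by auto
    moreover have "f ` (fst K - X) \<in> snd L \<longleftrightarrow> fst K - X \<in> snd K"
    proof
      assume "f ` (fst K - X) \<in> snd L"
      then obtain Y where "Y \<in> snd K" "f ` (fst K - X) = f ` Y" using f(2) by auto
      moreover from this have "fst K - X = Y"
        using inj_on_image_eq_iff[OF inj, of "fst K - X" Y] assms(2) by auto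
      ultimately show "fst K - X \<in> snd K" by simp
    qed (use f(2) in auto)
    moreover have "f ` X \<subseteq> fst L" using X im by blast
    ultimately show "f ` X \<in> {S. S \<subseteq> fst L \<and> fst L - S \<notin> snd L} \<longleftrightarrow> X \<in> {S. S \<subseteq> fst K \<and> fst K - S \<notin> snd K}"
      using X by simp
  qed auto
qed

lemma alex_dual_nonface_cx:
  "alex_dual (V, nonface_cx V Ns) = (V, {X. X \<subseteq> V \<and> (\<exists>N\<in>Ns. N \<subseteq> V - X)})"
  by (auto simp: alex_dual_def nonface_cx_def)

lemma alex_dual_isoI:
  assumes f: "bij_betw f V V" and eq: "\<forall>X\<in>Pow V. (\<forall>N\<in>Ns. \<not> N \<subseteq> f ` X) \<longleftrightarrow> (\<exists>N\<in>Ns. N \<subseteq> V - X)"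
  shows "cx_iso (alex_dual (V, nonface_cx V Ns)) (V, nonface_cx V Ns)"
  unfolding alex_dual_nonface_cx
proof (rule cx_isoI[OF f])
  fix X assume X: "X \<subseteq> V"
  then have "f ` X \<subseteq> V" using f by (auto simp: bij_betw_def)
  then show "f ` X \<in> nonface_cx V Ns \<longleftrightarrow> X \<in> {X. X \<subseteq> V \<and> (\<exists>N\<in>Ns. N \<subseteq> V - X)}"
    using X eq by (simp add: nonface_cx_def)
qed (auto simp: nonface_cx_def)

text \<open>The dual facets are the complements 24, 23, 13 of the minimal nonfaces. They again form
  a path, which the swap of 2 and 3 carries to the original one.\<close>

lemma alex_dual_P4: "cx_iso (alex_dual P4) P4"
  unfolding P4_eq
proof (rule alex_dual_isoI)
  show "bij_betw (\<lambda>n::nat. if n = 2 then 3 else if n = 3 then 2 else n) {1, 2, 3, 4} {1, 2, 3, 4}"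
    by (auto simp: bij_betw_def inj_on_def)
qed code_simp

text \<open>The complements of the minimal nonfaces are 245, 135, 34, 12; swapping 3 and 4 gives
  back the facets of \<open>J2\<close>.\<close>

lemma alex_dual_J2: "cx_iso (alex_dual J2) J2"
  unfolding J2_eq
proof (rule alex_dual_isoI)
  show "bij_betw (\<lambda>n::nat. if n = 3 then 4 else if n = 4 then 3 else n) {1, 2, 3, 4, 5} {1, 2, 3, 4, 5}"
    by (auto simp: bij_betw_def inj_on_def)
qed code_simp

lemma alex_dual_J1: "alex_dual J1 = J1_dual"
proof -
  have eq: "(V, {X. X \<subseteq> V \<and> (\<exists>N\<in>Ns. N \<subseteq> V - X)}) = (V, nonface_cx V Ms)"
    if "\<forall>X\<in>Pow V. (\<exists>N\<in>Ns. N \<subseteq> V - X) \<longleftrightarrow> (\<forall>N\<in>Ms. \<not> N \<subseteq> X)" for V :: "nat set" and Ns Ms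
    using that by (auto simp: nonface_cx_def)
  show ?thesis unfolding J1_eq J1_dual_eq alex_dual_nonface_cx by (rule eq) code_simp
qed

lemma alex_dual_alex_dual: "snd K \<subseteq> Pow (fst K) \<Longrightarrow> alex_dual (alex_dual K) = K"
  by (cases K) (auto simp: alex_dual_def double_diff)

text \<open>No relabelling occurs: the complements of the listed nonfaces are \<open>{Suc n}\<close>
  and the sets \<open>{0..n} - {i}\<close>, which generate the complex itself.\<close>

lemma alex_dual_bdry: "alex_dual (bdry_plus_pt n) = bdry_plus_pt n"
proof -
  have V: "{0..Suc n} = insert (Suc n) {0..n}" by auto
  have "Suc n \<notin> {0..n}" "{0..n} \<noteq> {}" by auto
  then have eq: "(X \<subseteq> {0..Suc n} \<and> (\<exists>N\<in>bdry_nonfaces n. N \<subseteq> {0..Suc n} - X)) \<longleftrightarrow> X \<in> {G. G \<subset> {0..n}} \<union> {{}, {Suc n}}" for X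
    unfolding bdry_nonfaces_def V by auto
  have "alex_dual (bdry_plus_pt n) = ({0..Suc n}, {X. X \<subseteq> {0..Suc n} \<and> (\<exists>N\<in>bdry_nonfaces n. N \<subseteq> {0..Suc n} - X)})"
    by (simp only: bdry_eq alex_dual_nonface_cx)
  then show ?thesis by (simp only: eq Collect_mem_eq bdry_plus_pt_def)
qed

lemma forbidden_alex_dual:
  assumes M: "forbidden M" and sub: "snd M \<subseteq> Pow (fst M)"
  shows "forbidden (alex_dual M)"
proof -
  have d: "cx_iso (alex_dual M) (alex_dual L)" if "cx_iso M L" for L :: "nat cx"
    by (rule cx_iso_alex_dual[OF that sub])
  have O6: "alex_dual (alex_dual O6) = O6"
    by (rule alex_dual_alex_dual) (auto simp: O6_def)
  have J1: "alex_dual J1_dual = J1"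
    unfolding alex_dual_J1[symmetric] by (rule alex_dual_alex_dual) (auto simp: J1_eq nonface_cx_def)
  consider "cx_iso M P4" | "cx_iso M O6" | "cx_iso M (alex_dual O6)" | "cx_iso M J1"
    | "cx_iso M J1_dual" | "cx_iso M J2" | n where "n \<ge> 1" "cx_iso M (bdry_plus_pt n)"
    using M unfolding forbidden_def by blast
  then show ?thesis
  proof cases
    case 1
    then show ?thesis using cx_iso_trans[OF d alex_dual_P4] by (simp add: forbidden_def)
  next
    case 2
    then show ?thesis using d by (simp add: forbidden_def)
  next
    case 3
    then show ?thesis using d[OF 3] O6 by (simp add: forbidden_def)
  next
    case 4
    then show ?thesis using d[OF 4] alex_dual_J1 by (simp add: forbidden_def)
  next
    case 5
    then show ?thesis using d[OF 5] J1 by (simp add: forbidden_def)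
  next
    case 6
    then show ?thesis using cx_iso_trans[OF d alex_dual_J2] by (simp add: forbidden_def)
  next
    case 7
    then show ?thesis using d[OF 7(2)] alex_dual_bdry[of n] by (auto simp: forbidden_def)
  qed
qed

definition dual_faces :: "'a set \<Rightarrow> 'a set set \<Rightarrow> 'a set set" where
  "dual_faces V C = {S. S \<subseteq> V \<and> V - S \<notin> C}"

lemma cx_dual_faces:
  assumes "simplicial_complex V C"
  shows "simplicial_complex V (dual_faces V C)"
proof (rule simplicial_complexI)
  fix F G assume "F \<in> dual_faces V C" "G \<subseteq> F"
  then show "G \<in> dual_faces V C"
    using simplicial_complexD(3)[OF assms, of "V - G" "V - F"] by (auto simp: dual_faces_def)
qed (use simplicial_complexD(1)[OF assms] in \<open>auto simp: dual_faces_def\<close>)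

text \<open>A minor of the dual may correspond to contracting a nonface of \<open>C\<close>, which
  is not a minor of \<open>C\<close>. Such a contraction is void, so this lemma rules it out in
  \<open>avoiding_dual\<close>.\<close>

lemma forbidden_nonvoid:
  assumes "forbidden (W, D)" shows "D \<noteq> {}"
proof
  assume "D = {}"
  then have no: "\<not> cx_iso (W, D) (W', D')" if "{} \<in> D'" for W' and D' :: "nat set set"
    using that by (auto simp: cx_iso_def)
  have "\<not> cx_iso (W, D) P4" unfolding P4_eq by (rule no) (simp add: nonface_cx_def)
  moreover have "\<not> cx_iso (W, D) (alex_dual O6)" unfolding O6_dual_eq by (rule no) (simp add: nonface_cx_def)
  moreover have "\<not> cx_iso (W, D) O6" unfolding O6_eq by (rule no) (simp add: nonface_cx_def)
  moreover have "\<not> cx_iso (W, D) J1" unfolding J1_eq by (rule no) (simp add: nonface_cx_def)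
  moreover have "\<not> cx_iso (W, D) J1_dual" unfolding J1_dual_eq by (rule no) (simp add: nonface_cx_def)
  moreover have "\<not> cx_iso (W, D) J2" unfolding J2_eq by (rule no) (simp add: nonface_cx_def)
  moreover have "\<not> cx_iso (W, D) (bdry_plus_pt n)" for n
    unfolding bdry_plus_pt_def by (rule no) simp
  ultimately show False using assms unfolding forbidden_def by blast
qed

text \<open>Duality exchanges the contracted set \<open>R\<close> with the deleted set
  \<open>S\<close>, and the excluded list is closed under duality.\<close>

lemma avoiding_dual:
  assumes sc: "simplicial_complex V C" and av: "beta_avoiding V C"
  shows "beta_avoiding V (dual_faces V C)"
  unfolding beta_avoiding_iff is_minor_iff[OF cx_dual_faces[OF sc]]
proof (intro allI impI notI)
  fix M :: "'a cx"
  assume forb: "forbidden M" and "\<exists>W R. W \<inter> R = {} \<and> W \<union> R \<subseteq> V \<and> R \<in> dual_faces V C \<and>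
    M = (W, minor_faces (dual_faces V C) W R)"
  then obtain W R where WR: "W \<inter> R = {}" "W \<union> R \<subseteq> V" "M = (W, minor_faces (dual_faces V C) W R)" by blast
  define S where "S = V - W - R"
  have "W - F \<in> minor_faces (dual_faces V C) W R \<longleftrightarrow> F \<union> S \<notin> C" if "F \<subseteq> W" for F
  proof -
    have "V - (W - F \<union> R) = F \<union> S" using WR that by (auto simp: S_def)
    then show ?thesis using WR that by (auto simp: minor_faces_def dual_faces_def)
  qed
  then have dual: "alex_dual M = (W, minor_faces C W S)"
    unfolding WR(3) alex_dual_def by (auto simp: minor_faces_def)
  have forb': "forbidden (W, minor_faces C W S)"
    unfolding dual[symmetric] by (rule forbidden_alex_dual[OF forb]) (auto simp: WR(3) minor_faces_def)
  then obtain F where "F \<in> minor_faces C W S" using forbidden_nonvoid by blast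
  then have "S \<in> C" using simplicial_complexD(3)[OF sc, of "F \<union> S" S] by (auto simp: minor_faces_def)
  then show False using avoiding_not_forbidden[OF sc av, of W S] forb' WR(2) by (auto simp: S_def)
qed

text \<open>By \<open>cover\<close>, every subset lies in a listed face or contains a listed
  nonface, so checking the listed sets determines the induced subcomplex.\<close>

lemma induced_iso_nonface_cx:
  assumes sc: "simplicial_complex V C" and f: "inj_on f W" and Fs: "\<forall>F\<in>Fs. f ` F \<in> C" and Ns: "\<forall>N\<in>Ns. f ` N \<notin> C"
    and cover: "\<forall>X\<in>Pow W. (\<exists>F\<in>Fs. X \<subseteq> F) \<or> (\<exists>N\<in>Ns. N \<subseteq> X)"
  shows "cx_iso (f ` W, minor_faces C (f ` W) {}) (W, nonface_cx W Ns)"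
proof (rule cx_iso_sym)
  show "cx_iso (W, nonface_cx W Ns) (f ` W, minor_faces C (f ` W) {})"
  proof (rule cx_isoI)
    show "bij_betw f W (f ` W)" using f by (simp add: bij_betw_def)
    fix X assume X: "X \<subseteq> W"
    have face: "f ` X \<in> C" if "X \<subseteq> F" "F \<in> Fs" for F
      using simplicial_complexD(3)[OF sc, of "f ` F" "f ` X"] Fs that by (auto simp: image_mono)
    have nonface: "f ` X \<notin> C" if "N \<subseteq> X" "N \<in> Ns" for N
      using simplicial_complexD(3)[OF sc, of "f ` X" "f ` N"] Ns that by (auto simp: image_mono)
    have "(\<exists>F\<in>Fs. X \<subseteq> F) \<or> (\<exists>N\<in>Ns. N \<subseteq> X)" using cover X by simp
    then have "f ` X \<in> C \<longleftrightarrow> (\<forall>N\<in>Ns. \<not> N \<subseteq> X)"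
    proof
      assume "\<exists>F\<in>Fs. X \<subseteq> F"
      then have "f ` X \<in> C" using face by blast
      then show ?thesis using nonface by metis
    next
      assume "\<exists>N\<in>Ns. N \<subseteq> X"
      then show ?thesis using nonface by metis
    qed
    then show "f ` X \<in> minor_faces C (f ` W) {} \<longleftrightarrow> X \<in> nonface_cx W Ns"
      using X by (auto simp: minor_faces_def nonface_cx_def)
  qed (auto simp: minor_faces_def nonface_cx_def)
qed (auto simp: nonface_cx_def)

section \<open>Excluded complexes as forbidden vertex configurations\<close>

context
  fixes V :: "'a set" and C :: "'a set set"
  assumes sc: "simplicial_complex V C" and av: "beta_avoiding V C"
begin

lemma no_induced_forbidden:
  assumes "W \<subseteq> V" "{} \<in> C" shows "\<not> forbidden (W, minor_faces C W {})"
  by (rule avoiding_not_forbidden[OF sc av]) (use assms in auto)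

lemma induced_forbidden:
  assumes cover: "\<forall>X\<in>Pow W. (\<exists>F\<in>Fs. X \<subseteq> F) \<or> (\<exists>N\<in>Ns. N \<subseteq> X)"
    and f: "inj_on f W" "f ` W \<subseteq> V" "\<forall>F\<in>Fs. f ` F \<in> C" "\<forall>N\<in>Ns. f ` N \<notin> C" "{} \<in> C"
    and forb: "\<And>M :: 'a cx. cx_iso M (W, nonface_cx W Ns) \<Longrightarrow> forbidden M"
  shows False
  using no_induced_forbidden[OF f(2,5)] forb[OF induced_iso_nonface_cx[OF sc f(1,3,4) cover]] by simp

lemma P4_free:
  assumes dist: "distinct [a, b, c, d]" and F: "{a, b} \<in> C" "{b, c} \<in> C" "{c, d} \<in> C"
    and N: "{a, c} \<notin> C" "{a, d} \<notin> C" "{b, d} \<notin> C"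
  shows False
proof (rule induced_forbidden)
  show "\<forall>X\<in>Pow {1, 2, 3, 4::nat}. (\<exists>F\<in>{{1, 2}, {2, 3}, {3, 4}}. X \<subseteq> F) \<or> (\<exists>N\<in>{{1, 3}, {1, 4}, {2, 4}}. N \<subseteq> X)"
    by code_simp
  \<comment> \<open>The vertex 1 is mapped to the default value \<open>a\<close>.\<close>
  let ?f = "(\<lambda>_::nat. a)(2 := b, 3 := c, 4 := d)"
  show "inj_on ?f {1, 2, 3, 4}" using dist by (auto simp: inj_on_def)
  show "?f ` {1, 2, 3, 4} \<subseteq> V" using F simplicial_complexD(2)[OF sc] by auto
  show "{} \<in> C" using simplicial_complexD(3)[OF sc F(1)] by blast
qed (use dist F N in \<open>auto simp: forbidden_def P4_eq\<close>)

lemma J1_free: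
  assumes dist: "distinct [a, b, c, d, e]" and F: "{a, b} \<in> C" "{a, e} \<in> C" "{b, c, d} \<in> C" "{c, d, e} \<in> C"
    and N: "{a, c} \<notin> C" "{a, d} \<notin> C" "{b, e} \<notin> C"
  shows False
proof (rule induced_forbidden)
  show "\<forall>X\<in>Pow {1, 2, 3, 4, 5::nat}. (\<exists>F\<in>{{1, 2}, {1, 5}, {2, 3, 4}, {3, 4, 5}}. X \<subseteq> F) \<or>
    (\<exists>N\<in>{{1, 3}, {1, 4}, {2, 5}}. N \<subseteq> X)"
    by code_simp
  let ?f = "(\<lambda>_::nat. a)(2 := b, 3 := c, 4 := d, 5 := e)"
  show "inj_on ?f {1, 2, 3, 4, 5}" using dist by (auto simp: inj_on_def)
  show "?f ` {1, 2, 3, 4, 5} \<subseteq> V" using F simplicial_complexD(2)[OF sc] by auto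
  show "{} \<in> C" using simplicial_complexD(3)[OF sc F(1)] by blast
qed (use dist F N in \<open>auto simp: forbidden_def J1_eq\<close>)

lemma J1_dual_free:
  assumes dist: "distinct [a, b, c, d, e]" and F: "{a, c, d} \<in> C" "{b, c, e} \<in> C" "{b, d, e} \<in> C"
    and N: "{a, b} \<notin> C" "{a, e} \<notin> C" "{b, c, d} \<notin> C" "{c, d, e} \<notin> C"
  shows False
proof (rule induced_forbidden)
  show "\<forall>X\<in>Pow {1, 2, 3, 4, 5::nat}. (\<exists>F\<in>{{1, 3, 4}, {2, 3, 5}, {2, 4, 5}}. X \<subseteq> F) \<or>
    (\<exists>N\<in>{{1, 2}, {1, 5}, {2, 3, 4}, {3, 4, 5}}. N \<subseteq> X)"
    by code_simp
  let ?f = "(\<lambda>_::nat. a)(2 := b, 3 := c, 4 := d, 5 := e)"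
  show "inj_on ?f {1, 2, 3, 4, 5}" using dist by (auto simp: inj_on_def)
  show "?f ` {1, 2, 3, 4, 5} \<subseteq> V" using F simplicial_complexD(2)[OF sc] by auto
  show "{} \<in> C" using simplicial_complexD(3)[OF sc F(1)] by blast
qed (use dist F N in \<open>auto simp: forbidden_def J1_dual_eq\<close>)

lemma J2_free:
  assumes dist: "distinct [a, b, c, d, e]" and F: "{a, b} \<in> C" "{b, c, e} \<in> C" "{c, d} \<in> C" "{a, d, e} \<in> C"
    and N: "{a, c} \<notin> C" "{b, d} \<notin> C" "{a, b, e} \<notin> C" "{c, d, e} \<notin> C"
  shows False
proof (rule induced_forbidden)
  show "\<forall>X\<in>Pow {1, 2, 3, 4, 5::nat}. (\<exists>F\<in>{{1, 2}, {2, 3, 5}, {3, 4}, {1, 4, 5}}. X \<subseteq> F) \<or>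
    (\<exists>N\<in>{{1, 3}, {2, 4}, {1, 2, 5}, {3, 4, 5}}. N \<subseteq> X)"
    by code_simp
  let ?f = "(\<lambda>_::nat. a)(2 := b, 3 := c, 4 := d, 5 := e)"
  show "inj_on ?f {1, 2, 3, 4, 5}" using dist by (auto simp: inj_on_def)
  show "?f ` {1, 2, 3, 4, 5} \<subseteq> V" using F simplicial_complexD(2)[OF sc] by auto
  show "{} \<in> C" using simplicial_complexD(3)[OF sc F(1)] by blast
qed (use dist F N in \<open>auto simp: forbidden_def J2_eq\<close>)

lemma O6_free:
  assumes dist: "distinct [a, a', b, b', c, c']"
    and F: "\<And>x y z. x \<in> {a, a'} \<Longrightarrow> y \<in> {b, b'} \<Longrightarrow> z \<in> {c, c'} \<Longrightarrow> {x, y, z} \<in> C"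
    and N: "{a, a'} \<notin> C" "{b, b'} \<notin> C" "{c, c'} \<notin> C"
  shows False
proof (rule induced_forbidden)
  show "\<forall>X\<in>Pow {1, 2, 3, 4, 5, 6::nat}.
    (\<exists>F\<in>{{1, 3, 5}, {1, 3, 6}, {1, 4, 5}, {1, 4, 6}, {2, 3, 5}, {2, 3, 6}, {2, 4, 5}, {2, 4, 6}}. X \<subseteq> F) \<or>
    (\<exists>N\<in>{{1, 2}, {3, 4}, {5, 6}}. N \<subseteq> X)"
    by code_simp
  let ?f = "(\<lambda>_::nat. a)(2 := a', 3 := b, 4 := b', 5 := c, 6 := c')"
  show "inj_on ?f {1, 2, 3, 4, 5, 6}" using dist by (auto simp: inj_on_def)
  show "?f ` {1, 2, 3, 4, 5, 6} \<subseteq> V"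
    using simplicial_complexD(2)[OF sc F[of a b c]] simplicial_complexD(2)[OF sc F[of a' b' c']] by auto
  show "{} \<in> C" using simplicial_complexD(3)[OF sc F[of a b c]] by blast
qed (use dist F N in \<open>auto simp: forbidden_def O6_eq\<close>)

text \<open>A minimal nonface \<open>N\<close> inside \<open>A\<close> has at least two points, and
  together with \<open>b\<close> it would induce the boundary of a simplex plus a point. Adjacency
  inside \<open>A\<close> is a conclusion: it is the case of a two-point \<open>N\<close>.\<close>

lemma disjoint_clique_face:
  assumes A: "\<And>x. x \<in> A \<Longrightarrow> {x} \<in> C" and b: "{b} \<in> C" "b \<notin> A" and ne: "\<And>x. x \<in> A \<Longrightarrow> {x, b} \<notin> C"
  shows "A \<in> C"
proof (rule ccontr)
  assume "A \<notin> C"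
  have AV: "A \<subseteq> V" and bV: "b \<in> V" using A b simplicial_complexD(2)[OF sc] by blast+
  then have "finite A" using simplicial_complexD(1)[OF sc] finite_subset by blast
  then have fin: "finite {N. N \<subseteq> A \<and> N \<notin> C}" by simp
  have "A \<in> {N. N \<subseteq> A \<and> N \<notin> C}" using \<open>A \<notin> C\<close> by simp
  from finite_has_minimal2[OF fin this]
  obtain N where N: "N \<subseteq> A" "N \<notin> C" and min': "\<forall>M\<in>{N. N \<subseteq> A \<and> N \<notin> C}. M \<subseteq> N \<longrightarrow> N = M"
    by blast
  have min: "M \<in> C" if "M \<subset> N" for M using that N(1) min' by blast
  have fN: "finite N" using N \<open>finite A\<close> finite_subset by blast
  have e: "{} \<in> C" using simplicial_complexD(3)[OF sc b(1)] by blast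
  have "card N \<noteq> 0" using N e fN by auto
  moreover have "card N \<noteq> 1"
  proof
    assume "card N = 1"
    then obtain x where "N = {x}" by (auto simp: card_1_singleton_iff)
    then show False using N A by auto
  qed
  ultimately have card2: "card N \<ge> 2" by linarith
  define n where "n = card N - 1"
  have n: "card N = Suc n" "n \<ge> 1" using card2 by (auto simp: n_def)
  obtain h where h: "bij_betw h {0..<card N} N" using ex_bij_betw_nat_finite[OF fN] by blast
  have h': "bij_betw h {0..n} N" using h n(1) by (simp add: atLeastLessThanSuc_atLeastAtMost)
  then have him: "h ` {0..n} = N" and hinj: "inj_on h {0..n}" by (auto simp: bij_betw_def)
  define f where "f = h(Suc n := b)"
  have fh: "f ` X = h ` X" if "X \<subseteq> {0..n}" for X using that by (auto simp: f_def)
  have fS: "f (Suc n) = b" by (simp add: f_def)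
  have bN: "b \<notin> N" using b(2) N by blast
  have V: "{0..Suc n} = insert (Suc n) {0..n}" by auto
  have "cx_iso (f ` {0..Suc n}, minor_faces C (f ` {0..Suc n}) {}) ({0..Suc n}, nonface_cx {0..Suc n} (bdry_nonfaces n))"
  proof (rule induced_iso_nonface_cx[OF sc])
    have "inj_on f {0..n}" using hinj unfolding f_def by (auto simp: inj_on_def)
    moreover have "f (Suc n) \<notin> f ` {0..n}" using bN him fh[of "{0..n}"] fS by auto
    ultimately show "inj_on f {0..Suc n}" unfolding V by auto
    show "\<forall>F\<in>insert {Suc n} {F. F \<subset> {0..n}}. f ` F \<in> C"
    proof
      fix F assume "F \<in> insert {Suc n} {F. F \<subset> {0..n}}"
      then show "f ` F \<in> C"
      proof
        assume "F \<in> {F. F \<subset> {0..n}}"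
        then have "f ` F = h ` F" "h ` F \<subset> h ` {0..n}"
          using fh image_strict_mono[OF hinj, of F] by auto
        then show ?thesis using min him by auto
      qed (use b fS in auto)
    qed
    show "\<forall>M\<in>bdry_nonfaces n. f ` M \<notin> C"
    proof
      fix M assume "M \<in> bdry_nonfaces n"
      then consider "M = {0..n}" | i where "i \<le> n" "M = {i, Suc n}" by (auto simp: bdry_nonfaces_def)
      then show "f ` M \<notin> C"
      proof cases
        case 1
        then show ?thesis using fh[of "{0..n}"] him N by auto
      next
        case 2
        then have "h i \<in> N" "f i = h i" using him by (auto simp: f_def)
        then show ?thesis using 2 ne[of "h i"] N fS by auto
      qed
    qed
    show "\<forall>X\<in>Pow {0..Suc n}. (\<exists>F\<in>insert {Suc n} {F. F \<subset> {0..n}}. X \<subseteq> F) \<or> (\<exists>N\<in>bdry_nonfaces n. N \<subseteq> X)"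
      unfolding V bdry_nonfaces_def by auto
  qed
  then have "forbidden (f ` {0..Suc n}, minor_faces C (f ` {0..Suc n}) {})"
    unfolding forbidden_def bdry_eq using n(2) by blast
  moreover have "f ` {0..Suc n} \<subseteq> V" using fh[of "{0..n}"] him fS N AV bV unfolding V by auto
  ultimately show False using no_induced_forbidden e by blast
qed

end

section \<open>Avoiding complexes without ghost and Lawrence vertices\<close>

text \<open>The two exceptional shapes, up to cone vertices: all vertices outside \<open>P \<union> Q\<close> are apexes.\<close>

definition two_simplex_type :: "'a set \<Rightarrow> 'a set set \<Rightarrow> 'a set \<Rightarrow> 'a set \<Rightarrow> bool" where
  "two_simplex_type V C P Q \<longleftrightarrow> P \<subseteq> V \<and> Q \<subseteq> V \<and> P \<inter> Q = {} \<and> card P \<ge> 2 \<and> card Q \<ge> 2 \<and>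
     C = {F. F \<subseteq> V \<and> (F \<inter> P = {} \<or> F \<inter> Q = {})}"

definition dual_simplex_type :: "'a set \<Rightarrow> 'a set set \<Rightarrow> 'a set \<Rightarrow> 'a set \<Rightarrow> bool" where
  "dual_simplex_type V C P Q \<longleftrightarrow> P \<subseteq> V \<and> Q \<subseteq> V \<and> P \<inter> Q = {} \<and> card P \<ge> 2 \<and> card Q \<ge> 2 \<and>
     C = {F. F \<subseteq> V \<and> \<not> P \<subseteq> F \<and> \<not> Q \<subseteq> F}"

definition exceptional :: "'a set \<Rightarrow> 'a set set \<Rightarrow> bool" where
  "exceptional V C \<longleftrightarrow> (\<exists>P Q. two_simplex_type V C P Q \<or> dual_simplex_type V C P Q)"

text \<open>Duality exchanges the two vertex conditions. They also explain the size bounds in the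
  exceptional shapes: a one-point part \<open>{p}\<close> would make \<open>V - {p}\<close> a face
  in the first shape and \<open>p\<close> a ghost in the second.\<close>

definition reduced :: "'a set \<Rightarrow> 'a set set \<Rightarrow> bool" where
  "reduced V C \<longleftrightarrow> V \<noteq> {} \<and> (\<forall>v\<in>V. {v} \<in> C \<and> V - {v} \<notin> C)"

lemma two_simplex_type_sym: "two_simplex_type V C P Q \<Longrightarrow> two_simplex_type V C Q P"
  unfolding two_simplex_type_def by (simp add: Int_commute disj_commute)

lemma dual_simplex_type_sym: "dual_simplex_type V C P Q \<Longrightarrow> dual_simplex_type V C Q P"
  unfolding dual_simplex_type_def by (simp add: Int_commute conj_commute)

lemma two_simplex_type_mem:
  "two_simplex_type V C P Q \<Longrightarrow> F \<in> C \<longleftrightarrow> F \<subseteq> V \<and> (F \<inter> P = {} \<or> F \<inter> Q = {})"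
  by (simp add: two_simplex_type_def)

lemma dual_simplex_type_mem:
  "dual_simplex_type V C P Q \<Longrightarrow> F \<in> C \<longleftrightarrow> F \<subseteq> V \<and> \<not> P \<subseteq> F \<and> \<not> Q \<subseteq> F"
  by (simp add: dual_simplex_type_def)

lemma two_simplex_typeD:
  assumes "two_simplex_type V C P Q"
  shows "P \<subseteq> V" "Q \<subseteq> V" "P \<inter> Q = {}" "card P \<ge> 2" "card Q \<ge> 2"
  using assms by (simp_all add: two_simplex_type_def)

lemma dual_simplex_typeD:
  assumes "dual_simplex_type V C P Q"
  shows "P \<subseteq> V" "Q \<subseteq> V" "P \<inter> Q = {}" "card P \<ge> 2" "card Q \<ge> 2"
  using assms by (simp_all add: dual_simplex_type_def)

lemma two_simplex_typeI:
  assumes "P \<subseteq> V" "Q \<subseteq> V" "P \<inter> Q = {}" "card P \<ge> 2" "card Q \<ge> 2"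
    and "\<And>F. F \<in> C \<longleftrightarrow> F \<subseteq> V \<and> (F \<inter> P = {} \<or> F \<inter> Q = {})"
  shows "two_simplex_type V C P Q"
  using assms(1-5) unfolding two_simplex_type_def by (intro conjI set_eqI) (simp_all add: assms(6))

lemma dual_simplex_typeI:
  assumes "P \<subseteq> V" "Q \<subseteq> V" "P \<inter> Q = {}" "card P \<ge> 2" "card Q \<ge> 2"
    and "\<And>F. F \<in> C \<longleftrightarrow> F \<subseteq> V \<and> \<not> P \<subseteq> F \<and> \<not> Q \<subseteq> F"
  shows "dual_simplex_type V C P Q"
  using assms(1-5) unfolding dual_simplex_type_def by (intro conjI set_eqI) (simp_all add: assms(6))

text \<open>Complementation turns missing \<open>P\<close> into containing \<open>P\<close>, so the
  two shapes are exchanged with the same \<open>P\<close> and \<open>Q\<close>.\<close>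

lemma exceptional_dual:
  assumes "C \<subseteq> Pow V" "exceptional V (dual_faces V C)"
  shows "exceptional V C"
proof -
  have mem: "F \<in> C \<longleftrightarrow> F \<subseteq> V \<and> V - F \<notin> dual_faces V C" for F
    using assms(1) by (auto simp: dual_faces_def double_diff)
  obtain P Q where "two_simplex_type V (dual_faces V C) P Q \<or> dual_simplex_type V (dual_faces V C) P Q"
    using assms(2) by (auto simp: exceptional_def)
  then show ?thesis
  proof
    assume t: "two_simplex_type V (dual_faces V C) P Q"
    note D = two_simplex_typeD[OF t]
    have "F \<in> C \<longleftrightarrow> F \<subseteq> V \<and> \<not> P \<subseteq> F \<and> \<not> Q \<subseteq> F" for F
      unfolding mem two_simplex_type_mem[OF t] using D(1,2) by blast
    with D have "dual_simplex_type V C P Q" by (rule dual_simplex_typeI)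
    then show ?thesis by (auto simp: exceptional_def)
  next
    assume t: "dual_simplex_type V (dual_faces V C) P Q"
    note D = dual_simplex_typeD[OF t]
    have "F \<in> C \<longleftrightarrow> F \<subseteq> V \<and> (F \<inter> P = {} \<or> F \<inter> Q = {})" for F
      unfolding mem dual_simplex_type_mem[OF t] using D(1,2) by blast
    with D have "two_simplex_type V C P Q" by (rule two_simplex_typeI)
    then show ?thesis by (auto simp: exceptional_def)
  qed
qed

lemma card_ge_2I:
  assumes "finite S" "x \<in> S" "S \<noteq> {x}" shows "card S \<ge> 2"
proof -
  obtain y where "y \<in> S" "y \<noteq> x" using assms by blast
  then show ?thesis using card_mono[OF assms(1), of "{x, y}"] assms(2) by simp
qed

lemma card_ge_2E:
  assumes "card S \<ge> 2" obtains x where "x \<in> S" "x \<noteq> y"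
proof -
  have "\<not> S \<subseteq> {y}" using assms card_mono[of "{y}" S] by auto
  then show ?thesis using that by blast
qed

lemma subset_pair_card_2: "P \<subseteq> {a, b} \<Longrightarrow> card P \<ge> 2 \<Longrightarrow> P = {a, b}"
proof -
  assume P: "P \<subseteq> {a, b}" "card P \<ge> 2"
  have "card {a, b} \<le> 2" by (simp add: card_insert_if)
  then show "P = {a, b}" using P card_seteq[of "{a, b}" P] by auto
qed

abbreviation vertex_link :: "'a set \<Rightarrow> 'a set set \<Rightarrow> 'a \<Rightarrow> 'a set set" where
  "vertex_link V C v \<equiv> minor_faces C (V - {v}) {v}"

lemma link_mem: "F \<in> vertex_link V C v \<longleftrightarrow> F \<subseteq> V - {v} \<and> insert v F \<in> C"
  by (simp add: minor_faces_def)

text \<open>\<open>disjoint_clique_face\<close> in the link of \<open>R\<close>, with the faces of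
  the link written as faces of \<open>C\<close>.\<close>

lemma disjoint_clique_link:
  assumes sc: "simplicial_complex V C" and av: "beta_avoiding V C"
    and A: "\<And>x. x \<in> A \<Longrightarrow> insert x R \<in> C" and b: "insert b R \<in> C" "b \<notin> A"
    and disj: "A \<inter> R = {}" "b \<notin> R" and ne: "\<And>x. x \<in> A \<Longrightarrow> insert x (insert b R) \<notin> C"
  shows "A \<union> R \<in> C"
proof -
  have bR: "insert b R \<subseteq> V" using b simplicial_complexD(2)[OF sc] by blast
  have AV: "A \<subseteq> V" using A simplicial_complexD(2)[OF sc] by blast
  have RC: "R \<in> C" using simplicial_complexD(3)[OF sc b(1)] by blast
  have W: "(V - R) \<inter> R = {}" "V - R \<union> R \<subseteq> V" "V - R \<subseteq> V" using bR by auto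
  have "A \<in> minor_faces C (V - R) R"
    by (rule disjoint_clique_face[OF cx_minor_faces[OF sc W(3)] avoiding_minor[OF sc av W(1,2) RC], of _ b])
       (use A b disj ne AV bR in \<open>auto simp: minor_faces_def\<close>)
  then show ?thesis by (simp add: minor_faces_def)
qed

lemma P4_free_link:
  assumes sc: "simplicial_complex V C" and av: "beta_avoiding V C"
    and dist: "distinct [a, b, c, d]" and disj: "{a, b, c, d} \<inter> R = {}"
    and F: "{a, b} \<union> R \<in> C" "{b, c} \<union> R \<in> C" "{c, d} \<union> R \<in> C"
    and N: "{a, c} \<union> R \<notin> C" "{a, d} \<union> R \<notin> C" "{b, d} \<union> R \<notin> C"
  shows False
proof -
  have RC: "R \<in> C" using simplicial_complexD(3)[OF sc F(1)] by blast
  have sub: "{a, b, c, d} \<subseteq> V - R" "R \<subseteq> V"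
    using simplicial_complexD(2)[OF sc F(1)] simplicial_complexD(2)[OF sc F(3)] disj by auto
  then have W: "(V - R) \<inter> R = {}" "V - R \<union> R \<subseteq> V" "V - R \<subseteq> V" by auto
  show False
    by (rule P4_free[OF cx_minor_faces[OF sc W(3)] avoiding_minor[OF sc av W(1,2) RC] dist])
       (use F N sub in \<open>auto simp: minor_faces_def\<close>)
qed

lemma J1_free_link:
  assumes sc: "simplicial_complex V C" and av: "beta_avoiding V C"
    and dist: "distinct [a, b, c, d, e]" and disj: "{a, b, c, d, e} \<inter> R = {}"
    and F: "{a, b} \<union> R \<in> C" "{a, e} \<union> R \<in> C" "{b, c, d} \<union> R \<in> C" "{c, d, e} \<union> R \<in> C"
    and N: "{a, c} \<union> R \<notin> C" "{a, d} \<union> R \<notin> C" "{b, e} \<union> R \<notin> C"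
  shows False
proof -
  have RC: "R \<in> C" using simplicial_complexD(3)[OF sc F(1)] by blast
  have sub: "{a, b, c, d, e} \<subseteq> V - R" "R \<subseteq> V"
    using simplicial_complexD(2)[OF sc F(1)] simplicial_complexD(2)[OF sc F(4)] disj by auto
  then have W: "(V - R) \<inter> R = {}" "V - R \<union> R \<subseteq> V" "V - R \<subseteq> V" by auto
  show False
    by (rule J1_free[OF cx_minor_faces[OF sc W(3)] avoiding_minor[OF sc av W(1,2) RC] dist])
       (use F N sub in \<open>auto simp: minor_faces_def\<close>)
qed

text \<open>The induction hypothesis is a locale assumption, so that all lemmas below can be used
  for a complex and, on the same ground set, for its Alexander dual.\<close>

locale reduced_avoiding =
  fixes V :: "'a set" and C :: "'a set set"
  assumes sc: "simplicial_complex V C" and av: "beta_avoiding V C" and red: "reduced V C"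
    and IH: "\<And>(W :: 'a set) D. card W < card V \<Longrightarrow> simplicial_complex W D \<Longrightarrow> beta_avoiding W D \<Longrightarrow>
      reduced W D \<Longrightarrow> exceptional W D"
begin

lemmas finV = simplicial_complexD(1)[OF sc]
lemmas face_sub = simplicial_complexD(2)[OF sc]
lemmas face_down = simplicial_complexD(3)[OF sc]

lemma vertex: "v \<in> V \<Longrightarrow> {v} \<in> C" and co_vertex: "v \<in> V \<Longrightarrow> V - {v} \<notin> C"
  using red by (auto simp: reduced_def)

text \<open>Adjacency of \<open>v\<close> to every vertex excludes ghosts in the link. A vertex
  \<open>w\<close> whose deletion from the link is a simplex would make \<open>V - {w}\<close> a
  face of \<open>C\<close>.\<close>

lemma link_exceptional:
  assumes v: "v \<in> V" and adj: "\<And>w. w \<in> V \<Longrightarrow> {v, w} \<in> C"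
  shows "exceptional (V - {v}) (vertex_link V C v)"
proof (rule IH)
  show "card (V - {v}) < card V" using v finV by (rule card_Diff1_less[rotated])
  show "simplicial_complex (V - {v}) (vertex_link V C v)" by (rule cx_minor_faces[OF sc]) blast
  show "beta_avoiding (V - {v}) (vertex_link V C v)"
    by (rule avoiding_minor[OF sc av]) (use v vertex in auto)
  have "{} \<in> C" using vertex[OF v] face_down by blast
  then have "V - {v} \<noteq> {}" using co_vertex[OF v] by metis
  moreover have "insert v (V - {v} - {w}) = V - {w}" if "w \<in> V - {v}" for w using v that by auto
  ultimately show "reduced (V - {v}) (vertex_link V C v)"
    unfolding reduced_def link_mem using adj co_vertex by auto
qed

section \<open>The graph of non-edges\<close>

definition nonnb :: "'a \<Rightarrow> 'a set" where
  "nonnb b = {x \<in> V. x \<noteq> b \<and> {x, b} \<notin> C}"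

lemma nonnbD: "x \<in> nonnb b \<Longrightarrow> x \<in> V" "x \<in> nonnb b \<Longrightarrow> x \<noteq> b" "x \<in> nonnb b \<Longrightarrow> {x, b} \<notin> C"
  by (auto simp: nonnb_def)

lemma nonnb_sym: "b \<in> V \<Longrightarrow> x \<in> nonnb b \<Longrightarrow> b \<in> nonnb x"
  by (auto simp: nonnb_def insert_commute)

text \<open>All non-neighbours of \<open>b\<close> are separated from \<open>b\<close>, so
  \<open>disjoint_clique_face\<close> applies. In particular the graph of non-edges contains no
  triangle.\<close>

lemma nonnb_face: "b \<in> V \<Longrightarrow> nonnb b \<in> C"
  by (rule disjoint_clique_face[OF sc av, of _ b]) (auto simp: nonnb_def vertex)

lemma nonnb_adj: "b \<in> V \<Longrightarrow> x \<in> nonnb b \<Longrightarrow> y \<in> nonnb b \<Longrightarrow> {x, y} \<in> C"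
  using face_down[OF nonnb_face, of b "{x, y}"] by simp

lemma nonnb_disj:
  assumes "a \<in> V" "b \<in> V" "a \<in> nonnb b"
  shows "nonnb a \<inter> nonnb b = {}"
proof -
  have False if "z \<in> nonnb a" "z \<in> nonnb b" for z
    using nonnb_adj[OF assms(2) that(2) assms(3)] nonnbD(3)[OF that(1)] by simp
  then show ?thesis by auto
qed

text \<open>An edge between \<open>x\<close> and \<open>y\<close> would complete the induced path
  \<open>a\<close>, \<open>x\<close>, \<open>y\<close>, \<open>b\<close>.\<close>

lemma nonnb_product:
  assumes ab: "a \<in> V" "b \<in> V" "a \<in> nonnb b" and x: "x \<in> nonnb b" and y: "y \<in> nonnb a"
  shows "{x, y} \<notin> C"
proof
  assume xy: "{x, y} \<in> C"
  have ne: "x \<noteq> a" "y \<noteq> b"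
    using nonnbD(3)[OF y] nonnbD(3)[OF x] xy by (auto simp: insert_commute)
  have dist: "distinct [a, x, y, b]"
    using ne nonnbD(2)[OF ab(3)] nonnbD(2)[OF x] nonnbD(2)[OF y] nonnb_disj[OF ab] x y by auto
  have "b \<in> nonnb a" using nonnb_sym[OF ab(2,3)] .
  then have "{y, b} \<in> C" using nonnb_adj[OF ab(1) y] by blast
  moreover have "{a, x} \<in> C" using nonnb_adj[OF ab(2,3) x] .
  ultimately show False
    using P4_free[OF sc av dist] xy nonnbD(3)[OF ab(3)] nonnbD(3)[OF x] nonnbD(3)[OF y]
    by (simp add: insert_commute)
qed

text \<open>A non-edge between \<open>x\<close> and \<open>y\<close> would let
  \<open>nonnb_product\<close>, applied to the non-edge of \<open>y\<close> with \<open>b\<close> or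
  with \<open>a\<close>, put \<open>x\<close> itself among the non-neighbours of \<open>a\<close> or
  \<open>b\<close>.\<close>

lemma nonnb_rest:
  assumes ab: "a \<in> V" "b \<in> V" "a \<in> nonnb b" and x: "x \<in> V" "x \<notin> nonnb a" "x \<notin> nonnb b"
    and y: "y \<in> nonnb a \<union> nonnb b"
  shows "{x, y} \<in> C"
proof (rule ccontr)
  assume xy: "{x, y} \<notin> C"
  then have "x \<noteq> y" using x y by auto
  then have xn: "x \<in> nonnb y" using x xy by (simp add: nonnb_def)
  have ba: "b \<in> nonnb a" using nonnb_sym[OF ab(2,3)] .
  have yV: "y \<in> V" using y nonnbD(1) by blast
  show False
  proof (cases "y \<in> nonnb b")
    case True
    have "x \<noteq> a" using x ab by auto
    then have "{a, x} \<in> C" using x by (auto simp: nonnb_def insert_commute)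
    then show False using nonnb_product[OF yV ab(2) True ab(3) xn] by simp
  next
    case False
    then have y': "y \<in> nonnb a" using y by simp
    have "x \<noteq> b" using x ba by auto
    then have "{b, x} \<in> C" using x by (auto simp: nonnb_def insert_commute)
    then show False using nonnb_product[OF yV ab(1) y' ba xn] by simp
  qed
qed

text \<open>If \<open>{v, a, c}\<close> is missing, then in the link of \<open>v\<close> the points
  \<open>d\<close> and \<open>a\<close> are both separated from \<open>c\<close>, hence adjacent;
  likewise \<open>b\<close> and \<open>c\<close>. According to whether \<open>b\<close> and
  \<open>d\<close> are adjacent there, the link has the induced path \<open>a\<close>,
  \<open>d\<close>, \<open>b\<close>, \<open>c\<close> or the five vertices form
  \<open>J2\<close>.\<close>

lemma join_triangle:
  assumes dist: "distinct [a, b, c, d, v]" and N: "{a, b} \<notin> C" "{c, d} \<notin> C"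
    and v: "{v, a} \<in> C" "{v, b} \<in> C" "{v, c} \<in> C" "{v, d} \<in> C"
    and E: "{a, c} \<in> C" "{a, d} \<in> C" "{b, c} \<in> C" "{b, d} \<in> C"
  shows "{v, a, c} \<in> C"
proof (rule ccontr)
  assume vac: "{v, a, c} \<notin> C"
  have up: "{x, y, v} \<notin> C" if "{x, y} \<notin> C" for x y using that face_down[of "{x, y, v}" "{x, y}"] by blast
  have "{d, a} \<union> {v} \<in> C"
    by (rule disjoint_clique_link[OF sc av, of _ _ c])
       (use dist v vac up[OF N(2)] in \<open>auto simp: insert_commute\<close>)
  then have vad: "{v, a, d} \<in> C" by (simp add: insert_commute)
  have "{b, c} \<union> {v} \<in> C"
    by (rule disjoint_clique_link[OF sc av, of _ _ a])
       (use dist v vac up[OF N(1)] in \<open>auto simp: insert_commute\<close>)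
  then have vbc: "{v, b, c} \<in> C" by (simp add: insert_commute)
  show False
  proof (cases "{v, b, d} \<in> C")
    case True
    show False
      by (rule P4_free_link[OF sc av, of a d b c "{v}"])
         (use dist True vad vbc vac up[OF N(1)] up[OF N(2)] in \<open>auto simp: insert_commute\<close>)
  next
    case False
    show False
      by (rule J2_free[OF sc av, of a c b d v])
         (use dist False vad vbc vac N E in \<open>auto simp: insert_commute\<close>)
  qed
qed

text \<open>A second non-neighbour \<open>a'\<close> of \<open>b\<close> would form a triangle with
  \<open>a\<close> and each of \<open>c\<close>, \<open>d\<close>, so that \<open>b\<close>,
  \<open>c\<close>, \<open>a\<close>, \<open>a'\<close>, \<open>d\<close> induce
  \<open>J1\<close>.\<close>

lemma nonnb_single:
  assumes ab: "a \<in> V" "b \<in> V" "a \<in> nonnb b"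
    and c: "c \<in> V" "c \<notin> nonnb a \<union> nonnb b" and d: "d \<in> V" "d \<notin> nonnb a \<union> nonnb b" and cd: "c \<in> nonnb d"
  shows "nonnb b = {a}"
proof (rule ccontr)
  assume "nonnb b \<noteq> {a}"
  then obtain a' where a': "a' \<in> nonnb b" "a' \<noteq> a" using ab(3) by blast
  have ba: "b \<in> nonnb a" using nonnb_sym[OF ab(2,3)] .
  have rest: "nonnb b \<union> {x} \<in> C" if x: "x \<in> V" "x \<notin> nonnb a \<union> nonnb b" for x
  proof (rule disjoint_clique_link[OF sc av, of _ _ b])
    show "insert y {x} \<in> C" if "y \<in> nonnb b" for y
      using nonnb_rest[OF ab, of x y] x that by (auto simp: insert_commute)
    show "insert b {x} \<in> C" using nonnb_rest[OF ab, of x b] x ba by (auto simp: insert_commute)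
    show "insert y (insert b {x}) \<notin> C" if "y \<in> nonnb b" for y
      using face_down[of "insert y (insert b {x})" "{y, b}"] nonnbD(3)[OF that] by blast
  qed (use x ba in \<open>auto simp: nonnb_def\<close>)
  have adj: "{b, x} \<in> C" if "x \<in> V" "x \<notin> nonnb a \<union> nonnb b" for x
    using nonnb_rest[OF ab, of x b] that ba by (simp add: insert_commute)
  show False
  proof (rule J1_free[OF sc av, of b c a a' d])
    show "distinct [b, c, a, a', d]"
      using a' ab c d ba nonnbD(2)[OF ab(3)] nonnbD(2)[OF a'(1)] nonnbD(2)[OF cd] by auto
    show "{b, c} \<in> C" "{b, d} \<in> C" by (rule adj[OF c], rule adj[OF d])
    show "{c, a, a'} \<in> C" by (rule face_down[OF rest[OF c]]) (use ab a' in auto)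
    show "{a, a', d} \<in> C" by (rule face_down[OF rest[OF d]]) (use ab a' in auto)
    show "{b, a} \<notin> C" "{b, a'} \<notin> C" "{c, d} \<notin> C"
      using nonnbD(3)[OF ab(3)] nonnbD(3)[OF a'(1)] nonnbD(3)[OF cd] by (auto simp: insert_commute)
  qed
qed

end

lemma pair_partner:
  assumes "x \<in> {a, b}" "a \<noteq> b" shows "\<exists>x'. {x, x'} = {a, b} \<and> x' \<noteq> x"
proof (cases "x = a")
  case True
  then show ?thesis using assms by (intro exI[of _ b]) simp
next
  case False
  then have "x = b" using assms by simp
  then show ?thesis using assms by (intro exI[of _ a]) auto
qed

section \<open>A second non-edge, and links of the dual shape\<close>

context reduced_avoiding
begin

text \<open>As \<open>P\<close> and \<open>Q\<close> are nonfaces of \<open>C\<close> itself, every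
  set allowed by the shape stays a face when \<open>v\<close> is added, so \<open>v\<close> is an
  apex.\<close>

lemma link_dual_type:
  assumes v: "v \<in> V" and t: "dual_simplex_type (V - {v}) (vertex_link V C v) P Q"
    and "P \<notin> C" "Q \<notin> C"
  shows "dual_simplex_type V C P Q"
proof -
  note D = dual_simplex_typeD[OF t]
  show ?thesis
  proof (rule dual_simplex_typeI)
    fix F
    show "F \<in> C \<longleftrightarrow> F \<subseteq> V \<and> \<not> P \<subseteq> F \<and> \<not> Q \<subseteq> F"
    proof
      assume "F \<in> C"
      then show "F \<subseteq> V \<and> \<not> P \<subseteq> F \<and> \<not> Q \<subseteq> F" using face_sub face_down assms(3,4) by metis
    next
      assume F: "F \<subseteq> V \<and> \<not> P \<subseteq> F \<and> \<not> Q \<subseteq> F"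
      then have "F - {v} \<in> vertex_link V C v"
        unfolding dual_simplex_type_mem[OF t] by auto
      then have "insert v (F - {v}) \<in> C" by (simp only: link_mem)
      then show "F \<in> C" by (rule face_down) auto
    qed
  qed (use D in auto)
qed

text \<open>By \<open>nonnb_single\<close> both non-edges are whole components of the non-edge
  graph, so \<open>a\<close>, \<open>b\<close>, \<open>c\<close>, \<open>d\<close> span a
  four-cycle. A further vertex is adjacent to everything and has this four-cycle in its link, which
  determines the link.\<close>

lemma two_nonedges:
  assumes ab: "a \<in> V" "b \<in> V" "a \<in> nonnb b"
    and c: "c \<in> V" "c \<notin> nonnb a \<union> nonnb b" and d: "d \<in> V" "d \<notin> nonnb a \<union> nonnb b" and cd: "c \<in> nonnb d"
  shows "exceptional V C"
proof -
  have ba: "b \<in> nonnb a" and dc: "d \<in> nonnb c" using nonnb_sym ab cd d by auto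
  have rest: "{x, y} \<in> C" if "x \<in> {c, d}" "y \<in> {a, b}" for x y
    using nonnb_rest[OF ab, of x y] that c d ab ba by auto
  have out: "a \<notin> nonnb c \<union> nonnb d" "b \<notin> nonnb c \<union> nonnb d"
    using rest[of c a] rest[of d a] rest[of c b] rest[of d b] by (auto simp: nonnb_def insert_commute)
  have nb: "nonnb b = {a}" by (rule nonnb_single[OF ab c d cd])
  have na: "nonnb a = {b}" by (rule nonnb_single[OF ab(2,1) ba _ _ _ _ cd]) (use c d in auto)
  have nd: "nonnb d = {c}" by (rule nonnb_single[OF c(1) d(1) cd ab(1) out(1) ab(2) out(2) ab(3)])
  have nc: "nonnb c = {d}" by (rule nonnb_single[OF d(1) c(1) dc ab(1) _ ab(2) _ ab(3)]) (use out in auto)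
  have dist: "distinct [a, b, c, d]"
    using c(2) d(2) na nb nonnbD(2)[OF ab(3)] nonnbD(2)[OF cd] by auto
  have N: "{a, b} \<notin> C" "{c, d} \<notin> C" using nonnbD(3)[OF ab(3)] nonnbD(3)[OF cd] .
  show ?thesis
  proof (cases "V \<subseteq> {a, b, c, d}")
    case True
    have "dual_simplex_type V C {a, b} {c, d}"
    proof (rule dual_simplex_typeI)
      fix F
      show "F \<in> C \<longleftrightarrow> F \<subseteq> V \<and> \<not> {a, b} \<subseteq> F \<and> \<not> {c, d} \<subseteq> F"
      proof
        assume F: "F \<in> C"
        show "F \<subseteq> V \<and> \<not> {a, b} \<subseteq> F \<and> \<not> {c, d} \<subseteq> F"
          using face_sub[OF F] face_down[OF F, of "{a, b}"] face_down[OF F, of "{c, d}"] N by blast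
      next
        assume F: "F \<subseteq> V \<and> \<not> {a, b} \<subseteq> F \<and> \<not> {c, d} \<subseteq> F"
        then have "F \<subseteq> {a, b, c, d}" using True by (meson subset_trans)
        then consider "F \<subseteq> {c, a}" | "F \<subseteq> {c, b}" | "F \<subseteq> {d, a}" | "F \<subseteq> {d, b}" using F by auto
        then show "F \<in> C" using rest face_down by (cases; blast)
      qed
    qed (use dist ab c d in auto)
    then show ?thesis by (auto simp: exceptional_def)
  next
    case False
    then obtain v where v: "v \<in> V" "v \<notin> {a, b, c, d}" by blast
    have adj: "{x, y} \<in> C" if "x \<in> V" "x \<notin> {a, b, c, d}" "y \<in> {a, b, c, d}" for x y
      using nonnb_rest[OF ab, of x y] nonnb_rest[OF c(1) d(1) cd, of x y] that by (auto simp: na nb nc nd)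
    have tri: "{z, x, y} \<in> C" if "z \<in> V" "z \<notin> {a, b, c, d}" "x \<in> {a, b}" "y \<in> {c, d}" for x y z
    proof -
      have "a \<noteq> b" "c \<noteq> d" using dist by auto
      obtain x' where x': "{x, x'} = {a, b}" "x' \<noteq> x" using pair_partner[OF \<open>x \<in> {a, b}\<close> \<open>a \<noteq> b\<close>] by blast
      obtain y' where y': "{y, y'} = {c, d}" "y' \<noteq> y" using pair_partner[OF \<open>y \<in> {c, d}\<close> \<open>c \<noteq> d\<close>] by blast
      have e: "{x, y} \<in> C" "{x, y'} \<in> C" "{x', y} \<in> C" "{x', y'} \<in> C"
        using rest[of y x] rest[of y' x] rest[of y x'] rest[of y' x'] x'(1) y'(1)
        by (auto simp: insert_commute)
      have mem: "x \<in> {a, b}" "x' \<in> {a, b}" "y \<in> {c, d}" "y' \<in> {c, d}" using x'(1) y'(1) by auto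
      show ?thesis
      proof (rule join_triangle[of x x' y y' z])
        show "distinct [x, x', y, y', z]" using mem x'(2) y'(2) that dist by auto
        show "{x, x'} \<notin> C" "{y, y'} \<notin> C" unfolding x'(1) y'(1) by (rule N)+
        show "{z, x} \<in> C" "{z, x'} \<in> C" "{z, y} \<in> C" "{z, y'} \<in> C" using adj that(1,2) mem by auto
      qed (rule e)+
    qed
    have all: "{v, w} \<in> C" if w: "w \<in> V" for w
    proof (rule ccontr)
      assume vw: "{v, w} \<notin> C"
      have "w \<noteq> v" using vw vertex[OF v(1)] by auto
      moreover have "w \<notin> {a, b, c, d}" using adj[OF v] vw by blast
      \<comment> \<open>A third non-edge \<open>{v, w}\<close> would make these six vertices an
        octahedron.\<close>
      ultimately show False
        using O6_free[OF sc av, of a b c d v w] dist v N vw tri[OF v] tri[OF w]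
        by (force simp: insert_commute)
    qed
    let ?L = "vertex_link V C v"
    have sub: "{a, b, c, d} \<subseteq> V - {v}" using ab c d v by auto
    have nL: "{a, b} \<notin> ?L" "{c, d} \<notin> ?L"
      using N face_down[of "insert v {a, b}" "{a, b}"] face_down[of "insert v {c, d}" "{c, d}"]
      unfolding link_mem by blast+
    have L: "{x, y} \<in> ?L" if "x \<in> {a, b}" "y \<in> {c, d}" for x y
      using tri[OF v that] sub that unfolding link_mem by auto
    from link_exceptional[OF v(1) all] obtain P Q
      where "two_simplex_type (V - {v}) ?L P Q \<or> dual_simplex_type (V - {v}) ?L P Q"
      unfolding exceptional_def by blast
    then show ?thesis
    proof
      assume t: "two_simplex_type (V - {v}) ?L P Q"
      \<comment> \<open>Two simplices cannot contain the four-cycle: \<open>P\<close> and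
        \<open>Q\<close> would separate \<open>a\<close> from \<open>b\<close> and \<open>c\<close>
        from \<open>d\<close>, and hence also some cross pair.\<close>
      note mem = two_simplex_type_mem[OF t]
      have "P \<inter> Q = {}" using two_simplex_typeD[OF t] by blast
      moreover have "{x, y} \<inter> P = {} \<or> {x, y} \<inter> Q = {}" if "x \<in> {a, b}" "y \<in> {c, d}" for x y
        using L[OF that] by (simp only: mem)
      from this[of a c] this[of a d] this[of b c] this[of b d]
      have "{a, c} \<inter> P = {} \<or> {a, c} \<inter> Q = {}" "{a, d} \<inter> P = {} \<or> {a, d} \<inter> Q = {}"
        "{b, c} \<inter> P = {} \<or> {b, c} \<inter> Q = {}" "{b, d} \<inter> P = {} \<or> {b, d} \<inter> Q = {}" by simp_all
      moreover have "\<not> ({a, b} \<inter> P = {} \<or> {a, b} \<inter> Q = {})" "\<not> ({c, d} \<inter> P = {} \<or> {c, d} \<inter> Q = {})"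
        using nL sub by (simp_all add: mem)
      ultimately show ?thesis by auto
    next
      assume t: "dual_simplex_type (V - {v}) ?L P Q"
      note mem = dual_simplex_type_mem[OF t] and D = dual_simplex_typeD[OF t]
      have "P \<subseteq> {a, b} \<or> Q \<subseteq> {a, b}" "P \<subseteq> {c, d} \<or> Q \<subseteq> {c, d}"
        using nL sub by (simp_all add: mem)
      then have "P = {a, b} \<or> Q = {a, b}" "P = {c, d} \<or> Q = {c, d}"
        using subset_pair_card_2[OF _ D(4), of a b] subset_pair_card_2[OF _ D(5), of a b]
          subset_pair_card_2[OF _ D(4), of c d] subset_pair_card_2[OF _ D(5), of c d] by metis+
      then have "P \<notin> C" "Q \<notin> C" using N D(3) dist by auto
      from link_dual_type[OF v(1) t this] show ?thesis by (auto simp: exceptional_def)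
    qed
  qed
qed

text \<open>Being a nonface, \<open>N\<close> is not in the link of \<open>v\<close>, so it contains
  \<open>Q\<close>. If it also contained \<open>a\<close>, removing \<open>a\<close> and some
  \<open>q\<close> of \<open>Q\<close> would leave a face \<open>R\<close> in whose link
  \<open>a\<close>, \<open>v\<close>, \<open>b\<close>, \<open>q\<close> behave badly.\<close>

lemma link_dual_pair_no_nonface:
  assumes v: "v \<in> V" "v \<notin> {a, b}" and ab: "{a, b} \<notin> C" "a \<noteq> b"
    and t: "dual_simplex_type (V - {v}) (vertex_link V C v) {a, b} Q"
    and N: "N \<subseteq> V" "v \<notin> N" "N \<notin> C" "b \<notin> N" and min: "\<And>M. M \<subset> N \<Longrightarrow> M \<in> C"
  shows "a \<notin> N"
proof
  assume aN: "a \<in> N"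
  note mem = dual_simplex_type_mem[OF t] and D = dual_simplex_typeD[OF t]
  have up: "insert v F \<in> C \<longleftrightarrow> \<not> {a, b} \<subseteq> F \<and> \<not> Q \<subseteq> F" if "F \<subseteq> V - {v}" for F
    using mem[of F] that unfolding link_mem by blast
  have NL: "N \<subseteq> V - {v}" using N by blast
  have "Q \<subseteq> N"
  proof (rule ccontr)
    assume "\<not> Q \<subseteq> N"
    then have "insert v N \<in> C" using up[OF NL] N(4) by blast
    then show False using N(3) face_down by blast
  qed
  obtain q where q: "q \<in> Q" using card_ge_2E[OF D(5)] by blast
  then have qne: "q \<noteq> a" "q \<noteq> b" "q \<in> N" "q \<noteq> v" using D(3) \<open>Q \<subseteq> N\<close> N(2) by auto
  define R where "R = N - {a, q}"
  have R: "a \<notin> R" "b \<notin> R" "q \<notin> R" "v \<notin> R" "R \<subseteq> V" "insert a (insert q R) = N"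
    using N aN qne by (auto simp: R_def)
  have abV: "a \<in> V" "b \<in> V" using D(1) by auto
  have av': "insert v (insert a R) \<in> C" using up[of "insert a R"] R abV v ab(2) q qne by auto
  have bv': "insert v (insert b R) \<in> C" using up[of "insert b R"] R abV v ab(2) q qne by auto
  have vq: "insert v (insert q R) \<notin> C"
  proof -
    have "Q \<subseteq> insert q R" using \<open>Q \<subseteq> N\<close> D(3) by (auto simp: R_def)
    then show ?thesis using up[of "insert q R"] R qne NL by auto
  qed
  have abR: "insert a (insert b R) \<notin> C" using ab(1) face_down[of "insert a (insert b R)" "{a, b}"] by blast
  have aq: "insert a (insert q R) \<notin> C" using R(6) N(3) by simp
  have aR: "insert a R \<in> C" and bR: "insert b R \<in> C" using face_down[OF av'] face_down[OF bv'] by blast+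
  have qR: "insert q R \<in> C" by (rule min) (use R(6) R(1) qne in auto)
  show False
  proof (cases "insert b (insert q R) \<in> C")
    case True
    show False
      by (rule P4_free_link[OF sc av, of a v b q R])
         (use ab(2) v qne R av' bv' True abR aq vq in \<open>auto simp: insert_commute\<close>)
  next
    case False
    \<comment> \<open>In the link of \<open>R\<close> both \<open>b\<close> and \<open>q\<close> are
      separated from \<open>a\<close>, so they must be adjacent. In the other case this edge
      completed the induced path \<open>a\<close>, \<open>v\<close>, \<open>b\<close>,
      \<open>q\<close>.\<close>
    have "{b, q} \<union> R \<in> C"
      by (rule disjoint_clique_link[OF sc av, of _ _ a])
         (use ab(2) qne R aR bR qR abR aq in \<open>auto simp: insert_commute\<close>)
    then show False using False by simp
  qed
qed

text \<open>If \<open>Q\<close> is a nonface of \<open>C\<close>, then \<open>v\<close> is an apex.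
  If \<open>Q\<close> is a face, the only surviving possibility is that \<open>v\<close> belongs to
  the second part, which is then \<open>insert v Q\<close>.\<close>

lemma link_dual_pair:
  assumes v: "v \<in> V" "v \<notin> {a, b}" and ab: "{a, b} \<notin> C" "a \<noteq> b"
    and t: "dual_simplex_type (V - {v}) (vertex_link V C v) {a, b} Q"
  shows "exceptional V C"
proof (cases "Q \<in> C")
  case False
  then show ?thesis using link_dual_type[OF v(1) t ab(1)] by (auto simp: exceptional_def)
next
  case True
  note mem = dual_simplex_type_mem[OF t] and D = dual_simplex_typeD[OF t]
  have up: "insert v F \<in> C \<longleftrightarrow> \<not> {a, b} \<subseteq> F \<and> \<not> Q \<subseteq> F" if "F \<subseteq> V - {v}" for F
    using mem[of F] that unfolding link_mem by blast
  have nonface_min: "\<exists>M\<subseteq>N. M \<notin> C \<and> (\<forall>M'. M' \<subset> M \<longrightarrow> M' \<in> C)" if N: "N \<subseteq> V" "N \<notin> C" for N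
  proof -
    have "finite {M. M \<subseteq> N \<and> M \<notin> C}" using finite_subset[OF N(1) finV] by simp
    moreover have "N \<in> {M. M \<subseteq> N \<and> M \<notin> C}" using N by simp
    ultimately obtain M where M: "M \<in> {M. M \<subseteq> N \<and> M \<notin> C}" "M \<subseteq> N"
      "\<forall>M'\<in>{M. M \<subseteq> N \<and> M \<notin> C}. M' \<subseteq> M \<longrightarrow> M = M'"
      using finite_has_minimal2[of "{M. M \<subseteq> N \<and> M \<notin> C}" N] by blast
    have "M' \<in> C" if "M' \<subset> M" for M'
    proof (rule ccontr)
      assume "M' \<notin> C"
      then have "M = M'" using M that by blast
      then show False using that by simp
    qed
    then show ?thesis using M by blast
  qed
  show ?thesis
  proof (cases "\<forall>N. N \<subseteq> V \<longrightarrow> v \<notin> N \<longrightarrow> N \<notin> C \<longrightarrow> {a, b} \<subseteq> N")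
    case all: True
    have "dual_simplex_type V C {a, b} (insert v Q)"
    proof (rule dual_simplex_typeI)
      fix F
      show "F \<in> C \<longleftrightarrow> F \<subseteq> V \<and> \<not> {a, b} \<subseteq> F \<and> \<not> insert v Q \<subseteq> F"
      proof
        assume F: "F \<in> C"
        have "insert v Q \<notin> C" using up[of Q] D(2) by simp
        then show "F \<subseteq> V \<and> \<not> {a, b} \<subseteq> F \<and> \<not> insert v Q \<subseteq> F"
          using face_sub[OF F] face_down[OF F] ab(1) by blast
      next
        assume F: "F \<subseteq> V \<and> \<not> {a, b} \<subseteq> F \<and> \<not> insert v Q \<subseteq> F"
        show "F \<in> C"
        proof (cases "v \<in> F")
          case True
          then have "\<not> Q \<subseteq> F - {v}" "\<not> {a, b} \<subseteq> F - {v}" using F by auto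
          then have "insert v (F - {v}) \<in> C" using up[of "F - {v}"] F by auto
          then show ?thesis using True by (simp add: insert_absorb)
        next
          case False
          then show ?thesis using all F by blast
        qed
      qed
    next
      have "finite Q" using D(5) card.infinite by fastforce
      then show "card (insert v Q) \<ge> 2" using D(5) by (simp add: card_insert_if)
    qed (use D v in auto)
    then show ?thesis by (auto simp: exceptional_def)
  next
    case False
    then obtain N0 where N0: "N0 \<subseteq> V" "v \<notin> N0" "N0 \<notin> C" "\<not> {a, b} \<subseteq> N0" by blast
    obtain N where N: "N \<subseteq> N0" "N \<notin> C" and min: "\<And>M. M \<subset> N \<Longrightarrow> M \<in> C"
      using nonface_min[OF N0(1,3)] by blast
    have t': "dual_simplex_type (V - {v}) (vertex_link V C v) {b, a} Q"
      using t by (simp add: insert_commute)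
    have ba: "{b, a} \<notin> C" "b \<noteq> a" "v \<notin> {b, a}" using ab v by (auto simp: insert_commute)
    have avoid: "a \<notin> M \<and> b \<notin> M" if "M \<subseteq> V" "v \<notin> M" "M \<notin> C" "\<not> {a, b} \<subseteq> M" "\<And>M'. M' \<subset> M \<Longrightarrow> M' \<in> C" for M
      using link_dual_pair_no_nonface[OF v ab t that(1-3) _ that(5)]
        link_dual_pair_no_nonface[OF v(1) ba(3) ba(1,2) t' that(1-3) _ that(5)] that(4) by blast
    have NV: "N \<subseteq> V" "v \<notin> N" "\<not> {a, b} \<subseteq> N" using N N0 by blast+
    have aN: "a \<notin> N" "b \<notin> N" using avoid[OF NV(1,2) N(2) NV(3) min] by auto
    have "Q \<subseteq> N"
    proof (rule ccontr)
      assume "\<not> Q \<subseteq> N"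
      then have "insert v N \<in> C" using up[of N] NV by auto
      then show False using N(2) face_down by blast
    qed
    moreover have "N \<noteq> Q" using True N(2) by blast
    ultimately obtain r where r: "r \<in> N" "r \<notin> Q" by blast
    obtain q where q: "q \<in> Q" using card_ge_2E[OF D(5)] by blast
    have qN: "q \<in> N" "q \<noteq> r" using q r \<open>Q \<subseteq> N\<close> by auto
    \<comment> \<open>\<open>N\<close> strictly contains the face \<open>Q\<close>, so it has a
      point \<open>r\<close> outside \<open>Q\<close>. Removing \<open>q\<close> and
      \<open>r\<close> leaves a face in whose link \<open>q\<close>, \<open>a\<close>,
      \<open>r\<close>, \<open>v\<close>, \<open>b\<close> form \<open>J1\<close>.\<close>
    define R where "R = N - {q, r}"
    have R: "q \<notin> R" "r \<notin> R" "a \<notin> R" "b \<notin> R" "v \<notin> R" "R \<subseteq> V" "insert q (insert r R) = N"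
      using aN NV qN r by (auto simp: R_def)
    have QR: "Q \<subseteq> insert q R" using \<open>Q \<subseteq> N\<close> r by (auto simp: R_def)
    have abV: "a \<in> V" "b \<in> V" using D(1) by auto
    have ne: "a \<noteq> q" "a \<noteq> r" "b \<noteq> q" "b \<noteq> r" "v \<noteq> q" "v \<noteq> r" using aN NV qN r by auto
    have rv: "insert v (insert x (insert r R)) \<in> C" if "x \<in> {a, b}" for x
      using up[of "insert x (insert r R)"] that abV NV r R(1,3,4,5,6) v ab(2) ne q qN by auto
    \<comment> \<open>A minimal nonface inside this set avoids \<open>a\<close> and
      \<open>b\<close>, so it would be a proper subset of the minimal nonface
      \<open>N\<close>.\<close>
    have xq: "insert x (insert q R) \<in> C" if x: "x \<in> {a, b}" for x
    proof (rule ccontr)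
      assume nf: "insert x (insert q R) \<notin> C"
      have sub: "insert x (insert q R) \<subseteq> V" "v \<notin> insert x (insert q R)" "\<not> {a, b} \<subseteq> insert x (insert q R)"
        using x abV NV qN R v ne ab(2) by auto
      obtain M where M: "M \<subseteq> insert x (insert q R)" "M \<notin> C" "\<And>M'. M' \<subset> M \<Longrightarrow> M' \<in> C"
        using nonface_min[OF sub(1) nf] by blast
      have "a \<notin> M \<and> b \<notin> M"
        by (rule avoid) (use M sub in blast)+
      then have "M \<subseteq> insert q R" using M(1) x by blast
      moreover have "insert q R \<subset> N" using R(2,7) qN r by blast
      ultimately show False using M(2) min by blast
    qed
    have False
    proof (rule J1_free_link[OF sc av, of q a r v b R])
      show "distinct [q, a, r, v, b]" using ne qN ab(2) v by auto
      show "{q, a, r, v, b} \<inter> R = {}" using R by auto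
      show "{q, a} \<union> R \<in> C" "{q, b} \<union> R \<in> C" using xq[of a] xq[of b] by (auto simp: insert_commute)
      show "{a, r, v} \<union> R \<in> C" "{r, v, b} \<union> R \<in> C" using rv[of a] rv[of b] by (auto simp: insert_commute)
      show "{q, r} \<union> R \<notin> C" using R(7) N(2) by simp
      have "insert v (insert q R) \<notin> C" using up[of "insert q R"] QR NV qN R ne by auto
      then show "{q, v} \<union> R \<notin> C" by (simp add: insert_commute)
      show "{a, b} \<union> R \<notin> C" using ab(1) face_down[of "{a, b} \<union> R" "{a, b}"] by blast
    qed
    then show ?thesis ..
  qed
qed

end

section \<open>Non-edges in general\<close>

context reduced_avoiding
begin

text \<open>The point \<open>p\<close> would be another vertex outside both sets of non-neighbours,
  so its link is known as well. Comparing the sides on which the vertices place each other leads to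
  \<open>J1_dual\<close>.\<close>

lemma links_two_simplex_closed:
  assumes ab: "a \<in> V" "b \<in> V" "a \<in> nonnb b"
    and lty: "\<And>x. x \<in> V - nonnb a - nonnb b \<Longrightarrow>
      two_simplex_type (V - {x}) (vertex_link V C x) (P x) (Q x) \<and> a \<in> P x \<and> b \<in> Q x"
    and v: "v \<in> V - nonnb a - nonnb b" and p: "p \<in> P v"
  shows "p \<in> nonnb b"
proof (rule ccontr)
  assume pb: "p \<notin> nonnb b"
  let ?X = "V - nonnb a - nonnb b"
  have ba: "b \<in> nonnb a" using nonnb_sym ab by blast
  have abX: "a \<notin> ?X" "b \<notin> ?X" using ab ba by auto
  have D: "P x \<subseteq> V - {x}" "Q x \<subseteq> V - {x}" "P x \<inter> Q x = {}" "a \<in> P x" "b \<in> Q x" "card (Q x) \<ge> 2" if "x \<in> ?X" for x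
    using two_simplex_typeD[OF conjunct1[OF lty[OF that]]] lty[OF that] by simp_all
  have up: "{x, y, z} \<in> C \<longleftrightarrow> {y, z} \<inter> P x = {} \<or> {y, z} \<inter> Q x = {}" if "x \<in> ?X" "y \<in> V - {x}" "z \<in> V - {x}" for x y z
  proof -
    have "two_simplex_type (V - {x}) (vertex_link V C x) (P x) (Q x)" using lty[OF that(1)] by blast
    from two_simplex_type_mem[OF this, of "{y, z}"] show ?thesis using that(2,3) unfolding link_mem by simp
  qed
  have sep: "{x, y, z} \<notin> C" if x: "x \<in> ?X" and "y \<in> P x" "z \<in> Q x" for x y z
    using up[OF x, of y z] D(1,2)[OF x] that by blast
  have same: "{x, y, z} \<in> C" if x: "x \<in> ?X" and yz: "y \<in> Q x" "z \<in> Q x" for x y z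
  proof -
    have "y \<in> V - {x}" "z \<in> V - {x}" using D(2)[OF x] yz by auto
    moreover have "{y, z} \<inter> P x = {}" using D(3)[OF x] yz by auto
    ultimately show ?thesis using up[OF x, of y z] by simp
  qed
  have same': "{x, y, z} \<in> C" if x: "x \<in> ?X" and yz: "y \<in> P x" "z \<in> P x" for x y z
  proof -
    have "y \<in> V - {x}" "z \<in> V - {x}" using D(1)[OF x] yz by auto
    moreover have "{y, z} \<inter> Q x = {}" using D(3)[OF x] yz by auto
    ultimately show ?thesis using up[OF x, of y z] by simp
  qed
  have toP: "y \<in> P x" if x: "x \<in> ?X" and n: "{x, y, z} \<notin> C" and z: "z \<in> Q x" and y: "y \<in> V - {x}" for x y z
    using up[OF x y, of z] n z D(2,3)[OF x] by auto
  have toQ: "z \<in> Q x" if x: "x \<in> ?X" and n: "{x, y, z} \<notin> C" and y: "y \<in> P x" and z: "z \<in> V - {x}" for x y z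
    using up[OF x _ z, of y] n y D(1,3)[OF x] by auto
  have Bsub: "y \<in> Q x" if x: "x \<in> ?X" and y: "y \<in> nonnb a" for x y
  proof (rule toQ[OF x])
    show "{x, a, y} \<notin> C" using nonnbD(3)[OF y] face_down[of "{x, a, y}" "{y, a}"] by blast
    show "a \<in> P x" using D(4)[OF x] .
    show "y \<in> V - {x}" using x y nonnbD(1) by blast
  qed
  have pX: "p \<in> ?X" using p pb D(1,3)[OF v] Bsub[OF v] by blast
  have vp: "v \<noteq> p" using p D(1)[OF v] by blast
  have vV: "v \<in> V" and pV: "p \<in> V" using v pX by auto
  \<comment> \<open>A point \<open>q\<close> violating this would also have a link of the first
    shape. The missing triangle on \<open>v\<close>, \<open>p\<close>, \<open>q\<close> is then
    propagated: \<open>v\<close> lies in \<open>P p\<close>, so \<open>q\<close> lies in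
    \<open>Q p\<close>, so \<open>p\<close> and \<open>v\<close> both lie in \<open>Q q\<close>,
    which makes the triangle a face.\<close>
  have QB: "q \<in> nonnb a" if q: "q \<in> Q v" for q
  proof (rule ccontr)
    assume qa: "q \<notin> nonnb a"
    have qb: "q \<notin> nonnb b"
    proof
      assume qb: "q \<in> nonnb b"
      have "q \<in> P v"
      proof (rule toP[OF v])
        show "{v, q, b} \<notin> C" using nonnbD(3)[OF qb] face_down[of "{v, q, b}" "{q, b}"] by blast
        show "b \<in> Q v" using D(5)[OF v] .
        show "q \<in> V - {v}" using q D(2)[OF v] by blast
      qed
      then show False using q D(3)[OF v] by blast
    qed
    have qX: "q \<in> ?X" using q qa qb D(2)[OF v] by blast
    have ne: "q \<noteq> v" "q \<noteq> p" using q p D(2,3)[OF v] by auto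
    have vpb: "{p, v, b} \<notin> C" using sep[OF v p D(5)[OF v]] by (simp add: insert_commute)
    have vqa: "{q, a, v} \<notin> C" using sep[OF v D(4)[OF v] q] by (simp add: insert_commute)
    have vpq: "{p, v, q} \<notin> C" using sep[OF v p q] by (simp add: insert_commute)
    have "v \<in> P p" by (rule toP[OF pX vpb D(5)[OF pX]]) (use vV vp in blast)
    then have "q \<in> Q p" by (rule toQ[OF pX vpq]) (use qX ne in blast)
    then have "{q, a, p} \<notin> C" using sep[OF pX D(4)[OF pX], of q] by (simp add: insert_commute)
    then have "p \<in> Q q" by (rule toQ[OF qX _ D(4)[OF qX]]) (use pV ne in blast)
    moreover have "v \<in> Q q" by (rule toQ[OF qX vqa D(4)[OF qX]]) (use vV ne in blast)
    ultimately have "{q, p, v} \<in> C" using same[OF qX] by blast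
    then show False using vpq by (simp add: insert_commute)
  qed
  \<comment> \<open>The side \<open>Q v\<close> has at least two points, and by \<open>QB\<close>
    the point \<open>b'\<close> is a further non-neighbour of \<open>a\<close>, as
    \<open>J1_dual\<close> requires.\<close>
  obtain b' where b': "b' \<in> Q v" "b' \<noteq> b" using card_ge_2E[OF D(6)[OF v]] by blast
  then have b'a: "b' \<in> nonnb a" using QB by blast
  show False
  proof (rule J1_dual_free[OF sc av, of a b v p b'])
    have "a \<noteq> b'" using nonnbD(2)[OF b'a] by blast
    moreover have "v \<noteq> b'" "p \<noteq> b'" using v pX b'a by auto
    ultimately show "distinct [a, b, v, p, b']" using vp v pX abX b'(2) nonnbD(2)[OF ab(3)] by auto
    show "{a, v, p} \<in> C" using same'[OF v p D(4)[OF v]] by (simp add: insert_commute)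
    show "{b, v, b'} \<in> C" using same[OF v b'(1) D(5)[OF v]] by (simp add: insert_commute)
    show "{b, p, b'} \<in> C" using same[OF pX Bsub[OF pX b'a] D(5)[OF pX]] by (simp add: insert_commute)
    show "{a, b} \<notin> C" "{a, b'} \<notin> C" using nonnbD(3)[OF ab(3)] nonnbD(3)[OF b'a] by (auto simp: insert_commute)
    show "{b, v, p} \<notin> C" using sep[OF v p D(5)[OF v]] by (simp add: insert_commute)
    show "{v, p, b'} \<notin> C" using sep[OF v p b'(1)] .
  qed
qed

text \<open>In a reduced complex \<open>V - {a}\<close> is never a face. The disjunction fits the
  application, where that face is derived from the assumption that \<open>nonnb b\<close> is
  \<open>{a}\<close>.\<close>

lemma nonnb_ge_2:
  assumes ab: "a \<in> V" "a \<in> nonnb b" and co: "V - {a} \<in> C \<or> nonnb b \<noteq> {a}"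
  shows "card (nonnb b) \<ge> 2"
proof -
  have "finite (nonnb b)" by (rule finite_subset[OF _ finV]) (auto simp: nonnb_def)
  then show ?thesis using card_ge_2I[of "nonnb b" a] ab co co_vertex by blast
qed

lemma nonedge_exceptional:
  assumes ab: "a \<in> V" "b \<in> V" "a \<in> nonnb b"
  shows "exceptional V C"
proof -
  have ba: "b \<in> nonnb a" using nonnb_sym ab by blast
  define X where "X = V - nonnb a - nonnb b"
  have subV: "nonnb x \<subseteq> V" for x by (auto simp: nonnb_def)
  have disj: "nonnb b \<inter> nonnb a = {}" using nonnb_disj[OF ab] by blast
  have nonface: "F \<notin> C" if "F \<inter> nonnb b \<noteq> {}" "F \<inter> nonnb a \<noteq> {}" for F
  proof -
    obtain x y where "x \<in> F" "x \<in> nonnb b" "y \<in> F" "y \<in> nonnb a" using \<open>F \<inter> nonnb b \<noteq> {}\<close> \<open>F \<inter> nonnb a \<noteq> {}\<close> by blast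
    then show ?thesis using nonnb_product[OF ab, of x y] face_down[of F "{x, y}"] by blast
  qed
  \<comment> \<open>\<open>X\<close> is what lies outside the component of \<open>{a, b}\<close> in
    the non-edge graph. If no non-edge joins two points of \<open>X\<close>, each of them is
    adjacent to all vertices, so its link is covered by the induction hypothesis.\<close>
  consider (empty) "X = {}" | (two) c d where "c \<in> X" "d \<in> X" "c \<in> nonnb d"
    | (clique) "X \<noteq> {}" "\<And>c d. c \<in> X \<Longrightarrow> d \<in> X \<Longrightarrow> c \<notin> nonnb d" by blast
  then show ?thesis
  proof cases
    case empty
    then have V: "V = nonnb b \<union> nonnb a" using subV by (auto simp: X_def)
    have "V - {a} \<in> C" if "nonnb b = {a}"
    proof -
      have "V - {a} \<subseteq> nonnb a" using V that by auto
      then show ?thesis by (rule face_down[OF nonnb_face[OF ab(1)]])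
    qed
    moreover have "V - {b} \<in> C" if "nonnb a = {b}"
    proof -
      have "V - {b} \<subseteq> nonnb b" using V that by auto
      then show ?thesis by (rule face_down[OF nonnb_face[OF ab(2)]])
    qed
    ultimately have card: "card (nonnb b) \<ge> 2" "card (nonnb a) \<ge> 2"
      using nonnb_ge_2[OF ab(1,3)] nonnb_ge_2[OF ab(2) ba] by blast+
    have "two_simplex_type V C (nonnb b) (nonnb a)"
    proof (rule two_simplex_typeI[OF subV subV disj card])
      fix F
      show "F \<in> C \<longleftrightarrow> F \<subseteq> V \<and> (F \<inter> nonnb b = {} \<or> F \<inter> nonnb a = {})"
      proof
        assume "F \<in> C"
        then show "F \<subseteq> V \<and> (F \<inter> nonnb b = {} \<or> F \<inter> nonnb a = {})" using nonface[of F] face_sub by blast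
      next
        assume "F \<subseteq> V \<and> (F \<inter> nonnb b = {} \<or> F \<inter> nonnb a = {})"
        then have "F \<subseteq> nonnb a \<or> F \<subseteq> nonnb b" using V by blast
        then show "F \<in> C" using face_down[OF nonnb_face[OF ab(1)]] face_down[OF nonnb_face[OF ab(2)]] by blast
      qed
    qed
    then show ?thesis unfolding exceptional_def by blast
  next
    case (two c d)
    then show ?thesis using two_nonedges[OF ab, of c d] by (simp add: X_def)
  next
    case clique
    have adj: "{v, w} \<in> C" if v: "v \<in> X" and w: "w \<in> V" for v w
    proof (cases "w \<in> X")
      case True
      then have "v \<notin> nonnb w" using clique(2) v by blast
      then show ?thesis using v w vertex by (auto simp: nonnb_def X_def)
    next
      case False
      then have "w \<in> nonnb a \<union> nonnb b" using w by (auto simp: X_def)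
      then show ?thesis using nonnb_rest[OF ab, of v w] v by (simp add: X_def)
    qed
    have XV: "v \<in> V" "v \<noteq> a" "v \<noteq> b" if "v \<in> X" for v using that ab ba by (auto simp: X_def)
    have abL: "{a, b} \<notin> vertex_link V C v" for v
      using nonnbD(3)[OF ab(3)] face_down[of "insert v {a, b}" "{a, b}"] unfolding link_mem by blast
    show ?thesis
    proof (cases "\<exists>v\<in>X. \<exists>P Q. dual_simplex_type (V - {v}) (vertex_link V C v) P Q")
      case True
      then obtain v P Q where v: "v \<in> X" and t: "dual_simplex_type (V - {v}) (vertex_link V C v) P Q"
        by blast
      \<comment> \<open>The non-edge \<open>{a, b}\<close> is missing from the link as well, so it
        contains one of the two minimal nonfaces, and by size it equals that one.\<close>
      have "P \<subseteq> {a, b} \<or> Q \<subseteq> {a, b}" using abL[of v] XV[OF v] ab by (simp add: dual_simplex_type_mem[OF t])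
      then have "P = {a, b} \<or> Q = {a, b}"
        using subset_pair_card_2[of P a b] subset_pair_card_2[of Q a b] dual_simplex_typeD(4,5)[OF t] by blast
      then obtain Q' where t': "dual_simplex_type (V - {v}) (vertex_link V C v) {a, b} Q'"
        using t dual_simplex_type_sym[OF t] by blast
      show ?thesis
        by (rule link_dual_pair[OF XV(1)[OF v] _ nonnbD(3)[OF ab(3)] nonnbD(2)[OF ab(3)] t']) (use XV[OF v] in blast)
    next
      case False
      have "\<exists>P Q. two_simplex_type (V - {v}) (vertex_link V C v) P Q \<and> a \<in> P \<and> b \<in> Q" if v: "v \<in> X" for v
      proof -
        obtain P Q where t: "two_simplex_type (V - {v}) (vertex_link V C v) P Q"
          using link_exceptional[OF XV(1)[OF v] adj[OF v]] False v unfolding exceptional_def by blast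
        have "\<not> ({a, b} \<inter> P = {} \<or> {a, b} \<inter> Q = {})"
          using abL[of v] XV[OF v] ab by (simp add: two_simplex_type_mem[OF t])
        then have "a \<in> P \<and> b \<in> Q \<or> a \<in> Q \<and> b \<in> P" using two_simplex_typeD(3)[OF t] by auto
        then show ?thesis using t two_simplex_type_sym[OF t] by blast
      qed
      then obtain P Q where lty: "\<And>v. v \<in> X \<Longrightarrow>
          two_simplex_type (V - {v}) (vertex_link V C v) (P v) (Q v) \<and> a \<in> P v \<and> b \<in> Q v"
        by metis
      have lty': "\<And>v. v \<in> V - nonnb b - nonnb a \<Longrightarrow>
          two_simplex_type (V - {v}) (vertex_link V C v) (Q v) (P v) \<and> b \<in> Q v \<and> a \<in> P v"
        using lty two_simplex_type_sym unfolding X_def by blast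
      obtain v where v: "v \<in> X" using clique(1) by blast
      then have v': "v \<in> V - nonnb b - nonnb a" by (auto simp: X_def)
      have t: "two_simplex_type (V - {v}) (vertex_link V C v) (P v) (Q v)" using lty[OF v] by blast
      note mem = two_simplex_type_mem[OF t] and D = two_simplex_typeD[OF t]
      have "P v \<subseteq> nonnb b" using links_two_simplex_closed[OF ab lty[unfolded X_def] v[unfolded X_def]] by blast
      moreover have "Q v \<subseteq> nonnb a" using links_two_simplex_closed[OF ab(2,1) ba lty' v'] by blast
      moreover have "nonnb b \<subseteq> P v"
      proof
        fix y assume y: "y \<in> nonnb b"
        have "{y, b} \<notin> vertex_link V C v"
          using nonnbD(3)[OF y] face_down[of "insert v {y, b}" "{y, b}"] unfolding link_mem by blast
        moreover have "y \<noteq> v" "y \<in> V" using y v subV by (auto simp: X_def)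
        ultimately have "\<not> ({y, b} \<inter> P v = {} \<or> {y, b} \<inter> Q v = {})" using XV[OF v] ab by (simp add: mem)
        then show "y \<in> P v" using lty[OF v] D(3) by auto
      qed
      moreover have "nonnb a \<subseteq> Q v"
      proof
        fix y assume y: "y \<in> nonnb a"
        have "{y, a} \<notin> vertex_link V C v"
          using nonnbD(3)[OF y] face_down[of "insert v {y, a}" "{y, a}"] unfolding link_mem by blast
        moreover have "y \<noteq> v" "y \<in> V" using y v subV by (auto simp: X_def)
        ultimately have "\<not> ({y, a} \<inter> P v = {} \<or> {y, a} \<inter> Q v = {})" using XV[OF v] ab by (simp add: mem)
        then show "y \<in> Q v" using lty[OF v] D(3) by auto
      qed
      ultimately have PQ: "P v = nonnb b" "Q v = nonnb a" by blast+
      have "two_simplex_type V C (nonnb b) (nonnb a)"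
      proof (rule two_simplex_typeI[OF subV subV disj])
        show "card (nonnb b) \<ge> 2" "card (nonnb a) \<ge> 2" using D(4,5) PQ by simp_all
        fix F
        show "F \<in> C \<longleftrightarrow> F \<subseteq> V \<and> (F \<inter> nonnb b = {} \<or> F \<inter> nonnb a = {})"
        proof
          assume "F \<in> C"
          then show "F \<subseteq> V \<and> (F \<inter> nonnb b = {} \<or> F \<inter> nonnb a = {})" using nonface[of F] face_sub by blast
        next
          assume F: "F \<subseteq> V \<and> (F \<inter> nonnb b = {} \<or> F \<inter> nonnb a = {})"
          then have "F - {v} \<in> vertex_link V C v" unfolding mem PQ by blast
          then have "insert v (F - {v}) \<in> C" by (simp only: link_mem)
          then show "F \<in> C" by (rule face_down) blast
        qed
      qed
      then show ?thesis unfolding exceptional_def by blast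
    qed
  qed
qed

text \<open>In the link of any \<open>v\<close>, the dual shape would make the complement of a pair
  a face. The shape of two simplices gives missing triangles that share an edge, and these do not
  fit into any exceptional deletion.\<close>

lemma some_nonedge:
  assumes E: "\<And>x y. x \<in> V \<Longrightarrow> y \<in> V \<Longrightarrow> {x, y} \<in> C" and coE: "\<And>x y. x \<in> V \<Longrightarrow> y \<in> V \<Longrightarrow> V - {x, y} \<notin> C"
  shows False
proof -
  obtain v where v: "v \<in> V" using red by (auto simp: reduced_def)
  obtain P Q where "two_simplex_type (V - {v}) (vertex_link V C v) P Q \<or>
      dual_simplex_type (V - {v}) (vertex_link V C v) P Q"
    using link_exceptional[OF v E[OF v]] unfolding exceptional_def by blast
  then show False
  proof
    assume t: "dual_simplex_type (V - {v}) (vertex_link V C v) P Q"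
    note D = dual_simplex_typeD[OF t]
    obtain p q where pq: "p \<in> P" "q \<in> Q" using card_ge_2E[OF D(4)] card_ge_2E[OF D(5)] by metis
    then have "V - {v} - {p, q} \<in> vertex_link V C v"
      unfolding dual_simplex_type_mem[OF t] by blast
    then have "insert v (V - {v} - {p, q}) \<in> C" by (simp only: link_mem)
    moreover have "insert v (V - {v} - {p, q}) = V - {p, q}" using pq D(1,2) v by auto
    ultimately show False using coE[of p q] pq D(1,2) by auto
  next
    assume t: "two_simplex_type (V - {v}) (vertex_link V C v) P Q"
    note D = two_simplex_typeD[OF t]
    obtain p where p: "p \<in> P" using card_ge_2E[OF D(4)] by metis
    obtain p' where p': "p' \<in> P" "p' \<noteq> p" using card_ge_2E[OF D(4)] by metis
    obtain q where q: "q \<in> Q" using card_ge_2E[OF D(5)] by metis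
    obtain q' where q': "q' \<in> Q" "q' \<noteq> q" using card_ge_2E[OF D(5)] by metis
    have inV: "p \<in> V" "p' \<in> V" "q \<in> V" "q' \<in> V" "p \<noteq> v" "p' \<noteq> v" "q \<noteq> v" "q' \<noteq> v" using p p' q q' D(1,2) by auto
    have ne: "p \<noteq> q" "p \<noteq> q'" "p' \<noteq> q" "p' \<noteq> q'" using p p' q q' D(3) by auto
    have tri: "{v, p, y} \<notin> C" if y: "y \<in> {q, q'}" for y
    proof -
      have "y \<in> Q" using y q q' by blast
      then have "{p, y} \<notin> vertex_link V C v"
        unfolding two_simplex_type_mem[OF t] using p by blast
      moreover have "{p, y} \<subseteq> V - {v}" using y inV by blast
      ultimately show ?thesis unfolding link_mem by blast
    qed
    \<comment> \<open>Deleting \<open>p'\<close> keeps \<open>v\<close>, \<open>p\<close>,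
      \<open>q\<close>, \<open>q'\<close>. The deletion is reduced because complements of pairs are
      nonfaces, so the induction hypothesis applies to it.\<close>
    let ?W = "V - {p'}" and ?D = "minor_faces C (V - {p'}) {}"
    have Dmem: "F \<in> ?D \<longleftrightarrow> F \<in> C \<and> F \<subseteq> ?W" for F by (auto simp: minor_faces_def)
    have "exceptional ?W ?D"
    proof (rule IH)
      show "card ?W < card V" using inV(2) finV by (rule card_Diff1_less[rotated])
      show "simplicial_complex ?W ?D" by (rule cx_minor_faces[OF sc]) blast
      show "beta_avoiding ?W ?D"
        by (rule avoiding_minor[OF sc av]) (use face_down[OF vertex[OF v]] in auto)
      have "?W - {w} \<notin> C" if "w \<in> ?W" for w
      proof -
        have "?W - {w} = V - {p', w}" by blast
        then show ?thesis using coE[of p' w] inV that by simp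
      qed
      then show "reduced ?W ?D" unfolding reduced_def Dmem using vertex v inV(6) by auto
    qed
    then obtain P' Q' where "two_simplex_type ?W ?D P' Q' \<or> dual_simplex_type ?W ?D P' Q'"
      unfolding exceptional_def by blast
    then show False
    proof
      assume t': "two_simplex_type ?W ?D P' Q'"
      note D' = two_simplex_typeD[OF t']
      obtain x y where xy: "x \<in> P'" "y \<in> Q'" using card_ge_2E[OF D'(4)] card_ge_2E[OF D'(5)] by metis
      then have "{x, y} \<notin> ?D" unfolding two_simplex_type_mem[OF t'] by blast
      moreover have "{x, y} \<subseteq> ?W" "x \<in> V" "y \<in> V" using xy D'(1,2) by auto
      ultimately show False using E[of x y] unfolding Dmem by blast
    next
      assume t': "dual_simplex_type ?W ?D P' Q'"
      note D' = dual_simplex_typeD[OF t']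
      \<comment> \<open>All pairs are faces, so a nonface inside such a triple is the whole triple.
        Hence \<open>{v, p, q}\<close> and \<open>{v, p, q'}\<close> would be the two disjoint sets
        \<open>P'\<close> and \<open>Q'\<close>, although both contain \<open>v\<close>.\<close>
      have full: "S = {v, p, y}" if S: "S \<subseteq> {v, p, y}" "S \<notin> C" and y: "y \<in> {q, q'}" for S y
      proof (rule ccontr)
        assume "S \<noteq> {v, p, y}"
        then have "S \<subseteq> {v, p} \<or> S \<subseteq> {v, y} \<or> S \<subseteq> {p, y}" using S(1) by blast
        moreover have "y \<in> V" using y inV by blast
        ultimately show False using S(2) face_down E v inV(1) by metis
      qed
      have PQ': "P' \<notin> C" "Q' \<notin> C" using dual_simplex_type_mem[OF t', of P'] dual_simplex_type_mem[OF t', of Q'] D'(1,2)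
        unfolding Dmem by blast+
      have one: "P' = {v, p, y} \<or> Q' = {v, p, y}" if y: "y \<in> {q, q'}" for y
      proof -
        have "{v, p, y} \<subseteq> ?W" using y v inV ne p' by auto
        moreover have "{v, p, y} \<notin> ?D" using tri[OF y] unfolding Dmem by blast
        ultimately have "P' \<subseteq> {v, p, y} \<or> Q' \<subseteq> {v, p, y}" unfolding dual_simplex_type_mem[OF t'] by blast
        then show ?thesis using full[OF _ PQ'(1) y] full[OF _ PQ'(2) y] by blast
      qed
      have "{v, p, q} \<noteq> {v, p, q'}" using q'(2) ne inV by auto
      moreover have "P' = {v, p, q} \<or> Q' = {v, p, q}" "P' = {v, p, q'} \<or> Q' = {v, p, q'}"
        using one[of q] one[of q'] by simp_all
      ultimately have "v \<in> P' \<inter> Q'" by auto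
      then show False using D'(3) by simp
    qed
  qed
qed

end

section \<open>Induction on the size of reduced complexes\<close>

lemma reduced_dual:
  assumes "C \<subseteq> Pow V" "reduced V C" shows "reduced V (dual_faces V C)"
proof -
  have "V - (V - {v}) = {v}" if "v \<in> V" for v using that by auto
  then show ?thesis using assms(2) by (auto simp: reduced_def dual_faces_def)
qed

theorem reduced_avoiding_exceptional:
  fixes V :: "'a set"
  assumes "simplicial_complex V C" "beta_avoiding V C" "reduced V C"
  shows "exceptional V C"
  using assms
proof (induction "card V" arbitrary: V C rule: less_induct)
  case (less V C)
  have IH: "exceptional W D" if "card W < card V" "simplicial_complex W D" "beta_avoiding W D" "reduced W D"
    for W :: "'a set" and D using less.hyps[OF that] .
  interpret prim: reduced_avoiding V C by unfold_locales (use less.prems IH in auto)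
  have CV: "C \<subseteq> Pow V" using prim.face_sub by blast
  \<comment> \<open>The hypothesis quantifies over all smaller complexes, so it serves the dual
    unchanged; there \<open>nonedge_exceptional\<close> handles pairs whose complements are faces of
    \<open>C\<close>.\<close>
  interpret dual: reduced_avoiding V "dual_faces V C"
    by unfold_locales
       (use cx_dual_faces[OF less.prems(1)] avoiding_dual[OF less.prems(1,2)] reduced_dual[OF CV less.prems(3)] IH in auto)
  show ?case
  proof (cases "\<exists>x\<in>V. \<exists>y\<in>V. {x, y} \<notin> C")
    case True
    then obtain x y where xy: "x \<in> V" "y \<in> V" "{x, y} \<notin> C" by blast
    then have "x \<noteq> y" using prim.vertex by auto
    then have "x \<in> prim.nonnb y" using xy by (simp add: prim.nonnb_def)
    then show ?thesis using prim.nonedge_exceptional xy by blast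
  next
    case E: False
    show ?thesis
    proof (cases "\<exists>x\<in>V. \<exists>y\<in>V. V - {x, y} \<in> C")
      case True
      then obtain x y where xy: "x \<in> V" "y \<in> V" "V - {x, y} \<in> C" by blast
      then have n: "{x, y} \<notin> dual_faces V C" by (simp add: dual_faces_def)
      then have "x \<noteq> y" using dual.vertex[OF xy(1)] by auto
      then have "x \<in> dual.nonnb y" using xy n by (simp add: dual.nonnb_def)
      then have "exceptional V (dual_faces V C)" using dual.nonedge_exceptional xy by blast
      then show ?thesis by (rule exceptional_dual[OF CV])
    next
      case False
      then show ?thesis using prim.some_nonedge E by blast
    qed
  qed
qed

section \<open>Avoiding complexes are nuclear\<close>

text \<open>\<open>nuclear_nat\<close> lives on sets of natural numbers, so an arbitrary complex is
  first transported to \<open>{0..<card V}\<close>.\<close>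

lemma avoiding_iso:
  assumes sc: "simplicial_complex V C" and av: "beta_avoiding V C" and f: "bij_betw f V V'"
  shows "beta_avoiding V' ((`) f ` C)"
proof -
  let ?C = "(`) f ` C"
  have sub: "C \<subseteq> Pow V" using sc by (simp add: simplicial_complex_def)
  have iso: "cx_iso (V, C) (V', ?C)" using f by (auto simp: cx_iso_def)
  have sc': "simplicial_complex V' ?C" using cx_iso_simplicial[OF iso] sc by simp
  have inj: "inj_on f V" and im: "f ` V = V'" using f by (auto simp: bij_betw_def)
  have memC: "f ` X \<in> ?C \<longleftrightarrow> X \<in> C" if "X \<subseteq> V" for X
  proof
    assume "f ` X \<in> ?C"
    then obtain Y where "Y \<in> C" "f ` X = f ` Y" by blast
    then show "X \<in> C" using inj_on_image_eq_iff[OF inj, of X Y] that sub by blast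
  qed simp
  show ?thesis unfolding beta_avoiding_iff is_minor_iff[OF sc']
  proof (intro allI impI notI)
    fix M :: "'b cx"
    assume forb: "forbidden M" and "\<exists>W R. W \<inter> R = {} \<and> W \<union> R \<subseteq> V' \<and> R \<in> ?C \<and> M = (W, minor_faces ?C W R)"
    then obtain W' R' where WR': "W' \<inter> R' = {}" "W' \<union> R' \<subseteq> V'" "R' \<in> ?C" "M = (W', minor_faces ?C W' R')"
      by blast
    obtain W where W: "W \<subseteq> V" "W' = f ` W" using WR'(2) im by (metis Un_subset_iff subset_imageE)
    obtain R where R: "R \<subseteq> V" "R' = f ` R" using WR'(2) im by (metis Un_subset_iff subset_imageE)
    have "cx_iso (W, minor_faces C W R) M" unfolding WR'(4)
    proof (rule cx_isoI[of f])
      show "bij_betw f W W'" using W inj_on_subset[OF inj] by (auto simp: bij_betw_def)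
      fix X assume X: "X \<subseteq> W"
      then have "f ` X \<union> R' = f ` (X \<union> R)" using R by (simp add: image_Un)
      moreover have "X \<union> R \<subseteq> V" using X W R by blast
      ultimately show "f ` X \<in> minor_faces ?C W' R' \<longleftrightarrow> X \<in> minor_faces C W R"
        using X W memC[of "X \<union> R"] by (auto simp: minor_faces_def)
    qed (auto simp: minor_faces_def)
    then have "forbidden (W, minor_faces C W R)"
      using forb cx_iso_trans unfolding forbidden_def by blast
    moreover have "W \<inter> R = {}" using WR'(1) W R by blast
    moreover have "R \<in> C" using memC R WR'(3) by simp
    ultimately show False using avoiding_not_forbidden[OF sc av] W R by blast
  qed
qed

lemma avoiding_imp_nuclear_nat:
  fixes V :: "nat set"
  assumes "simplicial_complex V C" "beta_avoiding V C"
  shows "nuclear_nat (V, C)"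
  using assms
proof (induction "card V" arbitrary: V C rule: less_induct)
  case (less V C)
  note sc = less.prems(1) and av = less.prems(2)
  note finV = simplicial_complexD(1)[OF sc] and sub = simplicial_complexD(2)[OF sc] and down = simplicial_complexD(3)[OF sc]
  consider (empty) "V = {}" | (ghost) v where "v \<in> V" "{v} \<notin> C"
    | (lawrence) v where "v \<in> V" "{v} \<in> C" "V - {v} \<in> C" | (reduced) "reduced V C"
    unfolding reduced_def by blast
  then show ?case
  proof cases
    case empty
    then have "C = {} \<or> C = Pow {}" using sub by auto
    then show ?thesis using empty nuclear_nat.void nuclear_nat.simplex[of "{}"] by auto
  next
    case (ghost v)
    have CW: "minor_faces C (V - {v}) {} = C"
      using ghost sub down[of _ "{v}"] unfolding minor_faces_def by auto
    have "simplicial_complex (V - {v}) C" using cx_minor_faces[OF sc, of "V - {v}" "{}"] unfolding CW by blast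
    moreover from this have "beta_avoiding (V - {v}) C"
    \<comment> \<open>The void complex has no minors because the empty set is not a face; for the
      same reason \<open>avoiding_minor\<close> cannot be applied to it with
      \<open>R = {}\<close>.\<close>
    proof (cases "C = {}")
      case True
      then show ?thesis by (simp add: beta_avoiding_def is_minor_def)
    next
      case False
      then have "{} \<in> C" using down by blast
      then show ?thesis using avoiding_minor[OF sc av, of "V - {v}" "{}"] unfolding CW by blast
    qed
    moreover have "card (V - {v}) < card V" using ghost(1) finV by (rule card_Diff1_less[rotated])
    ultimately have "nuclear_nat (V - {v}, C)" using less.hyps by blast
    from nuclear_nat.ghost[OF this, of v] show ?thesis using ghost(1) by (simp add: ghost_def insert_absorb)
  next
    case (lawrence v)
    \<comment> \<open>Since \<open>?W\<close> is a face, \<open>C\<close> is determined by the faces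
      through \<open>v\<close>, so it is the Lawrence lifting of the link.\<close>
    let ?W = "V - {v}" and ?D = "vertex_link V C v"
    have "nuclear_nat (?W, ?D)"
    proof (rule less.hyps)
      show "card ?W < card V" using lawrence(1) finV by (rule card_Diff1_less[rotated])
      show "simplicial_complex ?W ?D" by (rule cx_minor_faces[OF sc]) blast
      show "beta_avoiding ?W ?D" by (rule avoiding_minor[OF sc av]) (use lawrence in auto)
    qed
    from nuclear_nat.lawrence[OF this, of v]
    have "nuclear_nat (V, {G. G \<subseteq> ?W \<or> (\<exists>F\<in>?D. G \<subseteq> insert v F)})"
      using lawrence(1) by (simp add: lawrence_def insert_absorb)
    moreover have "G \<subseteq> ?W \<or> (\<exists>F\<in>?D. G \<subseteq> insert v F) \<longleftrightarrow> G \<in> C" for G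
    proof
      assume "G \<subseteq> ?W \<or> (\<exists>F\<in>?D. G \<subseteq> insert v F)"
      then show "G \<in> C"
      proof
        assume "\<exists>F\<in>?D. G \<subseteq> insert v F"
        then obtain F where "insert v F \<in> C" "G \<subseteq> insert v F" by (auto simp: minor_faces_def)
        then show ?thesis by (rule down)
      qed (use down[OF lawrence(3)] in blast)
    next
      assume G: "G \<in> C"
      show "G \<subseteq> ?W \<or> (\<exists>F\<in>?D. G \<subseteq> insert v F)"
      proof (cases "v \<in> G")
        case True
        then have "G - {v} \<in> ?D" using G sub[OF G] unfolding link_mem by (auto simp: insert_absorb)
        moreover have "G \<subseteq> insert v (G - {v})" by blast
        ultimately show ?thesis by metis
      qed (use sub[OF G] in blast)
    qed
    ultimately show ?thesis by simp
  next
    case reduced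
    then obtain P Q where "two_simplex_type V C P Q \<or> dual_simplex_type V C P Q"
      using reduced_avoiding_exceptional[OF sc av] unfolding exceptional_def by blast
    then show ?thesis
    proof
      assume t: "two_simplex_type V C P Q"
      note D = two_simplex_typeD[OF t] and mem = two_simplex_type_mem[OF t]
      \<comment> \<open>The vertices outside both parts are apexes and serve as the new vertices of
        the cone.\<close>
      define U where "U = V - P - Q"
      have "nuclear_nat (cone U (two_simplices P Q))"
        by (rule nuclear_nat.cone_simplices) (use D finV finite_subset in \<open>auto simp: U_def\<close>)
      moreover have "cone U (two_simplices P Q) = (V, C)"
      proof -
        have "P \<union> Q \<union> U = V" using D by (auto simp: U_def)
        moreover have "(\<exists>F\<in>{G. G \<subseteq> P \<or> G \<subseteq> Q}. G \<subseteq> F \<union> U) \<longleftrightarrow> G \<in> C" for G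
        proof -
          have "(\<exists>F\<in>{G. G \<subseteq> P \<or> G \<subseteq> Q}. G \<subseteq> F \<union> U) \<longleftrightarrow> G \<subseteq> P \<union> U \<or> G \<subseteq> Q \<union> U" by blast
          also have "\<dots> \<longleftrightarrow> G \<in> C" unfolding mem U_def using D(1-3) by blast
          finally show ?thesis .
        qed
        ultimately show ?thesis by (simp add: cone_def two_simplices_def)
      qed
      ultimately show ?thesis by simp
    next
      assume t: "dual_simplex_type V C P Q"
      note D = dual_simplex_typeD[OF t] and mem = dual_simplex_type_mem[OF t]
      define U where "U = V - P - Q"
      have "nuclear_nat (cone U (alex_dual (two_simplices P Q)))"
        by (rule nuclear_nat.cone_D) (use D finV finite_subset in \<open>auto simp: U_def\<close>)
      moreover have "cone U (alex_dual (two_simplices P Q)) = (V, C)"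
      proof -
        have "P \<union> Q \<union> U = V" using D by (auto simp: U_def)
        moreover have "(\<exists>F\<in>{S. S \<subseteq> P \<union> Q \<and> \<not> P \<subseteq> S \<and> \<not> Q \<subseteq> S}. G \<subseteq> F \<union> U) \<longleftrightarrow> G \<in> C" for G
        proof
          assume "\<exists>F\<in>{S. S \<subseteq> P \<union> Q \<and> \<not> P \<subseteq> S \<and> \<not> Q \<subseteq> S}. G \<subseteq> F \<union> U"
          then obtain F where "F \<subseteq> P \<union> Q" "\<not> P \<subseteq> F" "\<not> Q \<subseteq> F" "G \<subseteq> F \<union> U" by blast
          then show "G \<in> C" unfolding mem U_def using D(1,2) by blast
        next
          assume "G \<in> C"
          then have "G \<subseteq> V" "\<not> P \<subseteq> G \<inter> (P \<union> Q)" "\<not> Q \<subseteq> G \<inter> (P \<union> Q)" unfolding mem by auto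
          moreover from this have "G \<subseteq> G \<inter> (P \<union> Q) \<union> U" by (auto simp: U_def)
          ultimately show "\<exists>F\<in>{S. S \<subseteq> P \<union> Q \<and> \<not> P \<subseteq> S \<and> \<not> Q \<subseteq> S}. G \<subseteq> F \<union> U" by blast
        qed
        ultimately show ?thesis by (simp add: cone_def alex_dual_two_simplices[OF D(3)])
      qed
      ultimately show ?thesis by simp
    qed
  qed
qed

lemma beta_avoiding_imp_nuclear:
  assumes sc: "simplicial_complex V C" and av: "beta_avoiding V C"
  shows "nuclear V C"
proof -
  obtain f where f: "bij_betw f V {0..<card V}"
    using ex_bij_betw_finite_nat[OF simplicial_complexD(1)[OF sc]] by blast
  have iso: "cx_iso (V, C) ({0..<card V}, (`) f ` C)" using f by (auto simp: cx_iso_def)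
  have "nuclear_nat ({0..<card V}, (`) f ` C)"
    using avoiding_imp_nuclear_nat[OF _ avoiding_iso[OF sc av f]] cx_iso_simplicial[OF iso] sc by simp
  then show ?thesis using iso by (auto simp: nuclear_def)
qed

theorem theorem6p3:
  fixes V :: "'a set" and C :: "'a set set"
  assumes "simplicial_complex V C"
  shows "(unimodular V C \<longleftrightarrow> beta_avoiding V C) \<and> (beta_avoiding V C \<longleftrightarrow> nuclear V C)"
  using unimodular_imp_beta_avoiding[OF assms] beta_avoiding_imp_nuclear[OF assms]
    nuclear_imp_unimodular[OF assms] by blast

end
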